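(* Let $\mathbf{S5Alg}_{\mathrm{fin}}$ be the category of finite S5-algebras and homomorphisms, regarded as a category with finite limits. Then $\mathbf{S5Alg}_{\mathrm{fin}}$ classifies the models of the theory $T_2$ and their homomorphisms as $\mathcal{L}$-structures; that is, the category $\mathrm{Lex}(\mathbf{S5Alg}_{\mathrm{fin}},\mathbf{Set})$ of finite-limit-preserving functors $\mathbf{S5Alg}_{\mathrm{fin}}\to\mathbf{Set}$ and natural transformations is equivalent to the category of models of $T_2$ and $\mathcal{L}$-homomorphisms.
   Context: **S5-algebras.** An S5-algebra is a Boolean algebra with a unary operator $\Box$ such that $\Box\top=\top$, $\Box(x\wedge y)=\Box x\wedge\Box y$, $\Box x\le x$, $x\le\Box\Diamond x$, where $\Diamond x:=\neg\Box\neg x$. Homomorphisms are Boolean homomorphisms commuting with $\Box$. The category $\mathbf{S5Alg}_{\mathrm{fin}}$ is essentially small (replace it by a small skeleton where needed). **Language $\mathcal{L}$.** For a positive integer $n$ let $\underline{n}=\{1,\dots,n\}$, and let $S_n$ be the group of permutations of $\underline{n}$. $\mathcal{L}$ is the multi-sorted first-order language with equality whose sorts are the positive integers, with one unary function symbol $f$ taking arguments of sort $n$ to values of sort $m$ for every surjective function $f\colon\underline{m}\to\underline{n}$ (note the reversal of direction). An $\mathcal{L}$-structure $M$ thus consists of sets $M_n$ ($n\ge 1$) and functions $M(f)\colon M_n\to M_m$ for every surjection $f\colon\underline{m}\to\underline{n}$. A homomorphism $M\to N$ of $\mathcal{L}$-structures is a family of functions $M_n\to N_n$ commuting with all the operations.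 For $x$ of sort $n$, "$\mathrm{Fix}(x)=1$" abbreviates the formula $\bigwedge\{\neg(\sigma(x)=x) \mid \sigma\in S_n\setminus\{1\}\}$. **Theory $T_2$.** The models of $T_2$ are the $\mathcal{L}$-structures satisfying the following (classical first-order) axioms. (1) $1(x)=x$ and $f(g(x))=(g\circ f)(x)$, for every $n\ge1$, $x$ of sort $n$, $1$ the identity of $\underline{n}$, and all surjections $\underline{r}\xrightarrow{f}\underline{m}\xrightarrow{g}\underline{n}$. (5) For every $n\ge 1$ and every $x$ of sort $n$: there is exactly one $m\le n$ such that $\bigvee\{\exists y\,(f(y)=x\wedge\mathrm{Fix}(y)=1)\mid f\colon\underline{n}\to\underline{m}\text{ surjective}\}$ holds (with $y$ of sort $m$). (6) For all surjections $q_1,q_2\colon\underline{n}\to\underline{m}$ and all $x_1,x_2$ of sort $m$: $$\bigl(\mathrm{Fix}(x_1)=1\wedge\mathrm{Fix}(x_2)=1\wedge q_1(x_1)=q_2(x_2)\bigr)\to\bigvee\{\sigma(x_1)=x_2\mid\sigma\in S_m,\ \sigma\circ q_2=q_1\}.$$ **Meaning of (5) and (6).** By (1), $M$ is a presheaf on the category of the sets $\underline{n}$ ($n\ge1$) and surjections, and each $M_n$ carries the (right) action $(\sigma,x)\mapsto M(\sigma)(x)$ of $S_n$. Let $M'_n=\{x\in M_n\mid M(\sigma)(x)\neq x\text{ for all }\sigma\ne1\}$, with restricted action $a'_n$. Axioms (5) and (6) express that $M$ is the disjoint union of the canonical liftings of the actions $a'_n$, $n\ge1$. Here a presheaf $L$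 is a canonical lifting of an action $a\colon S_m\times X\to X$ if (i) there is a bijection $\eta\colon X\to L_m$; (ii) for every $n$, the images of the maps $L(q)$, for $q\colon\underline{n}\to\underline{m}$ surjective, cover $L_n$; (iii) for all surjections $q_1,q_2\colon\underline{n}\to\underline{m}$ and $x_1,x_2\in X$, $L(q_1)(\eta(x_1))=L(q_2)(\eta(x_2))$ iff there is $\sigma\in S_m$ with $a(\sigma,x_1)=x_2$ and $\sigma\circ q_2=q_1$.
   Formalization: The listed S5 axioms omit transitivity (they define KTB-algebras, for which the claim is false); the axiom □x ≤ □□x is added. Set is taken as the category of all subsets of an arbitrary infinite universe, with the models' sorts in the same universe. *)

theory Defs
  imports "HOL-Algebra.Bij"
begin

section \<open>Categories\<close>

text \<open>
  Arrows are only meaningful relative to a chosen domain and codomain (hom-sets need not be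
  disjoint), so composition takes the three objects as arguments:
  \<open>Comp C X Y Z g f\<close> is \<open>g \<circ> f\<close> for \<open>f : X \<rightarrow> Y\<close> and \<open>g : Y \<rightarrow> Z\<close>.
\<close>

record ('o, 'm) precategory =
  Obj :: "'o set"
  Hom :: "'o \<Rightarrow> 'o \<Rightarrow> 'm set"
  Id :: "'o \<Rightarrow> 'm"
  Comp :: "'o \<Rightarrow> 'o \<Rightarrow> 'o \<Rightarrow> 'm \<Rightarrow> 'm \<Rightarrow> 'm"

locale category =
  fixes C :: "('o, 'm) precategory"
  assumes Id_in_Hom: "X \<in> Obj C \<Longrightarrow> Id C X \<in> Hom C X X"
    and Comp_in_Hom:
      "\<lbrakk>X \<in> Obj C; Y \<in> Obj C; Z \<in> Obj C; f \<in> Hom C X Y; g \<in> Hom C Y Z\<rbrakk>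
        \<Longrightarrow> Comp C X Y Z g f \<in> Hom C X Z"
    and Comp_Id: "\<lbrakk>X \<in> Obj C; Y \<in> Obj C; f \<in> Hom C X Y\<rbrakk> \<Longrightarrow> Comp C X X Y f (Id C X) = f"
    and Id_Comp: "\<lbrakk>X \<in> Obj C; Y \<in> Obj C; f \<in> Hom C X Y\<rbrakk> \<Longrightarrow> Comp C X Y Y (Id C Y) f = f"
    and Comp_assoc:
      "\<lbrakk>W \<in> Obj C; X \<in> Obj C; Y \<in> Obj C; Z \<in> Obj C;
        f \<in> Hom C W X; g \<in> Hom C X Y; h \<in> Hom C Y Z\<rbrakk>
        \<Longrightarrow> Comp C W Y Z h (Comp C W X Y g f) = Comp C W X Z (Comp C X Y Z h g) f"

definition is_iso :: "('o, 'm) precategory \<Rightarrow> 'o \<Rightarrow> 'o \<Rightarrow> 'm \<Rightarrow> bool" where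
  "is_iso C X Y f \<longleftrightarrow> f \<in> Hom C X Y \<and>
    (\<exists>g \<in> Hom C Y X. Comp C X Y X g f = Id C X \<and> Comp C Y X Y f g = Id C Y)"

record ('o, 'm, 'p, 'n) cfunctor =
  FObj :: "'o \<Rightarrow> 'p"
  FArr :: "'o \<Rightarrow> 'o \<Rightarrow> 'm \<Rightarrow> 'n"

text \<open>
  The behaviour of a functor outside the objects and hom-sets of its domain is left arbitrary.
  Functors that differ only there are distinct but isomorphic as objects of a functor category,
  which is harmless up to equivalence.  The same remark applies to the algebras and structures
  below.  Morphisms, in contrast, are always made extensional, so that their equality is the
  intended one.
\<close>

definition is_functor ::
  "('o, 'm) precategory \<Rightarrow> ('p, 'n) precategory \<Rightarrow> ('o, 'm, 'p, 'n) cfunctor \<Rightarrow> bool" where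
  "is_functor C D F \<longleftrightarrow>
    (\<forall>X \<in> Obj C. FObj F X \<in> Obj D) \<and>
    (\<forall>X \<in> Obj C. \<forall>Y \<in> Obj C. \<forall>f \<in> Hom C X Y. FArr F X Y f \<in> Hom D (FObj F X) (FObj F Y)) \<and>
    (\<forall>X \<in> Obj C. FArr F X X (Id C X) = Id D (FObj F X)) \<and>
    (\<forall>X \<in> Obj C. \<forall>Y \<in> Obj C. \<forall>Z \<in> Obj C. \<forall>f \<in> Hom C X Y. \<forall>g \<in> Hom C Y Z.
      FArr F X Z (Comp C X Y Z g f) =
        Comp D (FObj F X) (FObj F Y) (FObj F Z) (FArr F Y Z g) (FArr F X Y f))"

definition id_functor :: "('o, 'm, 'o, 'm) cfunctor" where
  "id_functor = \<lparr>FObj = (\<lambda>X. X), FArr = (\<lambda>X Y f. f)\<rparr>"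

definition comp_functor ::
  "('p, 'n, 'q, 'k) cfunctor \<Rightarrow> ('o, 'm, 'p, 'n) cfunctor \<Rightarrow> ('o, 'm, 'q, 'k) cfunctor" where
  "comp_functor G F =
    \<lparr>FObj = (\<lambda>X. FObj G (FObj F X)),
     FArr = (\<lambda>X Y f. FArr G (FObj F X) (FObj F Y) (FArr F X Y f))\<rparr>"

definition nat_trans ::
  "('o, 'm) precategory \<Rightarrow> ('p, 'n) precategory \<Rightarrow>
    ('o, 'm, 'p, 'n) cfunctor \<Rightarrow> ('o, 'm, 'p, 'n) cfunctor \<Rightarrow> ('o \<Rightarrow> 'n) set" where
  "nat_trans C D F G =
    {\<eta> \<in> (\<Pi>\<^sub>E X \<in> Obj C. Hom D (FObj F X) (FObj G X)).
      \<forall>X \<in> Obj C. \<forall>Y \<in> Obj C. \<forall>f \<in> Hom C X Y.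
        Comp D (FObj F X) (FObj F Y) (FObj G Y) (\<eta> Y) (FArr F X Y f) =
        Comp D (FObj F X) (FObj G X) (FObj G Y) (FArr G X Y f) (\<eta> X)}"

definition naturally_isomorphic ::
  "('o, 'm) precategory \<Rightarrow> ('p, 'n) precategory \<Rightarrow>
    ('o, 'm, 'p, 'n) cfunctor \<Rightarrow> ('o, 'm, 'p, 'n) cfunctor \<Rightarrow> bool" where
  "naturally_isomorphic C D F G \<longleftrightarrow>
    (\<exists>\<eta> \<in> nat_trans C D F G. \<forall>X \<in> Obj C. is_iso D (FObj F X) (FObj G X) (\<eta> X))"

definition equivalent_categories :: "('o, 'm) precategory \<Rightarrow> ('p, 'n) precategory \<Rightarrow> bool" where
  "equivalent_categories C D \<longleftrightarrow> category C \<and> category D \<and>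
    (\<exists>F G. is_functor C D F \<and> is_functor D C G \<and>
      naturally_isomorphic C C id_functor (comp_functor G F) \<and>
      naturally_isomorphic D D (comp_functor F G) id_functor)"


section \<open>Finite limits\<close>

definition finite_category :: "('j, 'i) precategory \<Rightarrow> bool" where
  "finite_category J \<longleftrightarrow> category J \<and> finite (Obj J) \<and>
    (\<forall>i \<in> Obj J. \<forall>j \<in> Obj J. finite (Hom J i j))"

definition cone ::
  "('j, 'i) precategory \<Rightarrow> ('o, 'm) precategory \<Rightarrow> ('j, 'i, 'o, 'm) cfunctor \<Rightarrow>
    'o \<Rightarrow> ('j \<Rightarrow> 'm) \<Rightarrow> bool" where
  "cone J C D L p \<longleftrightarrow> L \<in> Obj C \<and>
    (\<forall>j \<in> Obj J. p j \<in> Hom C L (FObj D j)) \<and>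
    (\<forall>i \<in> Obj J. \<forall>j \<in> Obj J. \<forall>u \<in> Hom J i j.
      Comp C L (FObj D i) (FObj D j) (FArr D i j u) (p i) = p j)"

definition limit_cone ::
  "('j, 'i) precategory \<Rightarrow> ('o, 'm) precategory \<Rightarrow> ('j, 'i, 'o, 'm) cfunctor \<Rightarrow>
    'o \<Rightarrow> ('j \<Rightarrow> 'm) \<Rightarrow> bool" where
  "limit_cone J C D L p \<longleftrightarrow> cone J C D L p \<and>
    (\<forall>X q. cone J C D X q \<longrightarrow>
      (\<exists>!h. h \<in> Hom C X L \<and> (\<forall>j \<in> Obj J. Comp C X L (FObj D j) (p j) h = q j)))"

text \<open>
  Every finite category is isomorphic to one whose objects and arrows are natural numbers, so
  diagram shapes of type \<open>(nat, nat) precategory\<close> suffice.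
\<close>

definition has_finite_limits :: "('o, 'm) precategory \<Rightarrow> bool" where
  "has_finite_limits C \<longleftrightarrow>
    (\<forall>(J :: (nat, nat) precategory) D. finite_category J \<and> is_functor J C D \<longrightarrow>
      (\<exists>L p. limit_cone J C D L p))"

definition preserves_finite_limits ::
  "('o, 'm) precategory \<Rightarrow> ('p, 'n) precategory \<Rightarrow> ('o, 'm, 'p, 'n) cfunctor \<Rightarrow> bool" where
  "preserves_finite_limits C D F \<longleftrightarrow>
    (\<forall>(J :: (nat, nat) precategory) E L p.
      finite_category J \<and> is_functor J C E \<and> limit_cone J C E L p \<longrightarrow>
      limit_cone J D (comp_functor F E) (FObj F L) (\<lambda>j. FArr F L (FObj E j) (p j)))"

definition Lex ::
  "('o, 'm) precategory \<Rightarrow> ('p, 'n) precategory \<Rightarrow>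
    (('o, 'm, 'p, 'n) cfunctor, 'o \<Rightarrow> 'n) precategory" where
  "Lex C D =
    \<lparr>Obj = {F. is_functor C D F \<and> preserves_finite_limits C D F},
     Hom = nat_trans C D,
     Id = (\<lambda>F. \<lambda>X \<in> Obj C. Id D (FObj F X)),
     Comp = (\<lambda>F G H \<theta> \<eta>. \<lambda>X \<in> Obj C. Comp D (FObj F X) (FObj G X) (FObj H X) (\<theta> X) (\<eta> X))\<rparr>"

text \<open>The category of sets, relative to a type \<open>'u\<close> serving as universe: all subsets of \<open>'u\<close>.\<close>

definition SET :: "('u set, 'u \<Rightarrow> 'u) precategory" where
  "SET =
    \<lparr>Obj = UNIV,
     Hom = (\<lambda>X Y. X \<rightarrow>\<^sub>E Y),
     Id = (\<lambda>X. \<lambda>x \<in> X. x),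
     Comp = (\<lambda>X Y Z g f. compose X g f)\<rparr>"


section \<open>S5-algebras\<close>

record 'a s5_alg = "'a partial_object" +
  s5_top :: 'a ("tt\<index>")
  s5_bot :: 'a ("ff\<index>")
  s5_meet :: "'a \<Rightarrow> 'a \<Rightarrow> 'a" (infixl "\<curlywedge>\<index>" 70)
  s5_join :: "'a \<Rightarrow> 'a \<Rightarrow> 'a" (infixl "\<curlyvee>\<index>" 65)
  s5_neg :: "'a \<Rightarrow> 'a" ("neg\<index> _" [81] 80)
  s5_box :: "'a \<Rightarrow> 'a" ("box\<index> _" [81] 80)

definition s5_le :: "('a, 'b) s5_alg_scheme \<Rightarrow> 'a \<Rightarrow> 'a \<Rightarrow> bool" (infix "\<preceq>\<index>" 50) where
  "x \<preceq>\<^bsub>A\<^esub> y \<longleftrightarrow> x \<curlywedge>\<^bsub>A\<^esub> y = x"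

definition s5_dia :: "('a, 'b) s5_alg_scheme \<Rightarrow> 'a \<Rightarrow> 'a" ("dia\<index> _" [81] 80) where
  "dia\<^bsub>A\<^esub> x = neg\<^bsub>A\<^esub> (box\<^bsub>A\<^esub> (neg\<^bsub>A\<^esub> x))"

text \<open>The Boolean axioms are those of \<open>abstract_boolean_algebra\<close>, relativised to a carrier;
  the one-element algebra is allowed.\<close>

locale boolean_alg =
  fixes A :: "('a, 'b) s5_alg_scheme" (structure)
  assumes top_closed: "tt \<in> carrier A"
    and bot_closed: "ff \<in> carrier A"
    and meet_closed: "\<lbrakk>x \<in> carrier A; y \<in> carrier A\<rbrakk> \<Longrightarrow> x \<curlywedge> y \<in> carrier A"
    and join_closed: "\<lbrakk>x \<in> carrier A; y \<in> carrier A\<rbrakk> \<Longrightarrow> x \<curlyvee> y \<in> carrier A"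
    and neg_closed: "x \<in> carrier A \<Longrightarrow> neg x \<in> carrier A"
    and meet_assoc: "\<lbrakk>x \<in> carrier A; y \<in> carrier A; z \<in> carrier A\<rbrakk>
      \<Longrightarrow> (x \<curlywedge> y) \<curlywedge> z = x \<curlywedge> (y \<curlywedge> z)"
    and meet_comm: "\<lbrakk>x \<in> carrier A; y \<in> carrier A\<rbrakk> \<Longrightarrow> x \<curlywedge> y = y \<curlywedge> x"
    and join_assoc: "\<lbrakk>x \<in> carrier A; y \<in> carrier A; z \<in> carrier A\<rbrakk>
      \<Longrightarrow> (x \<curlyvee> y) \<curlyvee> z = x \<curlyvee> (y \<curlyvee> z)"
    and join_comm: "\<lbrakk>x \<in> carrier A; y \<in> carrier A\<rbrakk> \<Longrightarrow> x \<curlyvee> y = y \<curlyvee> x"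
    and meet_join_distrib: "\<lbrakk>x \<in> carrier A; y \<in> carrier A; z \<in> carrier A\<rbrakk>
      \<Longrightarrow> x \<curlywedge> (y \<curlyvee> z) = (x \<curlywedge> y) \<curlyvee> (x \<curlywedge> z)"
    and join_meet_distrib: "\<lbrakk>x \<in> carrier A; y \<in> carrier A; z \<in> carrier A\<rbrakk>
      \<Longrightarrow> x \<curlyvee> (y \<curlywedge> z) = (x \<curlyvee> y) \<curlywedge> (x \<curlyvee> z)"
    and meet_top: "x \<in> carrier A \<Longrightarrow> x \<curlywedge> tt = x"
    and join_bot: "x \<in> carrier A \<Longrightarrow> x \<curlyvee> ff = x"
    and meet_neg: "x \<in> carrier A \<Longrightarrow> x \<curlywedge> (neg x) = ff"
    and join_neg: "x \<in> carrier A \<Longrightarrow> x \<curlyvee> (neg x) = tt"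

text \<open>
  The axiom \<open>box_trans\<close> is part of S5 (reflexive, symmetric and transitive frames).  It does not
  follow from the other four modal axioms, which define KTB: on the powerset of the reflexive
  symmetric path \<open>1 - 2 - 3\<close> they hold, but \<open>box {1, 2} = {1}\<close> and \<open>box {1} = {}\<close>.
\<close>

locale s5_algebra = boolean_alg +
  assumes box_closed: "x \<in> carrier A \<Longrightarrow> box x \<in> carrier A"
    and box_top: "box tt = tt"
    and box_meet: "\<lbrakk>x \<in> carrier A; y \<in> carrier A\<rbrakk> \<Longrightarrow> box (x \<curlywedge> y) = (box x) \<curlywedge> (box y)"
    and box_refl: "x \<in> carrier A \<Longrightarrow> box x \<preceq> x"
    and box_sym: "x \<in> carrier A \<Longrightarrow> x \<preceq> box (dia x)"
    and box_trans: "x \<in> carrier A \<Longrightarrow> box x \<preceq> box (box x)"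

definition s5_hom ::
  "('a, 'c) s5_alg_scheme \<Rightarrow> ('b, 'd) s5_alg_scheme \<Rightarrow> ('a \<Rightarrow> 'b) set" where
  "s5_hom A B = {h \<in> carrier A \<rightarrow>\<^sub>E carrier B.
    h tt\<^bsub>A\<^esub> = tt\<^bsub>B\<^esub> \<and>
    h ff\<^bsub>A\<^esub> = ff\<^bsub>B\<^esub> \<and>
    (\<forall>x \<in> carrier A. \<forall>y \<in> carrier A. h (x \<curlywedge>\<^bsub>A\<^esub> y) = h x \<curlywedge>\<^bsub>B\<^esub> h y) \<and>
    (\<forall>x \<in> carrier A. \<forall>y \<in> carrier A. h (x \<curlyvee>\<^bsub>A\<^esub> y) = h x \<curlyvee>\<^bsub>B\<^esub> h y) \<and>
    (\<forall>x \<in> carrier A. h (neg\<^bsub>A\<^esub> x) = neg\<^bsub>B\<^esub> (h x)) \<and>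
    (\<forall>x \<in> carrier A. h (box\<^bsub>A\<^esub> x) = box\<^bsub>B\<^esub> (h x))}"

text \<open>
  A small category equivalent to that of all finite S5-algebras: the full subcategory on the
  algebras whose carrier is a finite set of natural numbers (see \<open>s5_algebra_nat_copy\<close>).
\<close>

definition S5Alg_fin :: "(nat s5_alg, nat \<Rightarrow> nat) precategory" where
  "S5Alg_fin =
    \<lparr>Obj = {A. s5_algebra A \<and> finite (carrier A)},
     Hom = s5_hom,
     Id = (\<lambda>A. \<lambda>x \<in> carrier A. x),
     Comp = (\<lambda>A B C g f. compose (carrier A) g f)\<rparr>"

lemma s5_algebra_nat_copy:
  fixes A :: "'a s5_alg"
  assumes "s5_algebra A" and fin: "finite (carrier A)"
  shows "\<exists>B \<in> Obj S5Alg_fin. \<exists>h \<in> s5_hom A B. bij_betw h (carrier A) (carrier B)"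
proof -
  interpret s5_algebra A by fact
  obtain e where e: "bij_betw e (carrier A) {0..<card (carrier A)}"
    using ex_bij_betw_finite_nat[OF fin] by blast
  define d where "d = inv_into (carrier A) e"
  define B where "B = \<lparr>carrier = {0..<card (carrier A)},
    s5_top = e tt\<^bsub>A\<^esub>, s5_bot = e ff\<^bsub>A\<^esub>, s5_meet = (\<lambda>x y. e (d x \<curlywedge>\<^bsub>A\<^esub> d y)),
    s5_join = (\<lambda>x y. e (d x \<curlyvee>\<^bsub>A\<^esub> d y)), s5_neg = (\<lambda>x. e (neg\<^bsub>A\<^esub> (d x))),
    s5_box = (\<lambda>x. e (box\<^bsub>A\<^esub> (d x)))\<rparr>"
  have de: "d (e x) = x" if "x \<in> carrier A" for x
    using e that by (simp add: d_def bij_betw_inv_into_left)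
  have ed: "e (d i) = i" if "i < card (carrier A)" for i
    using e that by (simp add: d_def bij_betw_inv_into_right)
  have ec: "e x < card (carrier A)" if "x \<in> carrier A" for x
    using e that by (auto simp: bij_betw_def)
  have dc: "d i \<in> carrier A" if "i < card (carrier A)" for i
    using e that by (metis atLeast0LessThan bij_betw_def d_def inv_into_into lessThan_iff)
  note closed = top_closed bot_closed meet_closed join_closed neg_closed box_closed
  have le: "box\<^bsub>A\<^esub> x \<curlywedge>\<^bsub>A\<^esub> x = box\<^bsub>A\<^esub> x" "x \<curlywedge>\<^bsub>A\<^esub> box\<^bsub>A\<^esub> (neg\<^bsub>A\<^esub> (box\<^bsub>A\<^esub> (neg\<^bsub>A\<^esub> x))) = x"
    "box\<^bsub>A\<^esub> x \<curlywedge>\<^bsub>A\<^esub> box\<^bsub>A\<^esub> (box\<^bsub>A\<^esub> x) = box\<^bsub>A\<^esub> x"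
    if "x \<in> carrier A" for x
    using box_refl[OF that] box_sym[OF that] box_trans[OF that]
    by (simp_all add: s5_le_def s5_dia_def)
  have "boolean_alg B"
  proof
    show "x \<curlywedge>\<^bsub>B\<^esub> y = y \<curlywedge>\<^bsub>B\<^esub> x" if "x \<in> carrier B" "y \<in> carrier B" for x y
      using that meet_comm[of "d x" "d y"] by (simp add: B_def dc)
    show "x \<curlyvee>\<^bsub>B\<^esub> y = y \<curlyvee>\<^bsub>B\<^esub> x" if "x \<in> carrier B" "y \<in> carrier B" for x y
      using that join_comm[of "d x" "d y"] by (simp add: B_def dc)
    show "x \<curlyvee>\<^bsub>B\<^esub> (y \<curlywedge>\<^bsub>B\<^esub> z) = (x \<curlyvee>\<^bsub>B\<^esub> y) \<curlywedge>\<^bsub>B\<^esub> (x \<curlyvee>\<^bsub>B\<^esub> z)"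
      if "x \<in> carrier B" "y \<in> carrier B" "z \<in> carrier B" for x y z
      using that join_meet_distrib[of "d x" "d y" "d z"] by (simp add: B_def de dc closed)
  qed (simp_all add: B_def de ed ec dc closed meet_assoc join_assoc meet_join_distrib
        meet_top join_bot meet_neg join_neg)
  moreover have "s5_algebra_axioms B"
    by unfold_locales
      (simp_all add: B_def s5_le_def s5_dia_def de ed ec dc closed box_top box_meet le)
  ultimately have "B \<in> Obj S5Alg_fin"
    by (simp add: S5Alg_fin_def s5_algebra_def B_def)
  moreover have "restrict e (carrier A) \<in> s5_hom A B"
    by (auto simp: s5_hom_def B_def de ec closed)
  moreover have "bij_betw (restrict e (carrier A)) (carrier A) (carrier B)"
    using e bij_betw_cong[of "carrier A" "restrict e (carrier A)" e] by (simp add: B_def)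
  ultimately show ?thesis by blast
qed


section \<open>The language and the theory\<close>

text \<open>Functions \<open>{1..m} \<rightarrow> {1..n}\<close> are represented extensionally; correspondingly, the library's
  \<open>Bij {1..n}\<close> is the group of permutations of \<open>{1..n}\<close>.\<close>

definition Surj :: "nat \<Rightarrow> nat \<Rightarrow> (nat \<Rightarrow> nat) set" where
  "Surj m n = {f \<in> {1..m} \<rightarrow>\<^sub>E {1..n}. f ` {1..m} = {1..n}}"

text \<open>
  \<open>Op M m n f : Sort M n \<rightarrow> Sort M m\<close> interprets the function symbol given by
  \<open>f \<in> Surj m n\<close>; only the sorts \<open>n \<ge> 1\<close> matter, and they may be empty.
\<close>

record 'u struct =
  Sort :: "nat \<Rightarrow> 'u set"
  Op :: "nat \<Rightarrow> nat \<Rightarrow> (nat \<Rightarrow> nat) \<Rightarrow> 'u \<Rightarrow> 'u"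

definition L_structure :: "'u struct \<Rightarrow> bool" where
  "L_structure M \<longleftrightarrow>
    (\<forall>m \<ge> 1. \<forall>n \<ge> 1. \<forall>f \<in> Surj m n. Op M m n f \<in> Sort M n \<rightarrow> Sort M m)"

definition L_hom :: "'u struct \<Rightarrow> 'u struct \<Rightarrow> (nat \<Rightarrow> 'u \<Rightarrow> 'u) set" where
  "L_hom M N = {h \<in> (\<Pi>\<^sub>E n \<in> {1..}. Sort M n \<rightarrow>\<^sub>E Sort N n).
    \<forall>m \<ge> 1. \<forall>n \<ge> 1. \<forall>f \<in> Surj m n. \<forall>x \<in> Sort M n. h m (Op M m n f x) = Op N m n f (h n x)}"

definition Fix_trivial :: "'u struct \<Rightarrow> nat \<Rightarrow> 'u \<Rightarrow> bool" where
  "Fix_trivial M n x \<longleftrightarrow> (\<forall>\<sigma> \<in> Bij {1..n} - {\<lambda>i \<in> {1..n}. i}. Op M n n \<sigma> x \<noteq> x)"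

definition axiom1 :: "'u struct \<Rightarrow> bool" where
  "axiom1 M \<longleftrightarrow>
    (\<forall>n \<ge> 1. \<forall>x \<in> Sort M n. Op M n n (\<lambda>i \<in> {1..n}. i) x = x) \<and>
    (\<forall>r \<ge> 1. \<forall>m \<ge> 1. \<forall>n \<ge> 1. \<forall>f \<in> Surj r m. \<forall>g \<in> Surj m n. \<forall>x \<in> Sort M n.
      Op M r m f (Op M m n g x) = Op M r n (compose {1..r} g f) x)"

definition axiom5 :: "'u struct \<Rightarrow> bool" where
  "axiom5 M \<longleftrightarrow>
    (\<forall>n \<ge> 1. \<forall>x \<in> Sort M n. \<exists>!m. 1 \<le> m \<and> m \<le> n \<and>
      (\<exists>f \<in> Surj n m. \<exists>y \<in> Sort M m. Op M n m f y = x \<and> Fix_trivial M m y))"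

definition axiom6 :: "'u struct \<Rightarrow> bool" where
  "axiom6 M \<longleftrightarrow>
    (\<forall>n \<ge> 1. \<forall>m \<ge> 1. \<forall>q1 \<in> Surj n m. \<forall>q2 \<in> Surj n m. \<forall>x1 \<in> Sort M m. \<forall>x2 \<in> Sort M m.
      Fix_trivial M m x1 \<and> Fix_trivial M m x2 \<and> Op M n m q1 x1 = Op M n m q2 x2 \<longrightarrow>
      (\<exists>\<sigma> \<in> Bij {1..m}. compose {1..n} \<sigma> q2 = q1 \<and> Op M m m \<sigma> x1 = x2))"

definition model_T2 :: "'u struct \<Rightarrow> bool" where
  "model_T2 M \<longleftrightarrow> L_structure M \<and> axiom1 M \<and> axiom5 M \<and> axiom6 M"

definition Mod_T2 :: "('u struct, nat \<Rightarrow> 'u \<Rightarrow> 'u) precategory" where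
  "Mod_T2 =
    \<lparr>Obj = {M. model_T2 M},
     Hom = L_hom,
     Id = (\<lambda>M. \<lambda>n \<in> {1..}. \<lambda>x \<in> Sort M n. x),
     Comp = (\<lambda>M N K g f. \<lambda>n \<in> {1..}. compose (Sort M n) (g n) (f n))\<rparr>"

end

theory Submission
  imports Defs
begin

text \<open>
  Finite S5-algebras are dual to finite S5-frames, that is, to finite sets partitioned into clusters,
  with the maps that carry every cluster onto a cluster (\<open>finite_s5_algebra_is_complex\<close>,
  \<open>finite_support_hom_is_preimage\<close>).  A frame is the coproduct of its clusters, so an algebra is the
  product of simple algebras \<open>Simple n\<close>; homomorphisms from \<open>Simple n\<close> to \<open>Simple m\<close> are the
  surjections from \<open>{1..m}\<close> to \<open>{1..n}\<close>; and every homomorphism from an algebra to a simple one factors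
  through a projection (\<open>simple_decomposition\<close>).  A functor \<open>F\<close> that preserves finite limits is
  therefore determined by the sets \<open>F (Simple n)\<close> with the action of the surjections, which is an
  \<open>\<L>\<close>-structure satisfying axiom (1), and the same holds for natural transformations.  Restriction to
  simple algebras is thus fully faithful (\<open>restriction_fully_faithful\<close>).

  The restriction satisfies axioms (5) and (6) because \<open>F\<close> preserves equalizers and pullbacks
  (\<open>model_T2_restr\<close>).  An element of sort \<open>n\<close> fixed by a permutation \<open>\<sigma> \<noteq> 1\<close> comes from the equalizer
  of \<open>\<sigma>\<close> and \<open>1\<close>, a simple algebra with fewer atoms; so every element comes from one with trivial
  stabilizer.  If \<open>q1(x1) = q2(x2)\<close>, then \<open>x1\<close> and \<open>x2\<close> come from an element \<open>z\<close> of the pullback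
  \<open>Simple k\<close>, say \<open>x1 = g1(z)\<close> and \<open>x2 = g2(z)\<close>.  If \<open>g1\<close> identified two points, their exchange would
  fix \<open>x1\<close>; so trivial stabilizers force \<open>g1\<close> and \<open>g2\<close> to be bijections, and \<open>x1\<close>, \<open>x2\<close> differ by a
  permutation.

  Conversely, axioms (5) and (6) say that a model \<open>M\<close> is a coproduct of representable presheaves, one
  for each orbit with trivial stabilizers (\<open>generators_cover\<close>, \<open>generators_free\<close>).  Hence the
  elements of \<open>M\<close> of sort \<open>n\<close> are the p-morphisms from an \<open>n\<close>-element cluster to the frame \<open>X\<close> that has
  one cluster of size \<open>m\<close> for each such orbit in sort \<open>m\<close>.  For an arbitrary finite algebra \<open>A\<close> take the
  p-morphisms from the frame of \<open>A\<close> to \<open>X\<close> or, avoiding the frame of \<open>A\<close>, the homomorphisms from the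
  complex algebra of \<open>X\<close> to \<open>A\<close> with finite support.  This functor preserves finite limits because it is
  a filtered colimit of representables: a finite diagram of such homomorphisms lives on a finite
  union of clusters (\<open>frame_functor_in_Lex\<close>).  The values of the functor fit into the universe since this
  is infinite and \<open>A\<close> is finite.
\<close>

section \<open>Equivalences of categories\<close>

lemma functor_obj: "\<lbrakk>is_functor C D F; X \<in> Obj C\<rbrakk> \<Longrightarrow> FObj F X \<in> Obj D"
  by (simp add: is_functor_def)

lemma functor_arr:
  "\<lbrakk>is_functor C D F; X \<in> Obj C; Y \<in> Obj C; f \<in> Hom C X Y\<rbrakk>
    \<Longrightarrow> FArr F X Y f \<in> Hom D (FObj F X) (FObj F Y)"
  by (simp add: is_functor_def)

lemma functor_id: "\<lbrakk>is_functor C D F; X \<in> Obj C\<rbrakk> \<Longrightarrow> FArr F X X (Id C X) = Id D (FObj F X)"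
  by (simp add: is_functor_def)

lemma functor_comp:
  "\<lbrakk>is_functor C D F; X \<in> Obj C; Y \<in> Obj C; Z \<in> Obj C; f \<in> Hom C X Y; g \<in> Hom C Y Z\<rbrakk>
    \<Longrightarrow> FArr F X Z (Comp C X Y Z g f) =
      Comp D (FObj F X) (FObj F Y) (FObj F Z) (FArr F Y Z g) (FArr F X Y f)"
  by (simp add: is_functor_def)

text \<open>
  The quasi-inverse sends an object \<open>Y\<close> to a chosen preimage with an isomorphism \<open>e Y\<close> onto \<open>Y\<close>,
  and an arrow \<open>g\<close> to the unique arrow over the conjugate of \<open>g\<close> by these isomorphisms.
\<close>

theorem equivalence_from_fully_faithful_eso:
  fixes C :: "('o, 'm) precategory" and D :: "('p, 'n) precategory"
  assumes "category C" "category D" and F: "is_functor C D F"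
    and ff: "\<And>X Y. \<lbrakk>X \<in> Obj C; Y \<in> Obj C\<rbrakk>
      \<Longrightarrow> bij_betw (FArr F X Y) (Hom C X Y) (Hom D (FObj F X) (FObj F Y))"
    and eso: "\<And>Y. Y \<in> Obj D \<Longrightarrow> \<exists>X \<in> Obj C. \<exists>f. is_iso D (FObj F X) Y f"
  shows "equivalent_categories C D"
proof -
  interpret C: category C by fact
  interpret D: category D by fact
  note Fo = functor_obj[OF F] and Fa = functor_arr[OF F] and Fi = functor_id[OF F]
    and Fc = functor_comp[OF F]
  define Go where "Go Y = (SOME X. X \<in> Obj C \<and> (\<exists>f. is_iso D (FObj F X) Y f))" for Y
  have Go: "Go Y \<in> Obj C \<and> (\<exists>f. is_iso D (FObj F (Go Y)) Y f)" if "Y \<in> Obj D" for Y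
    unfolding Go_def using someI_ex[of "\<lambda>X. X \<in> Obj C \<and> (\<exists>f. is_iso D (FObj F X) Y f)"] eso[OF that]
    by blast
  define e where "e Y = (SOME f. is_iso D (FObj F (Go Y)) Y f)" for Y
  have e_iso: "is_iso D (FObj F (Go Y)) Y (e Y)" if "Y \<in> Obj D" for Y
    unfolding e_def using someI_ex Go[OF that] by metis
  define e' where "e' Y = (SOME g. g \<in> Hom D Y (FObj F (Go Y)) \<and>
      Comp D (FObj F (Go Y)) Y (FObj F (Go Y)) g (e Y) = Id D (FObj F (Go Y)) \<and>
      Comp D Y (FObj F (Go Y)) Y (e Y) g = Id D Y)" for Y
  have e': "e' Y \<in> Hom D Y (FObj F (Go Y)) \<and>
      Comp D (FObj F (Go Y)) Y (FObj F (Go Y)) (e' Y) (e Y) = Id D (FObj F (Go Y)) \<and>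
      Comp D Y (FObj F (Go Y)) Y (e Y) (e' Y) = Id D Y" if "Y \<in> Obj D" for Y
    unfolding e'_def by (rule someI_ex) (use e_iso[OF that] in \<open>auto simp: is_iso_def\<close>)
  have GoC: "Go Y \<in> Obj C" and FGo: "FObj F (Go Y) \<in> Obj D"
    and eH: "e Y \<in> Hom D (FObj F (Go Y)) Y" and e'H: "e' Y \<in> Hom D Y (FObj F (Go Y))"
    and e'e: "Comp D (FObj F (Go Y)) Y (FObj F (Go Y)) (e' Y) (e Y) = Id D (FObj F (Go Y))"
    and ee': "Comp D Y (FObj F (Go Y)) Y (e Y) (e' Y) = Id D Y"
    if "Y \<in> Obj D" for Y
    using Go[OF that] Fo e_iso[OF that] e'[OF that] by (auto simp: is_iso_def)
  define lift where "lift X Y g = inv_into (Hom C X Y) (FArr F X Y) g" for X Y g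
  have lift: "lift X Y g \<in> Hom C X Y" "FArr F X Y (lift X Y g) = g"
    if "X \<in> Obj C" "Y \<in> Obj C" "g \<in> Hom D (FObj F X) (FObj F Y)" for X Y g
    using ff[OF that(1,2)] that(3) unfolding lift_def
    by (metis bij_betw_def inv_into_into, metis bij_betw_inv_into_right)
  have F_inj: "f = g" if "X \<in> Obj C" "Y \<in> Obj C" "f \<in> Hom C X Y" "g \<in> Hom C X Y"
    "FArr F X Y f = FArr F X Y g" for X Y f g
    using ff[OF that(1,2)] that(3-) by (meson bij_betw_def inj_onD)
  define Gt where "Gt Y Z g = Comp D (FObj F (Go Y)) Z (FObj F (Go Z)) (e' Z)
      (Comp D (FObj F (Go Y)) Y Z g (e Y))" for Y Z g
  have GtH: "Gt Y Z g \<in> Hom D (FObj F (Go Y)) (FObj F (Go Z))"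
    if "Y \<in> Obj D" "Z \<in> Obj D" "g \<in> Hom D Y Z" for Y Z g
    unfolding Gt_def using that by (intro D.Comp_in_Hom FGo eH e'H)
  have e_Gt: "Comp D (FObj F (Go Y)) (FObj F (Go Z)) Z (e Z) (Gt Y Z g) =
      Comp D (FObj F (Go Y)) Y Z g (e Y)"
    if "Y \<in> Obj D" "Z \<in> Obj D" "g \<in> Hom D Y Z" for Y Z g
    unfolding Gt_def
    using that by (simp add: D.Comp_assoc D.Comp_in_Hom FGo eH e'H ee' D.Id_Comp)
  have e_cancel: "a = b"
    if "Y \<in> Obj D" "X \<in> Obj D" "a \<in> Hom D X (FObj F (Go Y))" "b \<in> Hom D X (FObj F (Go Y))"
      "Comp D X (FObj F (Go Y)) Y (e Y) a = Comp D X (FObj F (Go Y)) Y (e Y) b" for X Y a b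
  proof -
    have "Comp D X Y (FObj F (Go Y)) (e' Y) (Comp D X (FObj F (Go Y)) Y (e Y) c) = c"
      if "c \<in> Hom D X (FObj F (Go Y))" for c
      using that \<open>Y \<in> Obj D\<close> \<open>X \<in> Obj D\<close>
      by (simp add: D.Comp_assoc FGo eH e'H e'e D.Id_Comp)
    then show ?thesis using that(3-) by metis
  qed
  define G where "G = \<lparr>FObj = Go, FArr = (\<lambda>Y Z g. lift (Go Y) (Go Z) (Gt Y Z g))\<rparr>"
  have GH: "FArr G Y Z g \<in> Hom C (Go Y) (Go Z)" and FG: "FArr F (Go Y) (Go Z) (FArr G Y Z g) = Gt Y Z g"
    if "Y \<in> Obj D" "Z \<in> Obj D" "g \<in> Hom D Y Z" for Y Z g
    using lift[OF GoC GoC GtH] that by (simp_all add: G_def)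
  have G: "is_functor D C G"
    unfolding is_functor_def
  proof (intro conjI ballI)
    fix Y assume Y: "Y \<in> Obj D"
    show "FObj G Y \<in> Obj C" using GoC Y by (simp add: G_def)
    have "Gt Y Y (Id D Y) = Id D (FObj F (Go Y))"
      using Y by (simp add: Gt_def D.Id_Comp FGo eH e'e)
    then have "FArr F (Go Y) (Go Y) (FArr G Y Y (Id D Y)) = FArr F (Go Y) (Go Y) (Id C (Go Y))"
      using Y by (simp add: FG D.Id_in_Hom Fi GoC)
    then show "FArr G Y Y (Id D Y) = Id C (FObj G Y)"
      using F_inj[OF GoC GoC GH C.Id_in_Hom] Y GoC D.Id_in_Hom by (simp add: G_def)
  next
    fix Y Z g assume "Y \<in> Obj D" "Z \<in> Obj D" "g \<in> Hom D Y Z"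
    then show "FArr G Y Z g \<in> Hom C (FObj G Y) (FObj G Z)" using GH by (simp add: G_def)
  next
    fix X Y Z f g
    assume o: "X \<in> Obj D" "Y \<in> Obj D" "Z \<in> Obj D" and a: "f \<in> Hom D X Y" "g \<in> Hom D Y Z"
    have "Gt X Z (Comp D X Y Z g f) =
        Comp D (FObj F (Go X)) (FObj F (Go Y)) (FObj F (Go Z)) (Gt Y Z g) (Gt X Y f)"
    proof (rule e_cancel[OF o(3) FGo[OF o(1)]])
      show "Gt X Z (Comp D X Y Z g f) \<in> Hom D (FObj F (Go X)) (FObj F (Go Z))"
        using o a by (simp add: GtH D.Comp_in_Hom)
      show "Comp D (FObj F (Go X)) (FObj F (Go Y)) (FObj F (Go Z)) (Gt Y Z g) (Gt X Y f)
          \<in> Hom D (FObj F (Go X)) (FObj F (Go Z))"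
        using o a by (meson GtH D.Comp_in_Hom FGo)
      have "Comp D (FObj F (Go X)) (FObj F (Go Z)) Z (e Z)
          (Comp D (FObj F (Go X)) (FObj F (Go Y)) (FObj F (Go Z)) (Gt Y Z g) (Gt X Y f)) =
          Comp D (FObj F (Go X)) (FObj F (Go Y)) Z (Comp D (FObj F (Go Y)) Y Z g (e Y)) (Gt X Y f)"
        using o a by (simp add: D.Comp_assoc FGo eH GtH e_Gt)
      also have "\<dots> = Comp D (FObj F (Go X)) Y Z g (Comp D (FObj F (Go X)) X Y f (e X))"
        using D.Comp_assoc[OF FGo[OF o(1)] FGo[OF o(2)] o(2,3) GtH[OF o(1,2) a(1)] eH[OF o(2)] a(2)]
          o a by (simp add: e_Gt)
      also have "\<dots> = Comp D (FObj F (Go X)) X Z (Comp D X Y Z g f) (e X)"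
        using o a by (simp add: D.Comp_assoc FGo eH)
      finally show "Comp D (FObj F (Go X)) (FObj F (Go Z)) Z (e Z) (Gt X Z (Comp D X Y Z g f)) =
          Comp D (FObj F (Go X)) (FObj F (Go Z)) Z (e Z)
          (Comp D (FObj F (Go X)) (FObj F (Go Y)) (FObj F (Go Z)) (Gt Y Z g) (Gt X Y f))"
        using o a by (simp add: e_Gt D.Comp_in_Hom)
    qed
    then have "FArr F (Go X) (Go Z) (FArr G X Z (Comp D X Y Z g f)) =
        FArr F (Go X) (Go Z) (Comp C (Go X) (Go Y) (Go Z) (FArr G Y Z g) (FArr G X Y f))"
      using o a by (simp add: FG D.Comp_in_Hom Fc GoC GH)
    then have "FArr G X Z (Comp D X Y Z g f) =
        Comp C (Go X) (Go Y) (Go Z) (FArr G Y Z g) (FArr G X Y f)"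
      using o a by (intro F_inj[of "Go X" "Go Z"]) (simp_all add: GoC GH D.Comp_in_Hom C.Comp_in_Hom)
    then show "FArr G X Z (Comp D X Y Z g f) =
        Comp C (FObj G X) (FObj G Y) (FObj G Z) (FArr G Y Z g) (FArr G X Y f)"
      by (simp add: G_def)
  qed
  have counit: "naturally_isomorphic D D (comp_functor F G) id_functor"
    unfolding naturally_isomorphic_def
  proof (intro bexI[of _ "restrict e (Obj D)"] ballI)
    show "restrict e (Obj D) \<in> nat_trans D D (comp_functor F G) id_functor"
      by (auto simp: nat_trans_def comp_functor_def id_functor_def G_def eH)
        (use FG e_Gt in \<open>simp add: G_def\<close>)
    show "is_iso D (FObj (comp_functor F G) X) (FObj id_functor X) (restrict e (Obj D) X)"
      if "X \<in> Obj D" for X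
      using e_iso[OF that] that by (simp add: comp_functor_def id_functor_def G_def)
  qed
  define u where "u X = lift X (Go (FObj F X)) (e' (FObj F X))" for X
  define u' where "u' X = lift (Go (FObj F X)) X (e (FObj F X))" for X
  have u: "u X \<in> Hom C X (Go (FObj F X))" "FArr F X (Go (FObj F X)) (u X) = e' (FObj F X)"
    and u': "u' X \<in> Hom C (Go (FObj F X)) X" "FArr F (Go (FObj F X)) X (u' X) = e (FObj F X)"
    if "X \<in> Obj C" for X
    using that lift GoC eH e'H Fo by (auto simp: u_def u'_def)
  have unit: "naturally_isomorphic C C id_functor (comp_functor G F)"
    unfolding naturally_isomorphic_def
  proof (intro bexI[of _ "restrict u (Obj C)"] ballI)
    have "Comp C X Y (Go (FObj F Y)) (u Y) f =
        Comp C X (Go (FObj F X)) (Go (FObj F Y)) (FArr G (FObj F X) (FObj F Y) (FArr F X Y f)) (u X)"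
      (is "?l = ?r")
      if o: "X \<in> Obj C" "Y \<in> Obj C" and f: "f \<in> Hom C X Y" for X Y f
    proof (rule F_inj)
      show "X \<in> Obj C" "Go (FObj F Y) \<in> Obj C" using o GoC Fo by auto
      show "?l \<in> Hom C X (Go (FObj F Y))" "?r \<in> Hom C X (Go (FObj F Y))"
        using o f by (simp_all add: C.Comp_in_Hom GoC Fo u GH Fa)
      have "FArr F X (Go (FObj F Y)) ?r =
          Comp D (FObj F X) (FObj F (Go (FObj F X))) (FObj F (Go (FObj F Y)))
            (Gt (FObj F X) (FObj F Y) (FArr F X Y f)) (e' (FObj F X))"
        using o f by (simp add: Fc u GoC Fo GH Fa FG)
      also have "\<dots> = Comp D (FObj F X) (FObj F Y) (FObj F (Go (FObj F Y))) (e' (FObj F Y)) (FArr F X Y f)"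
        unfolding Gt_def using o f
        by (simp add: D.Comp_assoc[symmetric] Fo FGo Fa eH e'H D.Comp_in_Hom ee' D.Comp_Id)
      also have "\<dots> = FArr F X (Go (FObj F Y)) ?l"
        using o f by (simp add: Fc u GoC Fo)
      finally show "FArr F X (Go (FObj F Y)) ?l = FArr F X (Go (FObj F Y)) ?r" by simp
    qed
    then show "restrict u (Obj C) \<in> nat_trans C C id_functor (comp_functor G F)"
      using u by (auto simp: nat_trans_def comp_functor_def id_functor_def G_def)
    show "is_iso C (FObj id_functor X) (FObj (comp_functor G F) X) (restrict u (Obj C) X)"
      if X: "X \<in> Obj C" for X
    proof -
      have "Comp C X (Go (FObj F X)) X (u' X) (u X) = Id C X"
        using X by (intro F_inj[of X X])
          (simp_all add: C.Comp_in_Hom GoC Fo u u' C.Id_in_Hom Fc Fi ee')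
      moreover have "Comp C (Go (FObj F X)) X (Go (FObj F X)) (u X) (u' X) = Id C (Go (FObj F X))"
        using X by (intro F_inj[of "Go (FObj F X)" "Go (FObj F X)"])
          (simp_all add: C.Comp_in_Hom GoC Fo u u' C.Id_in_Hom Fc Fi e'e)
      ultimately show ?thesis
        using u[OF X] u'[OF X] X by (auto simp: is_iso_def id_functor_def comp_functor_def G_def)
    qed
  qed
  show ?thesis
    unfolding equivalent_categories_def using assms(1,2) F G unit counit by blast
qed

section \<open>Categories of functors and of structures\<close>

lemma category_SET: "category SET"
  by unfold_locales (auto simp: SET_def compose_def fun_eq_iff PiE_iff extensional_def)

lemma category_Lex:
  assumes "category D"
  shows "category (Lex C D)"
proof -
  interpret D: category D by fact
  have H: "\<eta> X \<in> Hom D (FObj F X) (FObj G X)"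
    if "\<eta> \<in> nat_trans C D F G" "X \<in> Obj C" for \<eta> F G X
    using that by (auto simp: nat_trans_def)
  have O: "FObj F X \<in> Obj D" if "is_functor C D F" "X \<in> Obj C" for F X
    using that by (rule functor_obj)
  have ext: "\<eta> = (\<lambda>X \<in> Obj C. \<eta> X)" if "\<eta> \<in> nat_trans C D F G" for \<eta> F G
    using that by (auto simp: nat_trans_def PiE_iff extensional_def)
  show ?thesis
  proof unfold_locales
    fix F assume "F \<in> Obj (Lex C D)"
    then have F: "is_functor C D F" by (simp add: Lex_def)
    then show "Id (Lex C D) F \<in> Hom (Lex C D) F F"
      by (auto simp: Lex_def nat_trans_def D.Id_in_Hom D.Id_Comp D.Comp_Id functor_obj functor_arr)
  next
    fix F G K \<eta> \<theta>
    assume F: "F \<in> Obj (Lex C D)" and G: "G \<in> Obj (Lex C D)" and K: "K \<in> Obj (Lex C D)"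
      and \<eta>: "\<eta> \<in> Hom (Lex C D) F G" and \<theta>: "\<theta> \<in> Hom (Lex C D) G K"
    have f: "is_functor C D F" "is_functor C D G" "is_functor C D K"
      using F G K by (simp_all add: Lex_def)
    have n: "\<eta> \<in> nat_trans C D F G" "\<theta> \<in> nat_trans C D G K"
      using \<eta> \<theta> by (simp_all add: Lex_def)
    note hs = H[OF n(1)] H[OF n(2)] O[OF f(1)] O[OF f(2)] O[OF f(3)]
    have "Comp D (FObj F X) (FObj F Y) (FObj K Y)
          (Comp D (FObj F Y) (FObj G Y) (FObj K Y) (\<theta> Y) (\<eta> Y)) (FArr F X Y h) =
        Comp D (FObj F X) (FObj K X) (FObj K Y) (FArr K X Y h)
          (Comp D (FObj F X) (FObj G X) (FObj K X) (\<theta> X) (\<eta> X))"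
      if "X \<in> Obj C" "Y \<in> Obj C" "h \<in> Hom C X Y" for X Y h
    proof -
      have 1: "Comp D (FObj F X) (FObj F Y) (FObj G Y) (\<eta> Y) (FArr F X Y h) =
          Comp D (FObj F X) (FObj G X) (FObj G Y) (FArr G X Y h) (\<eta> X)"
        and 2: "Comp D (FObj G X) (FObj G Y) (FObj K Y) (\<theta> Y) (FArr G X Y h) =
          Comp D (FObj G X) (FObj K X) (FObj K Y) (FArr K X Y h) (\<theta> X)"
        using n that by (simp_all add: nat_trans_def)
      show ?thesis
        using that f 1 2 by (simp add: D.Comp_assoc[symmetric] hs functor_arr)
          (simp add: D.Comp_assoc hs functor_arr)
    qed
    then show "Comp (Lex C D) F G K \<theta> \<eta> \<in> Hom (Lex C D) F K"
      using hs by (auto simp: Lex_def nat_trans_def D.Comp_in_Hom)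
  next
    fix F G \<eta> assume a: "F \<in> Obj (Lex C D)" "G \<in> Obj (Lex C D)" "\<eta> \<in> Hom (Lex C D) F G"
    then have n: "\<eta> \<in> nat_trans C D F G" and f: "is_functor C D F" "is_functor C D G"
      by (simp_all add: Lex_def)
    note hs = H[OF n] O[OF f(1)] O[OF f(2)]
    show "Comp (Lex C D) F F G \<eta> (Id (Lex C D) F) = \<eta>"
      by (subst (2) ext[OF n]) (auto simp: Lex_def D.Comp_Id hs)
    show "Comp (Lex C D) F G G (Id (Lex C D) G) \<eta> = \<eta>"
      by (subst (2) ext[OF n]) (auto simp: Lex_def D.Id_Comp hs)
  next
    fix E F G K \<eta> \<theta> \<kappa>
    assume a: "E \<in> Obj (Lex C D)" "F \<in> Obj (Lex C D)" "G \<in> Obj (Lex C D)" "K \<in> Obj (Lex C D)"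
      and b: "\<eta> \<in> Hom (Lex C D) E F" "\<theta> \<in> Hom (Lex C D) F G" "\<kappa> \<in> Hom (Lex C D) G K"
    have f: "is_functor C D E" "is_functor C D F" "is_functor C D G" "is_functor C D K"
      using a by (simp_all add: Lex_def)
    have n: "\<eta> \<in> nat_trans C D E F" "\<theta> \<in> nat_trans C D F G" "\<kappa> \<in> nat_trans C D G K"
      using b by (simp_all add: Lex_def)
    note hs = H[OF n(1)] H[OF n(2)] H[OF n(3)] O[OF f(1)] O[OF f(2)] O[OF f(3)] O[OF f(4)]
    have "Comp (Lex C D) E F K (Comp (Lex C D) F G K \<kappa> \<theta>) \<eta> =
       Comp (Lex C D) E G K \<kappa> (Comp (Lex C D) E F G \<theta> \<eta>)"
      by (auto simp: Lex_def D.Comp_assoc hs)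
    then show "Comp (Lex C D) E G K \<kappa> (Comp (Lex C D) E F G \<theta> \<eta>) =
       Comp (Lex C D) E F K (Comp (Lex C D) F G K \<kappa> \<theta>) \<eta>" by simp
  qed
qed

lemma L_hom_app: "\<lbrakk>h \<in> L_hom M N; n \<ge> 1; x \<in> Sort M n\<rbrakk> \<Longrightarrow> h n x \<in> Sort N n"
  by (auto simp: L_hom_def PiE_iff)

lemma L_hom_Op:
  "\<lbrakk>h \<in> L_hom M N; m \<ge> 1; n \<ge> 1; f \<in> Surj m n; x \<in> Sort M n\<rbrakk>
    \<Longrightarrow> h m (Op M m n f x) = Op N m n f (h n x)"
  by (auto simp: L_hom_def)

lemma L_hom_ext:
  assumes "g \<in> L_hom M N" "h \<in> L_hom M N"
    and "\<And>n x. \<lbrakk>n \<ge> 1; x \<in> Sort M n\<rbrakk> \<Longrightarrow> g n x = h n x"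
  shows "g = h"
proof (rule ext)
  fix n show "g n = h n"
  proof (cases "n \<ge> 1")
    case True
    then have "g n \<in> extensional (Sort M n)" "h n \<in> extensional (Sort M n)"
      using assms(1,2) by (auto simp: L_hom_def PiE_iff)
    then show ?thesis using assms(3) True by (auto intro: extensionalityI)
  next
    case False
    then show ?thesis using assms(1,2) by (auto simp: L_hom_def PiE_iff extensional_def)
  qed
qed

lemma Op_in: "\<lbrakk>L_structure M; m \<ge> 1; n \<ge> 1; f \<in> Surj m n; x \<in> Sort M n\<rbrakk> \<Longrightarrow> Op M m n f x \<in> Sort M m"
  by (auto simp: L_structure_def)

lemma category_Mod_T2: "category Mod_T2"
proof unfold_locales
  fix M :: "'u struct" assume "M \<in> Obj Mod_T2"
  then show "Id Mod_T2 M \<in> Hom Mod_T2 M M"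
    by (auto simp: Mod_T2_def L_hom_def Op_in model_T2_def)
next
  fix M N K :: "'u struct" and f g
  assume "M \<in> Obj Mod_T2" "N \<in> Obj Mod_T2" "K \<in> Obj Mod_T2"
    and f: "f \<in> Hom Mod_T2 M N" and g: "g \<in> Hom Mod_T2 N K"
  then have L: "L_structure M" and f: "f \<in> L_hom M N" and g: "g \<in> L_hom N K"
    by (simp_all add: Mod_T2_def model_T2_def)
  show "Comp Mod_T2 M N K g f \<in> Hom Mod_T2 M K"
    by (auto simp: Mod_T2_def L_hom_def compose_def Op_in[OF L]
        L_hom_app[OF f] L_hom_app[OF g] L_hom_Op[OF f] L_hom_Op[OF g])
next
  fix M N :: "'u struct" and f
  assume "M \<in> Obj Mod_T2" "N \<in> Obj Mod_T2" and f: "f \<in> Hom Mod_T2 M N"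
  then have f: "f \<in> L_hom M N" by (simp add: Mod_T2_def)
  have e: "f n x = undefined" if "n \<ge> 1" "x \<notin> Sort M n" for n x
    using f that by (auto simp: L_hom_def PiE_iff extensional_def)
  have e0: "f n = undefined" if "\<not> n \<ge> 1" for n
    using f that by (auto simp: L_hom_def PiE_iff extensional_def)
  show "Comp Mod_T2 M M N f (Id Mod_T2 M) = f"
    using e e0 by (auto simp: Mod_T2_def compose_def fun_eq_iff)
  show "Comp Mod_T2 M N N (Id Mod_T2 N) f = f"
    using e e0 L_hom_app[OF f] by (auto simp: Mod_T2_def compose_def fun_eq_iff)
next
  fix M N K P :: "'u struct" and f g h
  assume "f \<in> Hom Mod_T2 M N"
  then have f: "f \<in> L_hom M N" by (simp add: Mod_T2_def)
  have "Comp Mod_T2 M N P (Comp Mod_T2 N K P h g) f =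
       Comp Mod_T2 M K P h (Comp Mod_T2 M N K g f)"
    using L_hom_app[OF f] by (auto simp: Mod_T2_def compose_def fun_eq_iff)
  then show "Comp Mod_T2 M K P h (Comp Mod_T2 M N K g f) =
       Comp Mod_T2 M N P (Comp Mod_T2 N K P h g) f" by simp
qed

text \<open>The inverse maps commute automatically with the operations.\<close>

lemma is_iso_Mod_T2:
  assumes L: "L_structure M" and h: "h \<in> L_hom M N"
    and bij: "\<And>n. n \<ge> 1 \<Longrightarrow> bij_betw (h n) (Sort M n) (Sort N n)"
  shows "is_iso Mod_T2 M N h"
proof -
  define g where "g = (\<lambda>n \<in> {1..}. \<lambda>y \<in> Sort N n. inv_into (Sort M n) (h n) y)"
  have gM: "g n y \<in> Sort M n" and hg: "h n (g n y) = y" if "n \<ge> 1" "y \<in> Sort N n" for n y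
    using bij[OF that(1)] that by (auto simp: g_def bij_betw_def inv_into_into f_inv_into_f)
  have gh: "g n (h n x) = x" if "n \<ge> 1" "x \<in> Sort M n" for n x
    using bij[OF that(1)] that by (auto simp: g_def bij_betw_def)
  have Lh: "h m (Op M m n f x) = Op N m n f (h n x)"
    if "m \<ge> 1" "n \<ge> 1" "f \<in> Surj m n" "x \<in> Sort M n" for m n f x
    using L_hom_Op[OF h that] .
  have "g m (Op N m n f y) = Op M m n f (g n y)"
    if "m \<ge> 1" "n \<ge> 1" "f \<in> Surj m n" "y \<in> Sort N n" for m n f y
    using gh[OF that(1) Op_in[OF L that(1,2,3) gM[OF that(2,4)]]] Lh[OF that(1-3) gM[OF that(2,4)]]
      hg[OF that(2,4)] by simp
  moreover have "g \<in> (\<Pi>\<^sub>E n \<in> {1..}. Sort N n \<rightarrow>\<^sub>E Sort M n)"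
    using gM by (auto simp: g_def PiE_iff)
  ultimately have "g \<in> L_hom N M" by (auto simp: L_hom_def)
  then show ?thesis
    unfolding is_iso_def using h gM hg gh
    by (auto simp: Mod_T2_def compose_def fun_eq_iff L_hom_app intro!: bexI[of _ g])
qed

section \<open>Homomorphisms of S5-algebras\<close>

lemma s5_hom_closed: "\<lbrakk>h \<in> s5_hom A B; x \<in> carrier A\<rbrakk> \<Longrightarrow> h x \<in> carrier B"
  by (auto simp: s5_hom_def)

lemma s5_hom_ops:
  assumes "h \<in> s5_hom A B"
  shows "h tt\<^bsub>A\<^esub> = tt\<^bsub>B\<^esub>" "h ff\<^bsub>A\<^esub> = ff\<^bsub>B\<^esub>"
    "\<And>x y. \<lbrakk>x \<in> carrier A; y \<in> carrier A\<rbrakk> \<Longrightarrow> h (x \<curlywedge>\<^bsub>A\<^esub> y) = h x \<curlywedge>\<^bsub>B\<^esub> h y"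
    "\<And>x y. \<lbrakk>x \<in> carrier A; y \<in> carrier A\<rbrakk> \<Longrightarrow> h (x \<curlyvee>\<^bsub>A\<^esub> y) = h x \<curlyvee>\<^bsub>B\<^esub> h y"
    "\<And>x. x \<in> carrier A \<Longrightarrow> h (neg\<^bsub>A\<^esub> x) = neg\<^bsub>B\<^esub> (h x)"
    "\<And>x. x \<in> carrier A \<Longrightarrow> h (box\<^bsub>A\<^esub> x) = box\<^bsub>B\<^esub> (h x)"
  using assms by (auto simp: s5_hom_def)

lemma s5_hom_eqI:
  "\<lbrakk>g \<in> s5_hom A B; h \<in> s5_hom A B; \<And>x. x \<in> carrier A \<Longrightarrow> g x = h x\<rbrakk> \<Longrightarrow> g = h"
  by (auto simp: s5_hom_def PiE_iff intro: extensionalityI)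

lemma s5_hom_id:
  assumes "s5_algebra A"
  shows "(\<lambda>x \<in> carrier A. x) \<in> s5_hom A A"
proof -
  interpret s5_algebra A by fact
  show ?thesis
    by (simp add: s5_hom_def top_closed bot_closed meet_closed join_closed neg_closed box_closed)
qed

lemma s5_hom_compose:
  assumes "s5_algebra A" and f: "f \<in> s5_hom A B" and g: "g \<in> s5_hom B C"
  shows "compose (carrier A) g f \<in> s5_hom A C"
proof -
  interpret s5_algebra A by fact
  note closed = top_closed bot_closed meet_closed join_closed neg_closed box_closed
  have c: "f x \<in> carrier B" "g (f x) \<in> carrier C" if "x \<in> carrier A" for x
    using s5_hom_closed[OF f that] s5_hom_closed[OF g] by simp_all
  show ?thesis
    using f g by (simp add: s5_hom_def compose_def closed c)
qed

lemma s5_hom_inverse: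
  assumes "s5_algebra A" and h: "h \<in> s5_hom A B" and b: "bij_betw h (carrier A) (carrier B)"
  shows "(\<lambda>y \<in> carrier B. inv_into (carrier A) h y) \<in> s5_hom B A"
proof -
  interpret s5_algebra A by fact
  note closed = top_closed bot_closed meet_closed join_closed neg_closed box_closed
  have iv: "inv_into (carrier A) h (h x) = x" if "x \<in> carrier A" for x
    using b that by (simp add: bij_betw_def)
  note hom = s5_hom_ops[OF h]
  have cB: "carrier B = h ` carrier A" using b by (simp add: bij_betw_def)
  have hB: "h x \<in> carrier B" if "x \<in> carrier A" for x using that cB by simp
  have hB': "tt\<^bsub>B\<^esub> \<in> carrier B" "ff\<^bsub>B\<^esub> \<in> carrier B"
    "\<And>x y. \<lbrakk>x \<in> carrier A; y \<in> carrier A\<rbrakk> \<Longrightarrow> h x \<curlywedge>\<^bsub>B\<^esub> h y \<in> carrier B"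
    "\<And>x y. \<lbrakk>x \<in> carrier A; y \<in> carrier A\<rbrakk> \<Longrightarrow> h x \<curlyvee>\<^bsub>B\<^esub> h y \<in> carrier B"
    "\<And>x. x \<in> carrier A \<Longrightarrow> neg\<^bsub>B\<^esub> (h x) \<in> carrier B"
    "\<And>x. x \<in> carrier A \<Longrightarrow> box\<^bsub>B\<^esub> (h x) \<in> carrier B"
    using hom hB closed by metis+
  have iv': "inv_into (carrier A) h tt\<^bsub>B\<^esub> = tt\<^bsub>A\<^esub>" "inv_into (carrier A) h ff\<^bsub>B\<^esub> = ff\<^bsub>A\<^esub>"
    "\<And>x y. \<lbrakk>x \<in> carrier A; y \<in> carrier A\<rbrakk> \<Longrightarrow> inv_into (carrier A) h (h x \<curlywedge>\<^bsub>B\<^esub> h y) = x \<curlywedge>\<^bsub>A\<^esub> y"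
    "\<And>x y. \<lbrakk>x \<in> carrier A; y \<in> carrier A\<rbrakk> \<Longrightarrow> inv_into (carrier A) h (h x \<curlyvee>\<^bsub>B\<^esub> h y) = x \<curlyvee>\<^bsub>A\<^esub> y"
    "\<And>x. x \<in> carrier A \<Longrightarrow> inv_into (carrier A) h (neg\<^bsub>B\<^esub> (h x)) = neg\<^bsub>A\<^esub> x"
    "\<And>x. x \<in> carrier A \<Longrightarrow> inv_into (carrier A) h (box\<^bsub>B\<^esub> (h x)) = box\<^bsub>A\<^esub> x"
    using hom iv closed by metis+
  show ?thesis
    by (simp add: s5_hom_def hB hB' iv iv' cB closed image_subset_iff PiE_iff)
      (simp add: cB[symmetric] hB')
qed

lemma finite_s5_copy:
  fixes A :: "'a s5_alg"
  assumes "s5_algebra A" "finite (carrier A)"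
  obtains B e d where "B \<in> Obj S5Alg_fin" "e \<in> s5_hom A B" "d \<in> s5_hom B A"
    "\<And>x. x \<in> carrier A \<Longrightarrow> d (e x) = x" "\<And>y. y \<in> carrier B \<Longrightarrow> e (d y) = y"
proof -
  obtain B h where B: "B \<in> Obj S5Alg_fin" "h \<in> s5_hom A B" "bij_betw h (carrier A) (carrier B)"
    using s5_algebra_nat_copy[OF assms] by blast
  show thesis
    by (rule that[OF B(1,2) s5_hom_inverse[OF assms(1) B(2,3)]])
      (use B(3) in \<open>auto simp: bij_betw_def inv_into_f_f f_inv_into_f\<close>)
qed

section \<open>Complex algebras and their duality\<close>

text \<open>
  The complex algebra of the S5-frame on \<open>X\<close> whose clusters are the fibres of \<open>k\<close>.  Presenting the
  equivalence relation by a labelling makes every pair \<open>(X, k)\<close> a legitimate frame.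
\<close>

definition Cm :: "'x set \<Rightarrow> ('x \<Rightarrow> 'k) \<Rightarrow> 'x set s5_alg" where
  "Cm X k = \<lparr>carrier = Pow X, s5_top = X, s5_bot = {}, s5_meet = (\<inter>), s5_join = (\<union>),
     s5_neg = (\<lambda>S. X - S), s5_box = (\<lambda>S. {x \<in> X. \<forall>y \<in> X. k y = k x \<longrightarrow> y \<in> S})\<rparr>"

lemma Cm_simps [simp]:
  "carrier (Cm X k) = Pow X" "s5_top (Cm X k) = X" "s5_bot (Cm X k) = {}"
  "s5_meet (Cm X k) S T = S \<inter> T" "s5_join (Cm X k) S T = S \<union> T" "s5_neg (Cm X k) S = X - S"
  "s5_box (Cm X k) S = {x \<in> X. \<forall>y \<in> X. k y = k x \<longrightarrow> y \<in> S}"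
  by (simp_all add: Cm_def)

lemma s5_algebra_Cm: "s5_algebra (Cm X k)"
  by unfold_locales (auto simp: s5_le_def s5_dia_def)

text \<open>
  For an equivalence relation, the forth and back conditions on a bounded morphism say together
  that every cluster is mapped onto a whole cluster.
\<close>

definition p_morphism :: "'z set \<Rightarrow> ('z \<Rightarrow> 'l) \<Rightarrow> 'x set \<Rightarrow> ('x \<Rightarrow> 'k) \<Rightarrow> ('z \<Rightarrow> 'x) \<Rightarrow> bool" where
  "p_morphism Z l X k t \<longleftrightarrow> t ` Z \<subseteq> X \<and>
    (\<forall>z \<in> Z. t ` {z' \<in> Z. l z' = l z} = {x \<in> X. k x = k (t z)})"

definition preimage_hom :: "'x set \<Rightarrow> 'z set \<Rightarrow> ('z \<Rightarrow> 'x) \<Rightarrow> 'x set \<Rightarrow> 'z set" where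
  "preimage_hom X Z t = (\<lambda>S \<in> Pow X. {z \<in> Z. t z \<in> S})"

lemma preimage_hom_apply: "S \<subseteq> X \<Longrightarrow> preimage_hom X Z t S = {z \<in> Z. t z \<in> S}"
  by (simp add: preimage_hom_def)

text \<open>
  The box is preserved because a set contains the cluster of \<open>t z\<close> iff its preimage contains the
  cluster of \<open>z\<close>.
\<close>

lemma preimage_hom_in_s5_hom:
  assumes "p_morphism Z l X k t"
  shows "preimage_hom X Z t \<in> s5_hom (Cm X k) (Cm Z l)"
proof -
  have t: "t z \<in> X" if "z \<in> Z" for z
    using assms that by (auto simp: p_morphism_def)
  have f: "{x \<in> X. k x = k (t z)} = t ` {z' \<in> Z. l z' = l z}" if "z \<in> Z" for z
    using assms that by (auto simp: p_morphism_def)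
  have "(\<forall>y \<in> X. k y = k (t z) \<longrightarrow> y \<in> S) \<longleftrightarrow> (\<forall>z' \<in> Z. l z' = l z \<longrightarrow> t z' \<in> S)"
    if "z \<in> Z" for z S
  proof -
    have "(\<forall>y \<in> X. k y = k (t z) \<longrightarrow> y \<in> S) \<longleftrightarrow> (\<forall>y \<in> {x \<in> X. k x = k (t z)}. y \<in> S)" by blast
    also have "\<dots> \<longleftrightarrow> (\<forall>z' \<in> Z. l z' = l z \<longrightarrow> t z' \<in> S)" unfolding f[OF that] by blast
    finally show ?thesis .
  qed
  then have b: "{z \<in> Z. t z \<in> {x \<in> X. \<forall>y \<in> X. k y = k x \<longrightarrow> y \<in> S}} =
      {z \<in> Z. \<forall>z' \<in> Z. l z' = l z \<longrightarrow> t z' \<in> S}" for S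
    using t by blast
  have p: "preimage_hom X Z t S = {z \<in> Z. t z \<in> S}" if "S \<subseteq> X" for S
    by (rule preimage_hom_apply[OF that])
  have "preimage_hom X Z t \<in> Pow X \<rightarrow>\<^sub>E Pow Z" by (auto simp: preimage_hom_def)
  moreover have "preimage_hom X Z t {x \<in> X. \<forall>y \<in> X. k y = k x \<longrightarrow> y \<in> S} =
     {z \<in> Z. \<forall>z' \<in> Z. l z' = l z \<longrightarrow> t z' \<in> S}" for S
    by (subst p) (use b in auto)
  ultimately show ?thesis
    using t by (auto simp: s5_hom_def p le_infI1)
qed

text \<open>
  A point \<open>z\<close> picks out the ultrafilter of all \<open>S\<close> with \<open>z \<in> h S\<close>; since it contains a finite set,
  it is principal, and \<open>t z\<close> is its generator.  That \<open>h\<close> commutes with the box, applied to the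
  cluster of \<open>t z\<close> and to the complement of a point of it, shows that clusters go onto clusters.
\<close>

lemma finite_support_hom_is_preimage:
  assumes h: "h \<in> s5_hom (Cm X k) (Cm Z l)" and Y: "finite Y" "Y \<subseteq> X" "h Y = Z"
  obtains t where "p_morphism Z l X k t" "h = preimage_hom X Z t"
proof -
  have bot: "h {} = {}"
    and meet: "\<And>S T. \<lbrakk>S \<subseteq> X; T \<subseteq> X\<rbrakk> \<Longrightarrow> h (S \<inter> T) = h S \<inter> h T"
    and join: "\<And>S T. \<lbrakk>S \<subseteq> X; T \<subseteq> X\<rbrakk> \<Longrightarrow> h (S \<union> T) = h S \<union> h T"
    and box: "\<And>S. S \<subseteq> X \<Longrightarrow> h {x \<in> X. \<forall>y \<in> X. k y = k x \<longrightarrow> y \<in> S} =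
      {z \<in> Z. \<forall>z' \<in> Z. l z' = l z \<longrightarrow> z' \<in> h S}"
    and ext: "h \<in> extensional (Pow X)" and sub: "\<And>S. S \<subseteq> X \<Longrightarrow> h S \<subseteq> Z"
    using h by (auto simp: s5_hom_def PiE_iff)
  have fin: "\<exists>x \<in> S. z \<in> h {x}" if "finite S" "S \<subseteq> X" "z \<in> h S" for S z
    using that
  proof (induction S rule: finite_induct)
    case empty
    then show ?case using bot by simp
  next
    case (insert x S)
    then have "z \<in> h {x} \<union> h S" using join[of "{x}" S] by simp
    then show ?case using insert by blast
  qed
  define t where "t z = (SOME x. x \<in> Y \<and> z \<in> h {x})" for z
  have t: "t z \<in> X" "z \<in> h {t z}" if "z \<in> Z" for z
  proof -
    have "t z \<in> Y \<and> z \<in> h {t z}" unfolding t_def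
      by (rule someI_ex) (use fin[of Y z] Y that in auto)
    then show "t z \<in> X" "z \<in> h {t z}" using Y by auto
  qed
  have hS: "h S = {z \<in> Z. t z \<in> S}" if S: "S \<subseteq> X" for S
  proof -
    have "z \<in> h S \<longleftrightarrow> t z \<in> S" if z: "z \<in> Z" for z
    proof
      assume "z \<in> h S"
      then have "z \<in> h ({t z} \<inter> S)" using meet[of "{t z}" S] t[OF z] S by simp
      then show "t z \<in> S" using bot by (cases "t z \<in> S") auto
    next
      assume "t z \<in> S"
      then have "h {t z} = h {t z} \<inter> h S" using meet[of "{t z}" S] t[OF z] S by (simp add: Int_absorb2)
      then show "z \<in> h S" using t[OF z] by blast
    qed
    then show ?thesis using sub[OF S] by blast
  qed
  have "p_morphism Z l X k t"
    unfolding p_morphism_def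
  proof (intro conjI ballI subset_antisym)
    show "t ` Z \<subseteq> X" using t by blast
  next
    fix z assume z: "z \<in> Z"
    let ?F = "{x \<in> X. k x = k (t z)}"
    have "{x \<in> X. \<forall>y \<in> X. k y = k x \<longrightarrow> y \<in> ?F} = ?F" by auto
    then have "h ?F = {z \<in> Z. \<forall>z' \<in> Z. l z' = l z \<longrightarrow> z' \<in> h ?F}" using box[of ?F] by simp
    moreover have "z \<in> h ?F" using hS[of ?F] z t by auto
    ultimately have "z' \<in> h ?F" if "z' \<in> Z" "l z' = l z" for z' using that by blast
    then show "t ` {z' \<in> Z. l z' = l z} \<subseteq> ?F" using hS[of ?F] by auto
  next
    fix z assume z: "z \<in> Z"
    show "{x \<in> X. k x = k (t z)} \<subseteq> t ` {z' \<in> Z. l z' = l z}"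
    proof (rule ccontr)
      assume "\<not> ?thesis"
      then obtain x where x: "x \<in> X" "k x = k (t z)" "x \<notin> t ` {z' \<in> Z. l z' = l z}" by blast
      then have "z \<in> {z \<in> Z. \<forall>z' \<in> Z. l z' = l z \<longrightarrow> z' \<in> h (X - {x})}"
        using z hS[of "X - {x}"] t by auto
      then have "z \<in> h {y \<in> X. \<forall>y' \<in> X. k y' = k y \<longrightarrow> y' \<in> X - {x}}" using box[of "X - {x}"] by simp
      then have "t z \<in> {y \<in> X. \<forall>y' \<in> X. k y' = k y \<longrightarrow> y' \<in> X - {x}}" by (subst (asm) hS) auto
      then show False using x by auto
    qed
  qed
  moreover have "h = preimage_hom X Z t"
    by (rule extensionalityI[OF ext]) (auto simp: preimage_hom_def hS)
  ultimately show thesis by (rule that)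
qed

section \<open>Representation of finite S5-algebras\<close>

context boolean_alg
begin

definition atoms :: "'a set" where
  "atoms = {x \<in> carrier A. x \<noteq> ff \<and> (\<forall>y \<in> carrier A. x \<curlywedge> y = ff \<or> x \<curlywedge> y = x)}"

definition atoms_below :: "'a \<Rightarrow> 'a set" where
  "atoms_below a = {x \<in> atoms. x \<curlywedge> a = x}"

lemmas closed = top_closed bot_closed meet_closed join_closed neg_closed

lemma meet_idem: "x \<in> carrier A \<Longrightarrow> x \<curlywedge> x = x"
  using meet_join_distrib[of x x "neg x"] by (simp add: closed meet_neg join_neg meet_top join_bot)

lemma meet_bot: "x \<in> carrier A \<Longrightarrow> x \<curlywedge> ff = ff"
  using meet_assoc[of x x "neg x"] by (simp add: closed meet_neg meet_idem)

lemma meet_absorb: "\<lbrakk>x \<in> carrier A; y \<in> carrier A\<rbrakk> \<Longrightarrow> x \<curlywedge> (x \<curlyvee> y) = x"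
  using join_meet_distrib[of x ff y] meet_comm[of ff y] by (simp add: closed join_bot meet_bot)

lemma atoms_carrier: "x \<in> atoms \<Longrightarrow> x \<in> carrier A"
  by (simp add: atoms_def)

lemma below_top: "atoms_below tt = atoms"
  by (auto simp: atoms_below_def atoms_carrier meet_top)

lemma below_bot: "atoms_below ff = {}"
  by (auto simp: atoms_below_def atoms_carrier meet_bot) (simp add: atoms_def)

lemma below_meet:
  assumes "a \<in> carrier A" "b \<in> carrier A"
  shows "atoms_below (a \<curlywedge> b) = atoms_below a \<inter> atoms_below b"
proof -
  have "x \<curlywedge> (a \<curlywedge> b) = x \<longleftrightarrow> x \<curlywedge> a = x \<and> x \<curlywedge> b = x" if "x \<in> carrier A" for x
    using that assms by (metis meet_assoc meet_comm meet_closed meet_idem)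
  then show ?thesis by (auto simp: atoms_below_def atoms_carrier)
qed

lemma below_join:
  assumes "a \<in> carrier A" "b \<in> carrier A"
  shows "atoms_below (a \<curlyvee> b) = atoms_below a \<union> atoms_below b"
proof -
  have "x \<curlywedge> (a \<curlyvee> b) = x \<longleftrightarrow> x \<curlywedge> a = x \<or> x \<curlywedge> b = x" if "x \<in> atoms" for x
  proof -
    have x: "x \<in> carrier A" "x \<noteq> ff" "x \<curlywedge> a = ff \<or> x \<curlywedge> a = x" "x \<curlywedge> b = ff \<or> x \<curlywedge> b = x"
      using that assms by (auto simp: atoms_def)
    show ?thesis
      using x assms by (metis bot_closed join_bot join_comm meet_absorb meet_assoc meet_join_distrib
          join_closed meet_closed)
  qed
  then show ?thesis by (auto simp: atoms_below_def)
qed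

lemma below_neg:
  assumes "a \<in> carrier A"
  shows "atoms_below (neg a) = atoms - atoms_below a"
proof -
  have "atoms_below a \<inter> atoms_below (neg a) = {}" "atoms_below a \<union> atoms_below (neg a) = atoms"
    using assms below_meet[of a "neg a"] below_join[of a "neg a"]
    by (simp_all add: neg_closed meet_neg join_neg below_bot below_top)
  then show ?thesis by blast
qed

lemma below_atom:
  assumes "x \<in> atoms"
  shows "atoms_below x = {x}"
proof -
  have "y = x" if "y \<in> atoms" "y \<curlywedge> x = y" for y
    using that assms meet_comm[of x y] by (auto simp: atoms_def)
  then show ?thesis using assms by (auto simp: atoms_below_def meet_idem atoms_carrier)
qed

text \<open>
  By induction on the number of elements below \<open>a\<close>: if \<open>a\<close> is not an atom, then some \<open>a \<curlywedge> y\<close>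
  lies strictly between \<open>ff\<close> and \<open>a\<close>.
\<close>

lemma below_nonempty:
  assumes fin: "finite (carrier A)" and a: "a \<in> carrier A" "a \<noteq> ff"
  shows "atoms_below a \<noteq> {}"
proof -
  define D where "D b = {z \<in> carrier A. z \<curlywedge> b = z}" for b
  have finD: "finite (D b)" for b using fin by (simp add: D_def)
  have "\<forall>a. a \<in> carrier A \<longrightarrow> a \<noteq> ff \<longrightarrow> card (D a) = n \<longrightarrow> atoms_below a \<noteq> {}" for n
  proof (induction n rule: less_induct)
    case (less n)
    show ?case
    proof (intro allI impI)
      fix a assume a: "a \<in> carrier A" "a \<noteq> ff" "card (D a) = n"
      show "atoms_below a \<noteq> {}"
      proof (cases "a \<in> atoms")
        case True
        then show ?thesis using below_atom[OF True] by simp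
      next
        case False
        then obtain y where y: "y \<in> carrier A" "a \<curlywedge> y \<noteq> ff" "a \<curlywedge> y \<noteq> a"
          using a(1,2) unfolding atoms_def by blast
        define b where "b = a \<curlywedge> y"
        have b: "b \<in> carrier A" unfolding b_def using meet_closed a(1) y(1) .
        have "a \<curlywedge> b = b"
          unfolding b_def using meet_assoc[OF a(1) a(1) y(1)] meet_idem[OF a(1)] by simp
        then have ba: "b \<curlywedge> a = b" using meet_comm[OF a(1) b] by simp
        have "D b \<subseteq> D a"
        proof
          fix z assume "z \<in> D b"
          then have z: "z \<in> carrier A" "z \<curlywedge> b = z" by (simp_all add: D_def)
          have "z \<curlywedge> a = (z \<curlywedge> b) \<curlywedge> a" by (simp only: z(2))
          also have "\<dots> = z \<curlywedge> b" using meet_assoc[OF z(1) b a(1)] by (simp only: ba)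
          finally show "z \<in> D a" using z by (simp add: D_def)
        qed
        moreover have "a \<in> D a" using meet_idem[OF a(1)] a(1) by (simp add: D_def)
        moreover have "a \<notin> D b" using \<open>a \<curlywedge> b = b\<close> y(3) by (simp add: D_def b_def)
        ultimately have "card (D b) < n"
          unfolding a(3)[symmetric] by (intro psubset_card_mono finD) blast
        then have "atoms_below b \<noteq> {}" using less.IH b y(2) unfolding b_def by blast
        then show ?thesis using below_meet[OF a(1) y(1)] unfolding b_def by blast
      qed
    qed
  qed
  then show ?thesis using a by blast
qed

text \<open>
  If \<open>a\<close> and \<open>b\<close> have the same atoms, then there is no atom below \<open>a \<curlywedge> neg b\<close>, so this is \<open>ff\<close>.
\<close>

lemma below_inj:
  assumes fin: "finite (carrier A)" and ab: "a \<in> carrier A" "b \<in> carrier A"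
    and eq: "atoms_below a = atoms_below b"
  shows "a = b"
proof -
  have le: "x \<curlywedge> y = x" if "x \<in> carrier A" "y \<in> carrier A" "atoms_below x = atoms_below y" for x y
  proof -
    have "atoms_below (x \<curlywedge> neg y) = {}"
      using that below_meet[of x "neg y"] below_neg[of y] by (auto simp: neg_closed)
    then have "x \<curlywedge> neg y = ff"
      using below_nonempty[OF fin, of "x \<curlywedge> neg y"] that by (auto simp: closed)
    then have "x \<curlywedge> (y \<curlyvee> neg y) = x \<curlywedge> y"
      using that by (simp add: meet_join_distrib closed join_bot)
    then show ?thesis using that by (metis join_neg meet_top)
  qed
  have "a = a \<curlywedge> b" by (rule le[OF ab eq, symmetric])
  also have "\<dots> = b \<curlywedge> a" by (rule meet_comm[OF ab])
  also have "\<dots> = b" by (rule le[OF ab(2,1) eq[symmetric]])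
  finally show ?thesis .
qed

lemma below_surj:
  assumes "finite S" "S \<subseteq> atoms"
  obtains a where "a \<in> carrier A" "atoms_below a = S"
proof -
  have "\<exists>a \<in> carrier A. atoms_below a = S"
    using assms
  proof (induction S rule: finite_induct)
    case empty
    then show ?case using below_bot bot_closed by blast
  next
    case (insert x S)
    then obtain a where a: "a \<in> carrier A" "atoms_below a = S" by auto
    have x: "x \<in> carrier A" "atoms_below x = {x}"
      using insert below_atom atoms_carrier by auto
    then show ?case using a below_join[of x a] by (auto intro!: bexI[of _ "x \<curlyvee> a"] simp: closed)
  qed
  then show thesis using that by blast
qed

end

context s5_algebra
begin

lemma dia_closed: "x \<in> carrier A \<Longrightarrow> dia x \<in> carrier A"
  by (simp add: s5_dia_def neg_closed box_closed)

lemma below_mono: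
  "\<lbrakk>x \<in> carrier A; y \<in> carrier A; x \<preceq> y\<rbrakk> \<Longrightarrow> atoms_below x \<subseteq> atoms_below y"
  by (metis below_meet s5_le_def inf.cobounded2)

lemma below_atoms: "atoms_below x \<subseteq> atoms"
  by (auto simp: atoms_below_def)

lemma below_neg_neg: "x \<in> carrier A \<Longrightarrow> atoms_below (neg (neg x)) = atoms_below x"
  by (simp add: below_neg neg_closed double_diff[OF below_atoms subset_refl])

lemma below_dia: "x \<in> carrier A \<Longrightarrow> atoms_below (dia x) = atoms - atoms_below (box (neg x))"
  by (simp add: s5_dia_def below_neg neg_closed box_closed)

lemma below_box_mono:
  assumes "finite (carrier A)" and xy: "x \<in> carrier A" "y \<in> carrier A"
    and sub: "atoms_below x \<subseteq> atoms_below y"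
  shows "atoms_below (box x) \<subseteq> atoms_below (box y)"
proof -
  have "x \<curlywedge> y = x"
    by (rule below_inj[OF assms(1)]) (use xy sub in \<open>auto simp: meet_closed below_meet\<close>)
  then have "box x \<curlywedge> box y = box x" using box_meet[OF xy] by simp
  then show ?thesis using xy by (intro below_mono) (simp_all add: s5_le_def box_closed)
qed

lemma below_dia_mono:
  assumes "finite (carrier A)" "x \<in> carrier A" "y \<in> carrier A" "atoms_below x \<subseteq> atoms_below y"
  shows "atoms_below (dia x) \<subseteq> atoms_below (dia y)"
proof -
  have "atoms_below (box (neg y)) \<subseteq> atoms_below (box (neg x))"
    using assms by (intro below_box_mono) (auto simp: neg_closed below_neg)
  then show ?thesis using assms by (auto simp: below_dia)
qed

lemma below_dia_refl: "x \<in> carrier A \<Longrightarrow> atoms_below x \<subseteq> atoms_below (dia x)"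
  using below_mono[OF _ _ box_refl[of "neg x"]] below_atoms[of x]
  by (auto simp: below_dia below_neg neg_closed box_closed)

lemma below_dia_trans:
  assumes fin: "finite (carrier A)" and x: "x \<in> carrier A"
  shows "atoms_below (dia (dia x)) \<subseteq> atoms_below (dia x)"
proof -
  have "neg (neg (box (neg x))) = box (neg x)"
    by (rule below_inj[OF fin]) (simp_all add: below_neg_neg neg_closed box_closed x)
  then have "neg (dia x) = box (neg x)" by (simp add: s5_dia_def)
  then show ?thesis
    using below_mono[OF _ _ box_trans[of "neg x"]] x
    by (auto simp: below_dia dia_closed neg_closed box_closed)
qed

text \<open>
  Symmetry of the relation \<open>x \<preceq> dia y\<close> on atoms is due to \<open>x \<preceq> box (dia x)\<close>, and its transitivity
  to \<open>box x \<preceq> box (box x)\<close>.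
\<close>

lemma dia_eq_if_below:
  assumes fin: "finite (carrier A)" and x: "x \<in> atoms" and y: "y \<in> atoms"
    and le: "x \<in> atoms_below (dia y)"
  shows "dia y = dia x"
proof -
  note c = atoms_carrier[OF x] atoms_carrier[OF y]
  note cl = neg_closed box_closed dia_closed
  have "y \<in> atoms_below (dia x)"
  proof (rule ccontr)
    assume "y \<notin> atoms_below (dia x)"
    then have "atoms_below (dia x) \<subseteq> atoms_below (neg y)"
      using below_neg[OF c(2)] below_atom[OF y] below_atoms[of "dia x"] by auto
    then have "atoms_below (box (dia x)) \<subseteq> atoms_below (box (neg y))"
      using c by (intro below_box_mono[OF fin]) (simp_all add: cl)
    moreover have "x \<in> atoms_below (box (dia x))"
      using below_mono[OF _ _ box_sym[OF c(1)]] below_atom[OF x] c by (simp add: cl)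
    ultimately show False using le below_dia[OF c(2)] by blast
  qed
  then have "atoms_below y \<subseteq> atoms_below (dia x)" "atoms_below x \<subseteq> atoms_below (dia y)"
    using le below_atom x y by auto
  then have "atoms_below (dia y) \<subseteq> atoms_below (dia (dia x))"
    "atoms_below (dia x) \<subseteq> atoms_below (dia (dia y))"
    using c by (simp_all add: below_dia_mono[OF fin] cl)
  then have "atoms_below (dia y) = atoms_below (dia x)"
    using below_dia_trans[OF fin c(1)] below_dia_trans[OF fin c(2)] by blast
  then show ?thesis using c by (intro below_inj[OF fin]) (simp_all add: cl)
qed

text \<open>
  In terms of frames the labelling is \<open>dia\<close>: two atoms are related iff they have the same \<open>dia\<close>,
  which is the join of their common cluster.
\<close>

lemma below_box:
  assumes fin: "finite (carrier A)" and a: "a \<in> carrier A"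
  shows "atoms_below (box a) = {x \<in> atoms. \<forall>y \<in> atoms. dia y = dia x \<longrightarrow> y \<in> atoms_below a}"
proof (intro subset_antisym subsetI)
  note cl = neg_closed box_closed dia_closed
  fix x assume x: "x \<in> atoms_below (box a)"
  have xa: "x \<in> atoms" using x below_atoms by blast
  have "y \<in> atoms_below a" if y: "y \<in> atoms" "dia y = dia x" for y
  proof (rule ccontr)
    assume "y \<notin> atoms_below a"
    then have "atoms_below y \<subseteq> atoms_below (neg a)"
      using y below_atom below_neg[OF a] by auto
    then have "atoms_below (dia y) \<subseteq> atoms_below (dia (neg a))"
      using y a atoms_carrier by (intro below_dia_mono[OF fin]) (simp_all add: cl)
    moreover have "x \<in> atoms_below (dia y)"
      using y below_dia_refl[of x] below_atom xa atoms_carrier by auto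
    moreover have "neg (neg a) = a"
      by (rule below_inj[OF fin]) (simp_all add: below_neg_neg cl a)
    ultimately show False using x a below_dia[of "neg a"] by (auto simp: cl)
  qed
  then show "x \<in> {x \<in> atoms. \<forall>y \<in> atoms. dia y = dia x \<longrightarrow> y \<in> atoms_below a}" using xa by blast
next
  fix x assume "x \<in> {x \<in> atoms. \<forall>y \<in> atoms. dia y = dia x \<longrightarrow> y \<in> atoms_below a}"
  then have x: "x \<in> atoms" and xa: "\<And>y. \<lbrakk>y \<in> atoms; dia y = dia x\<rbrakk> \<Longrightarrow> y \<in> atoms_below a" by auto
  \<comment> \<open>\<open>a\<close> is the meet of the coatoms \<open>neg y\<close> above it, and \<open>x\<close> is below each \<open>box (neg y)\<close>\<close>
  have "\<exists>b \<in> carrier A. atoms_below b = atoms - S \<and> x \<in> atoms_below (box b)"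
    if "finite S" "S \<subseteq> atoms - atoms_below a" for S
    using that
  proof (induction S rule: finite_induct)
    case empty
    then show ?case using x by (auto intro!: bexI[of _ tt] simp: below_top box_top top_closed)
  next
    case (insert y S)
    then obtain b where b: "b \<in> carrier A" "atoms_below b = atoms - S" "x \<in> atoms_below (box b)"
      by auto
    have y: "y \<in> atoms" "y \<in> carrier A" using insert atoms_carrier by auto
    have "x \<notin> atoms_below (dia y)"
      using dia_eq_if_below[OF fin x y(1)] xa[OF y(1)] insert.prems by blast
    then have "x \<in> atoms_below (box (neg y))" using below_dia[OF y(2)] x by blast
    then have "x \<in> atoms_below (box (b \<curlywedge> neg y))"
      using b y by (simp add: box_meet below_meet neg_closed box_closed)
    moreover have "atoms_below (b \<curlywedge> neg y) = atoms - insert y S"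
      using b y below_atom by (auto simp: below_meet below_neg neg_closed)
    moreover have "b \<curlywedge> neg y \<in> carrier A" using b y by (simp add: meet_closed neg_closed)
    ultimately show ?case by blast
  qed
  moreover have "finite (atoms - atoms_below a)"
    using fin by (rule rev_finite_subset) (auto simp: atoms_carrier)
  ultimately obtain b where b: "b \<in> carrier A" "atoms_below b = atoms - (atoms - atoms_below a)"
    "x \<in> atoms_below (box b)" by blast
  have "b = a"
    by (rule below_inj[OF fin b(1) a]) (simp add: b(2) double_diff[OF below_atoms subset_refl])
  then show "x \<in> atoms_below (box a)" using b by simp
qed

end

lemma finite_s5_algebra_is_complex:
  fixes A :: "'a s5_alg"
  assumes "s5_algebra A" and fin: "finite (carrier A)"
  obtains X :: "'a set" and k :: "'a \<Rightarrow> 'a" and r d where "finite X"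
    "r \<in> s5_hom A (Cm X k)" "d \<in> s5_hom (Cm X k) A"
    "\<And>a. a \<in> carrier A \<Longrightarrow> d (r a) = a" "\<And>S. S \<subseteq> X \<Longrightarrow> r (d S) = S"
proof -
  interpret s5_algebra A by fact
  define r where "r = (\<lambda>a \<in> carrier A. atoms_below a)"
  let ?C = "Cm atoms (s5_dia A)"
  have fa: "finite atoms" using fin by (rule rev_finite_subset) (auto simp: atoms_carrier)
  have r: "r \<in> s5_hom A ?C"
    by (auto simp: s5_hom_def r_def closed box_closed below_top below_bot below_meet below_join
        below_neg below_box[OF fin]) (auto simp: atoms_below_def)
  have b: "bij_betw r (carrier A) (carrier ?C)"
    unfolding bij_betw_def
  proof
    show "inj_on r (carrier A)" by (rule inj_onI, rule below_inj[OF fin]) (simp_all add: r_def)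
    show "r ` carrier A = carrier ?C"
    proof (intro subset_antisym subsetI)
      show "S \<in> carrier ?C" if "S \<in> r ` carrier A" for S
        using that by (auto simp: r_def atoms_below_def)
      show "S \<in> r ` carrier A" if "S \<in> carrier ?C" for S
      proof -
        have "S \<subseteq> atoms" using that by simp
        moreover from this have "finite S" using fa finite_subset by blast
        ultimately obtain a where "a \<in> carrier A" "atoms_below a = S" using below_surj by blast
        then show ?thesis by (auto simp: r_def intro!: rev_image_eqI)
      qed
    qed
  qed
  show thesis
    by (rule that[OF fa r s5_hom_inverse[OF assms(1) r b]])
      (use b in \<open>auto simp: bij_betw_def inv_into_f_f f_inv_into_f\<close>)
qed

section \<open>Limits in terms of elements\<close>

lemma S5Alg_fin_simps [simp]:
  "A \<in> Obj S5Alg_fin \<longleftrightarrow> s5_algebra A \<and> finite (carrier A)"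
  "Hom S5Alg_fin = s5_hom"
  "Id S5Alg_fin = (\<lambda>A. \<lambda>x \<in> carrier A. x)"
  "Comp S5Alg_fin A B C g f = compose (carrier A) g f"
  by (simp_all add: S5Alg_fin_def)

lemma SET_simps [simp]:
  "X \<in> Obj SET"
  "Hom SET X Y = (X \<rightarrow>\<^sub>E Y)"
  "Id SET X = (\<lambda>x \<in> X. x)"
  "Comp SET X Y Z g f = compose X g f"
  by (simp_all add: SET_def)

lemma functor_comp_functor:
  assumes F: "is_functor C D F" and G: "is_functor D E G"
  shows "is_functor C E (comp_functor G F)"
  using functor_obj[OF F] functor_arr[OF F] functor_id[OF F] functor_comp[OF F]
    functor_obj[OF G] functor_arr[OF G] functor_id[OF G] functor_comp[OF G]
  by (auto simp: is_functor_def comp_functor_def)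

text \<open>
  The limit of a diagram of sets in its standard form; \<open>act\<close> is the action of the arrows of \<open>J\<close>
  on elements.
\<close>

definition matching ::
  "('j, 'i) precategory \<Rightarrow> ('j \<Rightarrow> 'e set) \<Rightarrow> ('j \<Rightarrow> 'j \<Rightarrow> 'i \<Rightarrow> 'e \<Rightarrow> 'e) \<Rightarrow> ('j \<Rightarrow> 'e) set" where
  "matching J elt act = {x \<in> (\<Pi>\<^sub>E j \<in> Obj J. elt j).
    \<forall>i \<in> Obj J. \<forall>j \<in> Obj J. \<forall>u \<in> Hom J i j. act i j u (x i) = x j}"

lemma matching_restrict:
  "restrict x (Obj J) \<in> matching J elt act \<longleftrightarrow> (\<forall>j \<in> Obj J. x j \<in> elt j) \<and>
    (\<forall>i \<in> Obj J. \<forall>j \<in> Obj J. \<forall>u \<in> Hom J i j. act i j u (x i) = x j)"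
  by (auto simp: matching_def PiE_iff)

lemma compose_eqD: "\<lbrakk>compose S g f = h; x \<in> S\<rbrakk> \<Longrightarrow> g (f x) = h x"
  by (auto simp: compose_def)

lemma compose_eqI:
  "\<lbrakk>\<And>x. x \<in> S \<Longrightarrow> g (f x) = h x; h \<in> extensional S\<rbrakk> \<Longrightarrow> compose S g f = h"
  by (rule extensionalityI[of _ S]) (simp_all add: compose_def)

lemma s5_hom_extensional: "h \<in> s5_hom A B \<Longrightarrow> h \<in> extensional (carrier A)"
  by (auto simp: s5_hom_def PiE_iff)

lemma cone_S5_apply:
  assumes "cone J S5Alg_fin D L p" "i \<in> Obj J" "j \<in> Obj J" "u \<in> Hom J i j" "l \<in> carrier L"
  shows "FArr D i j u (p i l) = p j l"
  by (rule compose_eqD[of "carrier L"]) (use assms in \<open>auto simp: cone_def\<close>)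

text \<open>
  The universal arrow is determined elementwise.  It preserves the operations because the
  projections do and are jointly injective.
\<close>

lemma limit_cone_S5I:
  assumes D: "is_functor J S5Alg_fin D" and cone: "cone J S5Alg_fin D L p"
    and ex1: "\<And>x. x \<in> matching J (\<lambda>j. carrier (FObj D j)) (FArr D)
      \<Longrightarrow> \<exists>!l. l \<in> carrier L \<and> (\<forall>j \<in> Obj J. p j l = x j)"
  shows "limit_cone J S5Alg_fin D L p"
  unfolding limit_cone_def
proof (intro conjI cone allI impI)
  fix X q assume q: "cone J S5Alg_fin D X q"
  have L: "s5_algebra L" and p: "\<And>j. j \<in> Obj J \<Longrightarrow> p j \<in> s5_hom L (FObj D j)"
    using cone by (auto simp: cone_def)
  have X: "s5_algebra X" and qh: "\<And>j. j \<in> Obj J \<Longrightarrow> q j \<in> s5_hom X (FObj D j)"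
    using q by (auto simp: cone_def)
  interpret L: s5_algebra L by fact
  interpret X: s5_algebra X by fact
  note Lc = L.top_closed L.bot_closed L.meet_closed L.join_closed L.neg_closed L.box_closed
  note Xc = X.top_closed X.bot_closed X.meet_closed X.join_closed X.neg_closed X.box_closed
  have inj: "l = l'" if "l \<in> carrier L" "l' \<in> carrier L" "\<And>j. j \<in> Obj J \<Longrightarrow> p j l = p j l'" for l l'
  proof -
    have "restrict (\<lambda>j. p j l) (Obj J) \<in> matching J (\<lambda>j. carrier (FObj D j)) (FArr D)"
      unfolding matching_restrict
      using cone_S5_apply[OF cone _ _ _ that(1)] s5_hom_closed[OF p that(1)] by blast
    from ex1[OF this] have "\<exists>!a. a \<in> carrier L \<and> (\<forall>j \<in> Obj J. p j a = p j l)" by simp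
    then show ?thesis using that by metis
  qed
  define h where "h = (\<lambda>a \<in> carrier X. THE l. l \<in> carrier L \<and> (\<forall>j \<in> Obj J. p j l = q j a))"
  have h: "h a \<in> carrier L \<and> (\<forall>j \<in> Obj J. p j (h a) = q j a)" if a: "a \<in> carrier X" for a
  proof -
    have "restrict (\<lambda>j. q j a) (Obj J) \<in> matching J (\<lambda>j. carrier (FObj D j)) (FArr D)"
      unfolding matching_restrict
      using cone_S5_apply[OF q _ _ _ a] s5_hom_closed[OF qh a] by blast
    from theI'[OF ex1[OF this]] show ?thesis using a by (simp add: h_def)
  qed
  then have hc: "h a \<in> carrier L" and ph: "j \<in> Obj J \<Longrightarrow> p j (h a) = q j a"
    if "a \<in> carrier X" for a j using that by auto
  note p_hom = s5_hom_ops[OF p] and q_hom = s5_hom_ops[OF qh]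
  have "h \<in> s5_hom X L"
    unfolding s5_hom_def
  proof (intro CollectI conjI ballI)
    show "h \<in> carrier X \<rightarrow>\<^sub>E carrier L" using hc by (auto simp: PiE_iff h_def)
    show "h tt\<^bsub>X\<^esub> = tt\<^bsub>L\<^esub>" by (rule inj) (simp_all add: hc Lc Xc ph p_hom q_hom)
    show "h ff\<^bsub>X\<^esub> = ff\<^bsub>L\<^esub>" by (rule inj) (simp_all add: hc Lc Xc ph p_hom q_hom)
  next
    fix a assume a: "a \<in> carrier X"
    show "h (neg\<^bsub>X\<^esub> a) = neg\<^bsub>L\<^esub> (h a)" by (rule inj) (simp_all add: a hc Lc Xc ph p_hom q_hom)
    show "h (box\<^bsub>X\<^esub> a) = box\<^bsub>L\<^esub> (h a)" by (rule inj) (simp_all add: a hc Lc Xc ph p_hom q_hom)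
    fix b assume b: "b \<in> carrier X"
    show "h (a \<curlywedge>\<^bsub>X\<^esub> b) = h a \<curlywedge>\<^bsub>L\<^esub> h b" by (rule inj) (simp_all add: a b hc Lc Xc ph p_hom q_hom)
    show "h (a \<curlyvee>\<^bsub>X\<^esub> b) = h a \<curlyvee>\<^bsub>L\<^esub> h b" by (rule inj) (simp_all add: a b hc Lc Xc ph p_hom q_hom)
  qed
  moreover have "compose (carrier X) (p j) h = q j" if "j \<in> Obj J" for j
  proof (rule extensionalityI[of _ "carrier X"])
    show "q j \<in> extensional (carrier X)" using qh[OF that] by (auto simp: s5_hom_def PiE_iff)
  qed (simp_all add: compose_def ph that)
  ultimately show "\<exists>!h. h \<in> Hom S5Alg_fin X L \<and>
      (\<forall>j \<in> Obj J. Comp S5Alg_fin X L (FObj D j) (p j) h = q j)"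
  proof (intro ex1I[of _ h])
    fix h' assume h': "h' \<in> Hom S5Alg_fin X L \<and>
      (\<forall>j \<in> Obj J. Comp S5Alg_fin X L (FObj D j) (p j) h' = q j)"
    then have h'h: "h' \<in> s5_hom X L" by simp
    have "p j (h' a) = q j a" if "j \<in> Obj J" "a \<in> carrier X" for j a
      by (rule compose_eqD[of "carrier X"]) (use h' that in auto)
    then have "h' a = h a" if "a \<in> carrier X" for a
      by - (rule inj, simp_all add: that hc ph s5_hom_closed[OF h'h])
    then show "h' = h" by (rule s5_hom_eqI[OF h'h \<open>h \<in> s5_hom X L\<close>])
  qed auto
qed

text \<open>
  A finite algebra over any type has a copy on natural numbers, along which the universal property
  is carried over.
\<close>

lemma limit_cone_S5_universal:
  fixes B :: "'a s5_alg"
  assumes lim: "limit_cone J S5Alg_fin D L p" and B: "s5_algebra B" "finite (carrier B)"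
    and q: "\<And>j. j \<in> Obj J \<Longrightarrow> q j \<in> s5_hom B (FObj D j)"
    and compat: "\<And>i j u b. \<lbrakk>i \<in> Obj J; j \<in> Obj J; u \<in> Hom J i j; b \<in> carrier B\<rbrakk>
      \<Longrightarrow> FArr D i j u (q i b) = q j b"
  shows "\<exists>!l. l \<in> s5_hom B L \<and> (\<forall>j \<in> Obj J. \<forall>b \<in> carrier B. p j (l b) = q j b)"
proof -
  obtain C e d where C: "C \<in> Obj S5Alg_fin" and e: "e \<in> s5_hom B C" and d: "d \<in> s5_hom C B"
    and de: "\<And>x. x \<in> carrier B \<Longrightarrow> d (e x) = x" and ed: "\<And>y. y \<in> carrier C \<Longrightarrow> e (d y) = y"
    using finite_s5_copy[OF B] by blast
  have CA: "s5_algebra C" using C by simp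
  define q' where "q' j = compose (carrier C) (q j) d" for j
  have q'h: "q' j \<in> s5_hom C (FObj D j)" if "j \<in> Obj J" for j
    unfolding q'_def by (rule s5_hom_compose[OF CA d q[OF that]])
  have "cone J S5Alg_fin D C q'"
    unfolding cone_def
  proof (intro conjI ballI)
    show "C \<in> Obj S5Alg_fin" by (rule C)
    show "q' j \<in> Hom S5Alg_fin C (FObj D j)" if "j \<in> Obj J" for j using q'h[OF that] by simp
    show "Comp S5Alg_fin C (FObj D i) (FObj D j) (FArr D i j u) (q' i) = q' j"
      if "i \<in> Obj J" "j \<in> Obj J" "u \<in> Hom J i j" for i j u
      unfolding S5Alg_fin_simps
    proof (rule compose_eqI)
      show "FArr D i j u (q' i x) = q' j x" if x: "x \<in> carrier C" for x
        using compat[OF \<open>i \<in> Obj J\<close> \<open>j \<in> Obj J\<close> \<open>u \<in> Hom J i j\<close> s5_hom_closed[OF d x]] x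
        by (simp add: q'_def compose_def)
    qed (rule s5_hom_extensional[OF q'h[OF \<open>j \<in> Obj J\<close>]])
  qed
  then have "\<exists>!l'. l' \<in> s5_hom C L \<and> (\<forall>j \<in> Obj J. compose (carrier C) (p j) l' = q' j)"
    using lim unfolding limit_cone_def S5Alg_fin_simps by blast
  then obtain l' where l': "l' \<in> s5_hom C L \<and> (\<forall>j \<in> Obj J. compose (carrier C) (p j) l' = q' j)"
    and uniq: "\<And>l''. l'' \<in> s5_hom C L \<and> (\<forall>j \<in> Obj J. compose (carrier C) (p j) l'' = q' j) \<Longrightarrow> l'' = l'"
    unfolding Ex1_def by blast
  from l' have l'h: "l' \<in> s5_hom C L" and pl': "\<And>j. j \<in> Obj J \<Longrightarrow> compose (carrier C) (p j) l' = q' j"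
    by simp_all
  show ?thesis
  proof (rule ex1I[of _ "compose (carrier B) l' e"])
    have "p j (l' (e b)) = q j b" if "j \<in> Obj J" "b \<in> carrier B" for j b
      using compose_eqD[OF pl'[OF that(1)] s5_hom_closed[OF e that(2)]]
        s5_hom_closed[OF e that(2)] de[OF that(2)] by (simp add: q'_def compose_def)
    then show "compose (carrier B) l' e \<in> s5_hom B L \<and>
        (\<forall>j \<in> Obj J. \<forall>b \<in> carrier B. p j (compose (carrier B) l' e b) = q j b)"
      using s5_hom_compose[OF B(1) e l'h] by (simp add: compose_def)
    fix l assume l: "l \<in> s5_hom B L \<and> (\<forall>j \<in> Obj J. \<forall>b \<in> carrier B. p j (l b) = q j b)"
    have "compose (carrier C) l d = l'"
    proof (intro uniq conjI ballI)
      show "compose (carrier C) l d \<in> s5_hom C L" using s5_hom_compose[OF CA d] l by blast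
      show "compose (carrier C) (p j) (compose (carrier C) l d) = q' j" if "j \<in> Obj J" for j
      proof (rule compose_eqI)
        show "p j (compose (carrier C) l d x) = q' j x" if x: "x \<in> carrier C" for x
          using l \<open>j \<in> Obj J\<close> s5_hom_closed[OF d x] x by (simp add: q'_def compose_def)
      qed (rule s5_hom_extensional[OF q'h[OF that]])
    qed
    then have "l b = l' (e b)" if "b \<in> carrier B" for b
      using compose_eqD[of "carrier C" l d l' "e b"] s5_hom_closed[OF e that] de[OF that] by simp
    then show "l = compose (carrier B) l' e"
      using l s5_hom_compose[OF B(1) e l'h]
      by (intro s5_hom_eqI[of _ B L]) (auto simp: compose_def)
  qed
qed

lemma limit_cone_SET_iff:
  fixes D :: "('j, 'i, 'u set, 'u \<Rightarrow> 'u) cfunctor"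
  assumes D: "is_functor J SET D"
  shows "limit_cone J SET D L p \<longleftrightarrow> cone J SET D L p \<and>
    (\<forall>x \<in> matching J (FObj D) (FArr D). \<exists>!l. l \<in> L \<and> (\<forall>j \<in> Obj J. p j l = x j))"
    (is "?lim \<longleftrightarrow> ?cone \<and> ?elts")
proof
  assume lim: ?lim
  then have cone: ?cone by (simp add: limit_cone_def)
  have univ: "\<exists>!h. h \<in> X \<rightarrow>\<^sub>E L \<and> (\<forall>j \<in> Obj J. compose X (p j) h = q j)"
    if "cone J SET D X q" for X q
    using lim that unfolding limit_cone_def by simp
  have ?elts
  proof
    fix x assume x: "x \<in> matching J (FObj D) (FArr D)"
    \<comment> \<open>elements are maps from a one-element set\<close>
    define X where "X = {undefined :: 'u}"
    define q where "q j = (\<lambda>a \<in> X. x j)" for j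
    have "cone J SET D X q"
      using x by (auto simp: cone_def q_def compose_def matching_def PiE_iff)
    then have "\<exists>!h. h \<in> X \<rightarrow>\<^sub>E L \<and> (\<forall>j \<in> Obj J. compose X (p j) h = q j)" by (rule univ)
    then obtain h where h: "h \<in> X \<rightarrow>\<^sub>E L" "\<forall>j \<in> Obj J. compose X (p j) h = q j"
      and uniq: "\<And>h'. h' \<in> X \<rightarrow>\<^sub>E L \<and> (\<forall>j \<in> Obj J. compose X (p j) h' = q j) \<Longrightarrow> h' = h"
      unfolding Ex1_def by blast
    show "\<exists>!l. l \<in> L \<and> (\<forall>j \<in> Obj J. p j l = x j)"
    proof (rule ex1I[of _ "h undefined"])
      have "p j (h undefined) = x j" if "j \<in> Obj J" for j
        using compose_eqD[OF h(2)[rule_format, OF that], of undefined] by (simp add: q_def X_def)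
      moreover have "h undefined \<in> L" using h(1) by (auto simp: X_def)
      ultimately show "h undefined \<in> L \<and> (\<forall>j \<in> Obj J. p j (h undefined) = x j)" by blast
      fix l assume l: "l \<in> L \<and> (\<forall>j \<in> Obj J. p j l = x j)"
      have "(\<lambda>a \<in> X. l) = h"
        by (rule uniq) (use l in \<open>auto simp: compose_def q_def\<close>)
      then show "l = h undefined" by (auto simp: X_def)
    qed
  qed
  with cone show "?cone \<and> ?elts" by blast
next
  assume "?cone \<and> ?elts"
  then have cone: ?cone and elts: ?elts by auto
  show ?lim
    unfolding limit_cone_def
  proof (intro conjI cone allI impI)
    fix X q assume q: "cone J SET D X q"
    define h where "h = (\<lambda>a \<in> X. THE l. l \<in> L \<and> (\<forall>j \<in> Obj J. p j l = q j a))"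
    have ex1: "\<exists>!l. l \<in> L \<and> (\<forall>j \<in> Obj J. p j l = q j a)" if a: "a \<in> X" for a
    proof -
      have "restrict (\<lambda>j. q j a) (Obj J) \<in> matching J (FObj D) (FArr D)"
        unfolding matching_restrict
      proof (intro conjI ballI)
        show "q j a \<in> FObj D j" if "j \<in> Obj J" for j using q a that by (auto simp: cone_def)
        show "FArr D i j u (q i a) = q j a" if "i \<in> Obj J" "j \<in> Obj J" "u \<in> Hom J i j" for i j u
          by (rule compose_eqD[of X]) (use q that a in \<open>auto simp: cone_def\<close>)
      qed
      from elts[rule_format, OF this] show ?thesis by simp
    qed
    have h: "h a \<in> L \<and> (\<forall>j \<in> Obj J. p j (h a) = q j a)" if a: "a \<in> X" for a
      using theI'[OF ex1[OF a]] a by (simp add: h_def)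
    have qe: "q j \<in> extensional X" if "j \<in> Obj J" for j
      using q that by (auto simp: cone_def PiE_iff)
    have "compose X (p j) h = q j" if "j \<in> Obj J" for j
      by (rule extensionalityI[of _ X]) (simp_all add: compose_def qe h that)
    moreover have "h \<in> X \<rightarrow>\<^sub>E L" using h by (auto simp: PiE_iff h_def)
    moreover have "h' = h"
      if h': "h' \<in> X \<rightarrow>\<^sub>E L" "\<forall>j \<in> Obj J. compose X (p j) h' = q j" for h'
    proof (rule PiE_ext[OF h'(1) \<open>h \<in> X \<rightarrow>\<^sub>E L\<close>])
      fix a assume a: "a \<in> X"
      have "\<forall>j \<in> Obj J. p j (h' a) = q j a" using h'(2) a by (auto intro: compose_eqD)
      then show "h' a = h a" using ex1[OF a] h[OF a] h'(1) a by blast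
    qed
    ultimately have "\<exists>!h. h \<in> X \<rightarrow>\<^sub>E L \<and> (\<forall>j \<in> Obj J. compose X (p j) h = q j)"
      unfolding Ex1_def by blast
    then show "\<exists>!h. h \<in> Hom SET X L \<and> (\<forall>j \<in> Obj J. Comp SET X L (FObj D j) (p j) h = q j)"
      unfolding SET_simps .
  qed
qed

subsection \<open>Existence of finite limits\<close>

definition limit_alg ::
  "('j, 'i) precategory \<Rightarrow> ('j, 'i, 'a s5_alg, 'a \<Rightarrow> 'a) cfunctor \<Rightarrow> ('j \<Rightarrow> 'a) s5_alg" where
  "limit_alg J D = \<lparr>carrier = matching J (\<lambda>j. carrier (FObj D j)) (FArr D),
     s5_top = (\<lambda>j \<in> Obj J. tt\<^bsub>FObj D j\<^esub>), s5_bot = (\<lambda>j \<in> Obj J. ff\<^bsub>FObj D j\<^esub>),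
     s5_meet = (\<lambda>x y. \<lambda>j \<in> Obj J. x j \<curlywedge>\<^bsub>FObj D j\<^esub> y j),
     s5_join = (\<lambda>x y. \<lambda>j \<in> Obj J. x j \<curlyvee>\<^bsub>FObj D j\<^esub> y j),
     s5_neg = (\<lambda>x. \<lambda>j \<in> Obj J. neg\<^bsub>FObj D j\<^esub> (x j)),
     s5_box = (\<lambda>x. \<lambda>j \<in> Obj J. box\<^bsub>FObj D j\<^esub> (x j))\<rparr>"

text \<open>
  The equations hold componentwise, and matching families are closed under the operations because
  the arrows of the diagram are homomorphisms.
\<close>

lemma s5_algebra_limit_alg:
  assumes D: "is_functor J S5Alg_fin D"
  shows "s5_algebra (limit_alg J D)"
proof -
  let ?M = "matching J (\<lambda>j. carrier (FObj D j)) (FArr D)" and ?L = "limit_alg J D"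
  have A: "s5_algebra (FObj D j)" if "j \<in> Obj J" for j
    using functor_obj[OF D that] by simp
  have B: "boolean_alg (FObj D j)" if "j \<in> Obj J" for j
    using A[OF that] by (simp add: s5_algebra_def)
  have h: "FArr D i j u \<in> s5_hom (FObj D i) (FObj D j)"
    if "i \<in> Obj J" "j \<in> Obj J" "u \<in> Hom J i j" for i j u
    using functor_arr[OF D that] by simp
  have c: "x j \<in> carrier (FObj D j)" if "x \<in> ?M" "j \<in> Obj J" for x j
    using that by (auto simp: matching_def)
  have m: "FArr D i j u (x i) = x j" if "x \<in> ?M" "i \<in> Obj J" "j \<in> Obj J" "u \<in> Hom J i j" for x i j u
    using that by (auto simp: matching_def)
  have eqI: "x = y" if "x \<in> extensional (Obj J)" "y \<in> extensional (Obj J)"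
    "\<And>j. j \<in> Obj J \<Longrightarrow> x j = y j" for x y :: "'a \<Rightarrow> nat"
    using that by (rule extensionalityI)
  have ext: "x \<in> extensional (Obj J)" if "x \<in> ?M" for x using that by (auto simp: matching_def PiE_iff)
  note hop = s5_hom_ops[OF h]
  have [simp]: "carrier ?L = ?M" "s5_top ?L = (\<lambda>j \<in> Obj J. tt\<^bsub>FObj D j\<^esub>)"
    "s5_bot ?L = (\<lambda>j \<in> Obj J. ff\<^bsub>FObj D j\<^esub>)"
    "s5_meet ?L x y = (\<lambda>j \<in> Obj J. x j \<curlywedge>\<^bsub>FObj D j\<^esub> y j)"
    "s5_join ?L x y = (\<lambda>j \<in> Obj J. x j \<curlyvee>\<^bsub>FObj D j\<^esub> y j)"
    "s5_neg ?L x = (\<lambda>j \<in> Obj J. neg\<^bsub>FObj D j\<^esub> (x j))"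
    "s5_box ?L x = (\<lambda>j \<in> Obj J. box\<^bsub>FObj D j\<^esub> (x j))" for x y
    by (simp_all add: limit_alg_def)
  note bc = boolean_alg.top_closed[OF B] boolean_alg.bot_closed[OF B] boolean_alg.meet_closed[OF B]
    boolean_alg.join_closed[OF B] boolean_alg.neg_closed[OF B] s5_algebra.box_closed[OF A]
  note le = s5_algebra.box_refl[OF A, unfolded s5_le_def]
    s5_algebra.box_sym[OF A, unfolded s5_le_def s5_dia_def]
    s5_algebra.box_trans[OF A, unfolded s5_le_def]
  show ?thesis
  proof unfold_locales
    show "tt\<^bsub>?L\<^esub> \<in> carrier ?L" "ff\<^bsub>?L\<^esub> \<in> carrier ?L"
      by (simp_all add: matching_restrict bc hop)
  next
    fix x y assume "x \<in> carrier ?L" "y \<in> carrier ?L"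
    then have xy: "x \<in> ?M" "y \<in> ?M" by simp_all
    show "x \<curlywedge>\<^bsub>?L\<^esub> y \<in> carrier ?L" "x \<curlyvee>\<^bsub>?L\<^esub> y \<in> carrier ?L"
      using xy by (simp_all add: matching_restrict bc hop c m)
    show "x \<curlywedge>\<^bsub>?L\<^esub> y = y \<curlywedge>\<^bsub>?L\<^esub> x"
      using xy by (auto intro!: eqI boolean_alg.meet_comm[OF B] simp: c)
    show "x \<curlyvee>\<^bsub>?L\<^esub> y = y \<curlyvee>\<^bsub>?L\<^esub> x"
      using xy by (auto intro!: eqI boolean_alg.join_comm[OF B] simp: c)
    show "box\<^bsub>?L\<^esub> (x \<curlywedge>\<^bsub>?L\<^esub> y) = (box\<^bsub>?L\<^esub> x) \<curlywedge>\<^bsub>?L\<^esub> (box\<^bsub>?L\<^esub> y)"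
      using xy by (auto intro!: eqI simp: c s5_algebra.box_meet[OF A])
  next
    fix x assume "x \<in> carrier ?L"
    then have x: "x \<in> ?M" by simp
    show "neg\<^bsub>?L\<^esub> x \<in> carrier ?L" "box\<^bsub>?L\<^esub> x \<in> carrier ?L"
      using x by (simp_all add: matching_restrict bc hop c m)
    show "x \<curlywedge>\<^bsub>?L\<^esub> tt\<^bsub>?L\<^esub> = x" "x \<curlyvee>\<^bsub>?L\<^esub> ff\<^bsub>?L\<^esub> = x"
      using x ext[OF x] by (auto intro!: eqI simp: c boolean_alg.meet_top[OF B] boolean_alg.join_bot[OF B])
    show "x \<curlywedge>\<^bsub>?L\<^esub> neg\<^bsub>?L\<^esub> x = ff\<^bsub>?L\<^esub>"
      "x \<curlyvee>\<^bsub>?L\<^esub> neg\<^bsub>?L\<^esub> x = tt\<^bsub>?L\<^esub>"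
      using x by (auto intro!: eqI simp: c boolean_alg.meet_neg[OF B] boolean_alg.join_neg[OF B])
    show "box\<^bsub>?L\<^esub> x \<preceq>\<^bsub>?L\<^esub> x"
      "box\<^bsub>?L\<^esub> x \<preceq>\<^bsub>?L\<^esub> box\<^bsub>?L\<^esub> (box\<^bsub>?L\<^esub> x)"
      using x by (auto intro!: eqI simp: s5_le_def c le)
    show "x \<preceq>\<^bsub>?L\<^esub> box\<^bsub>?L\<^esub> (dia\<^bsub>?L\<^esub> x)"
      using x ext[OF x] by (auto intro!: eqI simp: s5_le_def s5_dia_def c le)
  next
    show "box\<^bsub>?L\<^esub> tt\<^bsub>?L\<^esub> = tt\<^bsub>?L\<^esub>"
      by (auto intro!: eqI simp: s5_algebra.box_top[OF A])
  next
    fix x y z assume "x \<in> carrier ?L" "y \<in> carrier ?L" "z \<in> carrier ?L"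
    then have xyz: "x \<in> ?M" "y \<in> ?M" "z \<in> ?M" by simp_all
    show "x \<curlywedge>\<^bsub>?L\<^esub> y \<curlywedge>\<^bsub>?L\<^esub> z = x \<curlywedge>\<^bsub>?L\<^esub> (y \<curlywedge>\<^bsub>?L\<^esub> z)"
      using xyz by (auto intro!: eqI simp: c boolean_alg.meet_assoc[OF B])
    show "x \<curlyvee>\<^bsub>?L\<^esub> y \<curlyvee>\<^bsub>?L\<^esub> z = x \<curlyvee>\<^bsub>?L\<^esub> (y \<curlyvee>\<^bsub>?L\<^esub> z)"
      using xyz by (auto intro!: eqI simp: c boolean_alg.join_assoc[OF B])
    show "x \<curlywedge>\<^bsub>?L\<^esub> (y \<curlyvee>\<^bsub>?L\<^esub> z) = x \<curlywedge>\<^bsub>?L\<^esub> y \<curlyvee>\<^bsub>?L\<^esub> (x \<curlywedge>\<^bsub>?L\<^esub> z)"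
      using xyz by (auto intro!: eqI simp: c boolean_alg.meet_join_distrib[OF B])
    show "x \<curlyvee>\<^bsub>?L\<^esub> (y \<curlywedge>\<^bsub>?L\<^esub> z) = (x \<curlyvee>\<^bsub>?L\<^esub> y) \<curlywedge>\<^bsub>?L\<^esub> (x \<curlyvee>\<^bsub>?L\<^esub> z)"
      using xyz by (auto intro!: eqI simp: c boolean_alg.join_meet_distrib[OF B])
  qed
qed

theorem has_finite_limits_S5Alg_fin: "has_finite_limits S5Alg_fin"
  unfolding has_finite_limits_def
proof (intro allI impI)
  fix J :: "(nat, nat) precategory" and D
  assume JD: "finite_category J \<and> is_functor J S5Alg_fin D"
  then have D: "is_functor J S5Alg_fin D" and fJ: "finite (Obj J)" by (auto simp: finite_category_def)
  let ?M = "matching J (\<lambda>j. carrier (FObj D j)) (FArr D)"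
  have cQ: "carrier (limit_alg J D) = ?M" by (simp add: limit_alg_def)
  have fin: "finite (carrier (FObj D j))" if "j \<in> Obj J" for j
    using functor_obj[OF D that] by simp
  have "finite (\<Pi>\<^sub>E j \<in> Obj J. carrier (FObj D j))" using fJ fin by (rule finite_PiE)
  then have "finite (carrier (limit_alg J D))"
    unfolding cQ by (rule rev_finite_subset) (auto simp: matching_def)
  then obtain L e d where L: "L \<in> Obj S5Alg_fin" and e: "e \<in> s5_hom (limit_alg J D) L"
    and d: "d \<in> s5_hom L (limit_alg J D)"
    and de: "\<And>x. x \<in> ?M \<Longrightarrow> d (e x) = x" and ed: "\<And>y. y \<in> carrier L \<Longrightarrow> e (d y) = y"
    using finite_s5_copy[OF s5_algebra_limit_alg[OF D]] unfolding cQ by blast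
  have ev: "(\<lambda>x \<in> ?M. x j) \<in> s5_hom (limit_alg J D) (FObj D j)" if "j \<in> Obj J" for j
  proof -
    interpret s5_algebra "limit_alg J D" by (rule s5_algebra_limit_alg[OF D])
    note cl = top_closed bot_closed meet_closed join_closed neg_closed box_closed
    show ?thesis
      unfolding s5_hom_def cQ
      using that cl[unfolded cQ] by (auto simp: matching_def PiE_iff) (auto simp: limit_alg_def)
  qed
  define p where "p j = compose (carrier L) (\<lambda>x \<in> ?M. x j) d" for j
  have dM: "d y \<in> ?M" if "y \<in> carrier L" for y using s5_hom_closed[OF d that] cQ by simp
  have pa: "p j y = d y j" if "y \<in> carrier L" for j y
    using dM[OF that] that by (simp add: p_def compose_def)
  have "cone J S5Alg_fin D L p"
    unfolding cone_def
  proof (intro conjI ballI)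
    show "L \<in> Obj S5Alg_fin" by (rule L)
    show "p j \<in> Hom S5Alg_fin L (FObj D j)" if "j \<in> Obj J" for j
      unfolding p_def using s5_hom_compose[OF _ d ev[OF that]] L by simp
    show "Comp S5Alg_fin L (FObj D i) (FObj D j) (FArr D i j u) (p i) = p j"
      if "i \<in> Obj J" "j \<in> Obj J" "u \<in> Hom J i j" for i j u
    proof -
      have "FArr D i j u (p i y) = p j y" if y: "y \<in> carrier L" for y
        using dM[OF y] \<open>i \<in> Obj J\<close> \<open>j \<in> Obj J\<close> \<open>u \<in> Hom J i j\<close>
        by (simp add: pa[OF y]) (simp add: matching_def)
      then show ?thesis by (auto simp: compose_def p_def)
    qed
  qed
  then have "limit_cone J S5Alg_fin D L p"
  proof (rule limit_cone_S5I[OF D])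
    fix x assume x: "x \<in> ?M"
    show "\<exists>!l. l \<in> carrier L \<and> (\<forall>j \<in> Obj J. p j l = x j)"
    proof (rule ex1I[of _ "e x"])
      have "e x \<in> carrier L" using s5_hom_closed[OF e] cQ x by simp
      then show "e x \<in> carrier L \<and> (\<forall>j \<in> Obj J. p j (e x) = x j)" by (simp add: pa de x)
      fix l assume l: "l \<in> carrier L \<and> (\<forall>j \<in> Obj J. p j l = x j)"
      have "d l = x"
        by (rule extensionalityI[of _ "Obj J"]) (use x l dM in \<open>auto simp: matching_def PiE_iff pa\<close>)
      then show "l = e x" using ed[of l] l by simp
    qed
  qed
  then show "\<exists>L p. limit_cone J S5Alg_fin D L p" by blast
qed

section \<open>Star-shaped diagrams\<close>

text \<open>
  Products, pullbacks and equalizers are all limits of star-shaped diagrams, with \<open>H i\<close> the set of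
  arrows from the leaf \<open>i\<close> to the centre \<open>0\<close>: there are no arrows, or one arrow from each of two
  leaves, or two arrows from one leaf.  Two arrows that are not identities never compose.
\<close>

definition star :: "nat \<Rightarrow> (nat \<Rightarrow> nat set) \<Rightarrow> (nat, nat) precategory" where
  "star N H = \<lparr>Obj = {..<N},
     Hom = (\<lambda>i j. if i = j then {0} else if j = 0 then H i else {}),
     Id = (\<lambda>_. 0), Comp = (\<lambda>i j k g f. if i = j then g else f)\<rparr>"

definition star_diagram ::
  "(nat \<Rightarrow> 'a s5_alg) \<Rightarrow> (nat \<Rightarrow> nat \<Rightarrow> 'a \<Rightarrow> 'a) \<Rightarrow> (nat, nat, 'a s5_alg, 'a \<Rightarrow> 'a) cfunctor" where
  "star_diagram D E = \<lparr>FObj = D,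
     FArr = (\<lambda>i j u. if i = j then (\<lambda>x \<in> carrier (D i). x) else E i u)\<rparr>"

lemma finite_category_star:
  assumes "\<And>i. finite (H i)"
  shows "finite_category (star N H)"
  using assms by (auto simp: finite_category_def category_def star_def split: if_splits)

lemma is_functor_star_diagram:
  assumes D: "\<And>i. i < N \<Longrightarrow> D i \<in> Obj S5Alg_fin"
    and E: "\<And>i u. \<lbrakk>0 < i; i < N; u \<in> H i\<rbrakk> \<Longrightarrow> E i u \<in> s5_hom (D i) (D 0)"
  shows "is_functor (star N H) S5Alg_fin (star_diagram D E)"
proof -
  have arr: "FArr (star_diagram D E) i j u \<in> s5_hom (D i) (D j)"
    if "i < N" "u \<in> Hom (star N H) i j" for i j u
    using that E D s5_hom_id by (auto simp: star_def star_diagram_def split: if_splits)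
  show ?thesis
    unfolding is_functor_def
  proof (intro conjI ballI)
    fix i j k u v
    assume i: "i \<in> Obj (star N H)" and j: "j \<in> Obj (star N H)"
      and u: "u \<in> Hom (star N H) i j" and v: "v \<in> Hom (star N H) j k"
    have iN: "i < N" "j < N" using i j by (simp_all add: star_def)
    consider "i = j" | "i \<noteq> j" "j = k" using u v by (auto simp: star_def split: if_splits)
    then show "FArr (star_diagram D E) i k (Comp (star N H) i j k v u) =
        Comp S5Alg_fin (FObj (star_diagram D E) i) (FObj (star_diagram D E) j)
          (FObj (star_diagram D E) k) (FArr (star_diagram D E) j k v) (FArr (star_diagram D E) i j u)"
    proof cases
      case 1
      then have "FArr (star_diagram D E) i k v \<in> extensional (carrier (D i))"
        using s5_hom_extensional[OF arr] iN v by blast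
      then show ?thesis
        using 1 by (simp add: star_def) (auto intro!: compose_eqI[symmetric] simp: star_diagram_def)
    next
      case 2
      have "FArr (star_diagram D E) i k u \<in> extensional (carrier (D i))"
        using s5_hom_extensional[OF arr] iN u 2 by blast
      moreover have "FArr (star_diagram D E) i k u x \<in> carrier (D k)" if "x \<in> carrier (D i)" for x
        using s5_hom_closed[OF arr that] iN u 2 by blast
      ultimately show ?thesis
        using 2 by (simp add: star_def) (auto intro!: compose_eqI[symmetric] simp: star_diagram_def)
    qed
  qed (use D arr in \<open>auto simp: star_def star_diagram_def\<close>)
qed

text \<open>
  Both the hypothesis \<open>lim\<close> and the conclusion express a limit by elements, so that later
  applications need no categorical diagrams.
\<close>

lemma lex_preserves_star_limit:
  fixes N :: nat and H :: "nat \<Rightarrow> nat set" and D :: "nat \<Rightarrow> nat s5_alg"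
  assumes F: "F \<in> Obj (Lex S5Alg_fin SET)"
    and D: "\<And>i. i < N \<Longrightarrow> D i \<in> Obj S5Alg_fin" and H: "\<And>i. finite (H i)"
    and E: "\<And>i u. \<lbrakk>0 < i; i < N; u \<in> H i\<rbrakk> \<Longrightarrow> E i u \<in> s5_hom (D i) (D 0)"
    and L: "L \<in> Obj S5Alg_fin" and p: "\<And>i. i < N \<Longrightarrow> p i \<in> s5_hom L (D i)"
    and comm: "\<And>i u l. \<lbrakk>0 < i; i < N; u \<in> H i; l \<in> carrier L\<rbrakk> \<Longrightarrow> E i u (p i l) = p 0 l"
    and lim: "\<And>d. \<lbrakk>\<And>i. i < N \<Longrightarrow> d i \<in> carrier (D i);
        \<And>i u. \<lbrakk>0 < i; i < N; u \<in> H i\<rbrakk> \<Longrightarrow> E i u (d i) = d 0\<rbrakk>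
      \<Longrightarrow> \<exists>!l. l \<in> carrier L \<and> (\<forall>i < N. p i l = d i)"
    and x: "\<And>i. i < N \<Longrightarrow> x i \<in> FObj F (D i)"
    and xm: "\<And>i u. \<lbrakk>0 < i; i < N; u \<in> H i\<rbrakk> \<Longrightarrow> FArr F (D i) (D 0) (E i u) (x i) = x 0"
  shows "\<exists>!z. z \<in> FObj F L \<and> (\<forall>i < N. FArr F L (D i) (p i) z = x i)"
proof -
  let ?J = "star N H" and ?D = "star_diagram D E"
  have fJ: "finite_category ?J" using H by (rule finite_category_star)
  have fD: "is_functor ?J S5Alg_fin ?D" using D E by (rule is_functor_star_diagram)
  have "cone ?J S5Alg_fin ?D L p"
    unfolding cone_def
  proof (intro conjI ballI)
    show "L \<in> Obj S5Alg_fin" by (rule L)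
    show "p j \<in> Hom S5Alg_fin L (FObj ?D j)" if "j \<in> Obj ?J" for j
      using p that by (simp add: star_def star_diagram_def)
    show "Comp S5Alg_fin L (FObj ?D i) (FObj ?D j) (FArr ?D i j u) (p i) = p j"
      if "i \<in> Obj ?J" "j \<in> Obj ?J" "u \<in> Hom ?J i j" for i j u
      unfolding S5Alg_fin_simps
    proof (rule compose_eqI)
      show "FArr ?D i j u (p i l) = p j l" if "l \<in> carrier L" for l
        using \<open>i \<in> Obj ?J\<close> \<open>j \<in> Obj ?J\<close> \<open>u \<in> Hom ?J i j\<close> that comm s5_hom_closed[OF p that]
        by (auto simp: star_def star_diagram_def split: if_splits)
      show "p j \<in> extensional (carrier L)"
        using s5_hom_extensional[OF p] \<open>j \<in> Obj ?J\<close> by (simp add: star_def)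
    qed
  qed
  then have "limit_cone ?J S5Alg_fin ?D L p"
  proof (rule limit_cone_S5I[OF fD])
    fix d assume d: "d \<in> matching ?J (\<lambda>j. carrier (FObj ?D j)) (FArr ?D)"
    have "\<exists>!l. l \<in> carrier L \<and> (\<forall>i < N. p i l = d i)"
    proof (rule lim)
      show "d i \<in> carrier (D i)" if "i < N" for i
        using d that by (auto simp: matching_def star_def star_diagram_def)
      show "E i u (d i) = d 0" if "0 < i" "i < N" "u \<in> H i" for i u
      proof -
        have "i \<in> Obj ?J" "0 \<in> Obj ?J" "u \<in> Hom ?J i 0" using that by (simp_all add: star_def)
        then have "FArr ?D i 0 u (d i) = d 0" using d unfolding matching_def by blast
        then show ?thesis using that by (simp add: star_diagram_def)
      qed
    qed
    then show "\<exists>!l. l \<in> carrier L \<and> (\<forall>j \<in> Obj ?J. p j l = d j)" by (simp add: star_def Ball_def)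
  qed
  moreover have Ff: "is_functor S5Alg_fin SET F" and pres: "preserves_finite_limits S5Alg_fin SET F"
    using F by (simp_all add: Lex_def)
  ultimately have "limit_cone ?J SET (comp_functor F ?D) (FObj F L) (\<lambda>j. FArr F L (FObj ?D j) (p j))"
    using fJ fD unfolding preserves_finite_limits_def by blast
  then have el: "\<forall>y \<in> matching ?J (FObj (comp_functor F ?D)) (FArr (comp_functor F ?D)).
      \<exists>!l. l \<in> FObj F L \<and> (\<forall>j \<in> Obj ?J. FArr F L (FObj ?D j) (p j) l = y j)"
    unfolding limit_cone_SET_iff[OF functor_comp_functor[OF fD Ff]] by blast
  have "restrict x (Obj ?J) \<in> matching ?J (FObj (comp_functor F ?D)) (FArr (comp_functor F ?D))"
    unfolding matching_restrict
  proof (intro conjI ballI)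
    show "x j \<in> FObj (comp_functor F ?D) j" if "j \<in> Obj ?J" for j
      using x that by (simp add: comp_functor_def star_def star_diagram_def)
    show "FArr (comp_functor F ?D) i j u (x i) = x j"
      if "i \<in> Obj ?J" "j \<in> Obj ?J" "u \<in> Hom ?J i j" for i j u
    proof (cases "i = j")
      case True
      have "FArr F (D i) (D i) (\<lambda>x \<in> carrier (D i). x) (x i) = x i"
        using functor_id[OF Ff D] x[of i] that(1) by (simp add: star_def)
      then show ?thesis using True by (simp add: comp_functor_def star_diagram_def)
    next
      case False
      then show ?thesis using that xm[of i u]
        by (auto simp: comp_functor_def star_def star_diagram_def split: if_splits)
    qed
  qed
  from el[rule_format, OF this] show ?thesis by (simp add: star_def star_diagram_def Ball_def)
qed

section \<open>Simple algebras\<close>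

\<comment> \<open>keeps the intervals \<open>{1..n}\<close> in this form\<close>
declare One_nat_def [simp del]

text \<open>
  The simple algebra with \<open>n\<close> atoms.  The objects of \<open>S5Alg_fin\<close> have natural numbers as elements, so
  \<open>Simple n\<close> is a copy of the powerset, and \<open>code n\<close>, \<open>decode n\<close> are inverse isomorphisms.
\<close>

definition one_cluster :: "nat \<Rightarrow> nat set s5_alg" where
  "one_cluster n = Cm {1..n} (\<lambda>_. ())"

definition Simple_copy :: "nat \<Rightarrow> nat s5_alg \<times> (nat set \<Rightarrow> nat) \<times> (nat \<Rightarrow> nat set)" where
  "Simple_copy n = (SOME (B, e, d). B \<in> Obj S5Alg_fin \<and> e \<in> s5_hom (one_cluster n) B \<and>
     d \<in> s5_hom B (one_cluster n) \<and> (\<forall>S. S \<subseteq> {1..n} \<longrightarrow> d (e S) = S) \<and>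
     (\<forall>y \<in> carrier B. e (d y) = y))"

definition Simple :: "nat \<Rightarrow> nat s5_alg" where "Simple n = fst (Simple_copy n)"
definition code :: "nat \<Rightarrow> nat set \<Rightarrow> nat" where "code n = fst (snd (Simple_copy n))"
definition decode :: "nat \<Rightarrow> nat \<Rightarrow> nat set" where "decode n = snd (snd (Simple_copy n))"

lemma s5_algebra_one_cluster: "s5_algebra (one_cluster n)"
  by (simp add: one_cluster_def s5_algebra_Cm)

lemma Simple_props:
  "Simple n \<in> Obj S5Alg_fin \<and> code n \<in> s5_hom (one_cluster n) (Simple n) \<and>
   decode n \<in> s5_hom (Simple n) (one_cluster n) \<and> (\<forall>S. S \<subseteq> {1..n} \<longrightarrow> decode n (code n S) = S) \<and>
   (\<forall>y \<in> carrier (Simple n). code n (decode n y) = y)"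
proof -
  have "finite (carrier (one_cluster n))" by (simp add: one_cluster_def)
  then obtain B e d where "B \<in> Obj S5Alg_fin" "e \<in> s5_hom (one_cluster n) B"
     "d \<in> s5_hom B (one_cluster n)" "\<And>S. S \<in> carrier (one_cluster n) \<Longrightarrow> d (e S) = S"
     "\<And>y. y \<in> carrier B \<Longrightarrow> e (d y) = y"
    using finite_s5_copy[OF s5_algebra_one_cluster] by metis
  then have "\<exists>t. case t of (B, e, d) \<Rightarrow> B \<in> Obj S5Alg_fin \<and> e \<in> s5_hom (one_cluster n) B \<and>
     d \<in> s5_hom B (one_cluster n) \<and> (\<forall>S. S \<subseteq> {1..n} \<longrightarrow> d (e S) = S) \<and>
     (\<forall>y \<in> carrier B. e (d y) = y)"
    by (intro exI[of _ "(B, e, d)"]) (simp add: one_cluster_def)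
  from someI_ex[OF this, folded Simple_copy_def] show ?thesis
    unfolding Simple_def code_def decode_def case_prod_beta .
qed

lemma Simple_Obj: "Simple n \<in> Obj S5Alg_fin"
  and Simple_alg: "s5_algebra (Simple n)"
  and code_hom: "code n \<in> s5_hom (one_cluster n) (Simple n)"
  and decode_hom: "decode n \<in> s5_hom (Simple n) (one_cluster n)"
  and decode_code: "S \<subseteq> {1..n} \<Longrightarrow> decode n (code n S) = S"
  and code_decode: "y \<in> carrier (Simple n) \<Longrightarrow> code n (decode n y) = y"
  using Simple_props[of n] by auto

lemma decode_code_Collect: "decode n (code n {i \<in> {1..n}. P i}) = {i \<in> {1..n}. P i}"
  by (rule decode_code) blast

lemma code_closed: "S \<subseteq> {1..n} \<Longrightarrow> code n S \<in> carrier (Simple n)"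
  using s5_hom_closed[OF code_hom, of S n] by (simp add: one_cluster_def)

lemma code_Collect_closed: "code n {i \<in> {1..n}. P i} \<in> carrier (Simple n)"
  by (rule code_closed) blast

lemma decode_sub: "y \<in> carrier (Simple n) \<Longrightarrow> decode n y \<subseteq> {1..n}"
  using s5_hom_closed[OF decode_hom, of y n] by (simp add: one_cluster_def)

definition dual :: "nat \<Rightarrow> nat \<Rightarrow> (nat \<Rightarrow> nat) \<Rightarrow> nat \<Rightarrow> nat" where
  "dual m n f = (\<lambda>a \<in> carrier (Simple n). code m {i \<in> {1..m}. f i \<in> decode n a})"

lemma p_morphism_one_cluster:
  "p_morphism {1..m::nat} (\<lambda>_. ()) X k t \<longleftrightarrow>
    t ` {1..m} \<subseteq> X \<and> (\<forall>z \<in> {1..m}. t ` {1..m} = {x \<in> X. k x = k (t z)})"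
  by (simp add: p_morphism_def Collect_mem_eq del: atLeastAtMost_iff)

text \<open>The dual maps, the projections onto simple factors and, later, the elements of a model arise in this way.\<close>

lemma coded_preimage_hom:
  assumes A: "s5_algebra A" and r: "r \<in> s5_hom A (Cm X k)" and t: "p_morphism {1..m} (\<lambda>_. ()) X k t"
  shows "(\<lambda>a \<in> carrier A. code m {i \<in> {1..m}. t i \<in> r a}) \<in> s5_hom A (Simple m)"
proof -
  have "compose (carrier A) (preimage_hom X {1..m} t) r \<in> s5_hom A (one_cluster m)"
    unfolding one_cluster_def by (rule s5_hom_compose[OF A r preimage_hom_in_s5_hom[OF t]])
  then have "compose (carrier A) (code m) (compose (carrier A) (preimage_hom X {1..m} t) r) \<in> s5_hom A (Simple m)"
    by (rule s5_hom_compose[OF A _ code_hom])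
  moreover have "compose (carrier A) (code m) (compose (carrier A) (preimage_hom X {1..m} t) r) =
      (\<lambda>a \<in> carrier A. code m {i \<in> {1..m}. t i \<in> r a})"
    using s5_hom_closed[OF r] by (intro compose_eqI) (auto simp: compose_def preimage_hom_apply)
  ultimately show ?thesis by simp
qed

lemma Surj_range: "\<lbrakk>f \<in> Surj m n; i \<in> {1..m}\<rbrakk> \<Longrightarrow> f i \<in> {1..n}"
  by (auto simp: Surj_def)

lemma Surj_image: "f \<in> Surj m n \<Longrightarrow> f ` {1..m} = {1..n}"
  by (simp add: Surj_def)

lemma Surj_ext: "f \<in> Surj m n \<Longrightarrow> f \<in> extensional {1..m}"
  by (auto simp: Surj_def PiE_iff)

lemma SurjI: "\<lbrakk>f \<in> extensional {1..m}; f ` {1..m} = {1..n}\<rbrakk> \<Longrightarrow> f \<in> Surj m n"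
  by (auto simp: Surj_def PiE_iff)

lemma Surj_id: "(\<lambda>i \<in> {1..n}. i) \<in> Surj n n"
  by (auto intro: SurjI)

lemma Surj_compose: "\<lbrakk>f \<in> Surj r m; g \<in> Surj m n\<rbrakk> \<Longrightarrow> compose {1..r} g f \<in> Surj r n"
proof (rule SurjI)
  assume f: "f \<in> Surj r m" and g: "g \<in> Surj m n"
  have "compose {1..r} g f ` {1..r} = g ` f ` {1..r}" by (auto simp: compose_def)
  then show "compose {1..r} g f ` {1..r} = {1..n}" using f g by (simp add: Surj_image)
qed (simp add: compose_def)

lemma Surj_pos: "\<lbrakk>f \<in> Surj m n; 1 \<le> m\<rbrakk> \<Longrightarrow> 1 \<le> n"
  using Surj_image[of f m n] by (cases n) auto

lemma dual_hom:
  assumes f: "f \<in> Surj m n"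
  shows "dual m n f \<in> s5_hom (Simple n) (Simple m)"
  unfolding dual_def
proof (rule coded_preimage_hom[OF Simple_alg decode_hom[unfolded one_cluster_def]])
  show "p_morphism {1..m} (\<lambda>_. ()) {1..n} (\<lambda>_. ()) f"
    using Surj_image[OF f] by (simp add: p_morphism_def Collect_mem_eq del: atLeastAtMost_iff)
qed

lemma dual_apply: "a \<in> carrier (Simple n) \<Longrightarrow> dual m n f a = code m {i \<in> {1..m}. f i \<in> decode n a}"
  by (simp add: dual_def)

lemma decode_dual:
  "a \<in> carrier (Simple n) \<Longrightarrow> decode m (dual m n f a) = {i \<in> {1..m}. f i \<in> decode n a}"
  by (simp only: dual_apply decode_code_Collect)

lemma dual_id: "dual n n (\<lambda>i \<in> {1..n}. i) = (\<lambda>a \<in> carrier (Simple n). a)"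
proof -
  have "code n {i \<in> {1..n}. (\<lambda>i \<in> {1..n}. i) i \<in> decode n a} = a" if a: "a \<in> carrier (Simple n)" for a
  proof -
    have "{i \<in> {1..n}. (\<lambda>i \<in> {1..n}. i) i \<in> decode n a} = decode n a" using decode_sub[OF a] by auto
    then show ?thesis using code_decode[OF a] by simp
  qed
  then show ?thesis unfolding dual_def by (rule restrict_ext)
qed

lemma dual_compose:
  assumes f: "f \<in> Surj r m" and g: "g \<in> Surj m n"
  shows "compose (carrier (Simple n)) (dual r m f) (dual m n g) = dual r n (compose {1..r} g f)"
proof (rule compose_eqI)
  fix a assume a: "a \<in> carrier (Simple n)"
  have "{i \<in> {1..r}. f i \<in> {j \<in> {1..m}. g j \<in> decode n a}} =
      {i \<in> {1..r}. compose {1..r} g f i \<in> decode n a}"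
    using Surj_range[OF f] by (auto simp: compose_def)
  then show "dual r m f (dual m n g a) = dual r n (compose {1..r} g f) a"
    unfolding dual_apply[OF s5_hom_closed[OF dual_hom[OF g] a]] decode_dual[OF a]
    unfolding dual_apply[OF a] by (rule arg_cong)
qed (simp add: dual_def)

text \<open>
  If \<open>A\<close> is the complex algebra of \<open>(X, k)\<close>, then its simple factors belong to the fibres of \<open>k\<close>.  A
  homomorphism from \<open>A\<close> to \<open>Simple m\<close> is dual to a map from a single cluster to \<open>X\<close>; the image of this
  map is one fibre, so the homomorphism factors through one projection.
\<close>

lemma simple_decomposition:
  assumes "A \<in> Obj S5Alg_fin"
  obtains N n \<pi> where "\<And>j::nat. j < N \<Longrightarrow> 1 \<le> n j" "\<And>j. j < N \<Longrightarrow> \<pi> j \<in> s5_hom A (Simple (n j))"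
    "\<And>x. \<forall>j < N. x j \<in> carrier (Simple (n j))
      \<Longrightarrow> \<exists>!a. a \<in> carrier A \<and> (\<forall>j < N. \<pi> j a = x j)"
    "\<And>m g. \<lbrakk>1 \<le> m; g \<in> s5_hom A (Simple m)\<rbrakk>
      \<Longrightarrow> \<exists>j < N. \<exists>s \<in> Surj m (n j). g = compose (carrier A) (dual m (n j) s) (\<pi> j)"
proof -
  have A: "s5_algebra A" "finite (carrier A)" using assms by simp_all
  obtain X :: "nat set" and k :: "nat \<Rightarrow> nat" and r d where fX: "finite X"
    and r: "r \<in> s5_hom A (Cm X k)" and d: "d \<in> s5_hom (Cm X k) A"
    and dr: "\<And>a. a \<in> carrier A \<Longrightarrow> d (r a) = a" and rd: "\<And>S. S \<subseteq> X \<Longrightarrow> r (d S) = S"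
    by (rule finite_s5_algebra_is_complex[OF A], rule that)
  have rX: "r a \<subseteq> X" if "a \<in> carrier A" for a using s5_hom_closed[OF r that] by simp
  have dA: "d S \<in> carrier A" if "S \<subseteq> X" for S using s5_hom_closed[OF d] that by simp
  define N where "N = card (k ` X)"
  obtain c where c: "bij_betw c {0..<N} (k ` X)"
    using ex_bij_betw_nat_finite[of "k ` X"] fX unfolding N_def by blast
  define fib where "fib j = {x \<in> X. k x = c j}" for j
  define n where "n j = card (fib j)" for j
  have finfib: "finite (fib j)" for j using fX by (simp add: fib_def)
  have "\<exists>e. bij_betw e {1..n j} (fib j)" for j
    unfolding n_def by (rule ex_bij_betw_nat_finite_1[OF finfib])
  then obtain e where e: "\<And>j. bij_betw (e j) {1..n j} (fib j)" by metis
  have eim: "e j ` {1..n j} = fib j" and einj: "inj_on (e j) {1..n j}" for j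
    using e[of j] by (simp_all add: bij_betw_def)
  have eX: "e j i \<in> X" "k (e j i) = c j" if "i \<in> {1..n j}" for i j
    using eim[of j] that unfolding fib_def by blast+
  have cov: "\<exists>j < N. c j = k x" if "x \<in> X" for x
    using c that unfolding bij_betw_def by (metis atLeastLessThan_iff image_iff)
  have cinj: "j = j'" if "j < N" "j' < N" "c j = c j'" for j j'
    using c that unfolding bij_betw_def inj_on_def by (metis atLeastLessThan_iff zero_le)
  define \<pi> where "\<pi> j = (\<lambda>a \<in> carrier A. code (n j) {i \<in> {1..n j}. e j i \<in> r a})" for j
  have \<pi>d: "decode (n j) (\<pi> j a) = {i \<in> {1..n j}. e j i \<in> r a}" if "a \<in> carrier A" for j a
    using that by (simp only: \<pi>_def restrict_apply if_True decode_code_Collect)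
  show thesis
  proof (rule that)
    fix j assume j: "j < N"
    then have "c j \<in> k ` X" using c by (auto simp: bij_betw_def)
    then obtain y where "y \<in> X" "c j = k y" by (rule imageE)
    then have "y \<in> fib j" by (simp add: fib_def)
    then have "fib j \<noteq> {}" by (metis empty_iff)
    then show "1 \<le> n j" using finfib[of j] by (simp add: n_def Suc_le_eq card_gt_0_iff One_nat_def)
    show "\<pi> j \<in> s5_hom A (Simple (n j))"
      unfolding \<pi>_def
    proof (rule coded_preimage_hom[OF A(1) r])
      show "p_morphism {1..n j} (\<lambda>_. ()) X k (e j)"
        unfolding p_morphism_one_cluster
      proof (intro conjI ballI)
        show "e j ` {1..n j} \<subseteq> X" using eX(1) by blast
        show "e j ` {1..n j} = {x \<in> X. k x = k (e j i)}" if "i \<in> {1..n j}" for i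
          using eim[of j] eX(2)[OF that] by (simp only: fib_def)
      qed
    qed
  next
    fix x assume "\<forall>j < N. x j \<in> carrier (Simple (n j))"
    then have x: "x j \<in> carrier (Simple (n j))" if "j < N" for j using that by blast
    define S where "S = {y. \<exists>j < N. \<exists>i \<in> decode (n j) (x j). y = e j i}"
    have SX: "S \<subseteq> X" using eX decode_sub[OF x] unfolding S_def by blast
    have S: "{i \<in> {1..n j}. e j i \<in> S} = decode (n j) (x j)" if j: "j < N" for j
    proof (intro subset_antisym subsetI)
      fix i assume "i \<in> {i \<in> {1..n j}. e j i \<in> S}"
      then obtain j' i' where i: "i \<in> {1..n j}" and i': "j' < N" "i' \<in> decode (n j') (x j')" "e j i = e j' i'"
        unfolding S_def by blast
      have i'n: "i' \<in> {1..n j'}" using decode_sub[OF x[OF i'(1)]] i'(2) by blast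
      have "j = j'" using cinj[OF j i'(1)] eX(2)[OF i] eX(2)[OF i'n] i'(3) by simp
      moreover from this have "i = i'" using inj_onD[OF einj i'(3)[folded \<open>j = j'\<close>] i] i'n by simp
      ultimately show "i \<in> decode (n j) (x j)" using i'(2) by simp
    next
      fix i assume "i \<in> decode (n j) (x j)"
      then show "i \<in> {i \<in> {1..n j}. e j i \<in> S}" using decode_sub[OF x[OF j]] j unfolding S_def by blast
    qed
    show "\<exists>!a. a \<in> carrier A \<and> (\<forall>j < N. \<pi> j a = x j)"
    proof (rule ex1I[of _ "d S"])
      have "\<pi> j (d S) = x j" if "j < N" for j
        using dA[OF SX] S[OF that] by (simp add: \<pi>_def rd[OF SX] code_decode[OF x[OF that]])
      then show "d S \<in> carrier A \<and> (\<forall>j < N. \<pi> j (d S) = x j)" using dA[OF SX] by blast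
      fix a assume a: "a \<in> carrier A \<and> (\<forall>j < N. \<pi> j a = x j)"
      have "y \<in> r a \<longleftrightarrow> y \<in> S" if y: "y \<in> X" for y
      proof -
        obtain j where j: "j < N" "c j = k y" using cov[OF y] by blast
        then have "y \<in> fib j" using y by (simp add: fib_def)
        then obtain i where i: "i \<in> {1..n j}" "y = e j i" using eim[of j] by blast
        have "decode (n j) (x j) = {i \<in> {1..n j}. e j i \<in> r a}" using a j \<pi>d[of a j] by simp
        then have "{i \<in> {1..n j}. e j i \<in> S} = {i \<in> {1..n j}. e j i \<in> r a}" using S[OF j(1)] by simp
        then show ?thesis using i by blast
      qed
      then have "r a = S" using rX a SX by blast
      then show "a = d S" using dr a by metis
    qed
  next
    fix m g assume m: "1 \<le> m" and g: "g \<in> s5_hom A (Simple m)"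
    define g' where "g' = compose (Pow X) (decode m) (compose (Pow X) g d)"
    have "compose (Pow X) g d \<in> s5_hom (Cm X k) (Simple m)"
      using s5_hom_compose[OF s5_algebra_Cm d g] by simp
    then have g': "g' \<in> s5_hom (Cm X k) (Cm {1..m} (\<lambda>_. ()))"
      unfolding g'_def using s5_hom_compose[OF s5_algebra_Cm _ decode_hom[unfolded one_cluster_def]] by fastforce
    then have "g' X = {1..m}" by (auto simp: s5_hom_def)
    then obtain t where t: "p_morphism {1..m} (\<lambda>_. ()) X k t" and gt: "g' = preimage_hom X {1..m} t"
      using finite_support_hom_is_preimage[OF g' fX] by blast
    have m1: "1 \<in> {1..m}" using m by simp
    have tX: "t ` {1..m} \<subseteq> X" and tf: "t ` {1..m} = {x \<in> X. k x = k (t 1)}"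
      using t m1 unfolding p_morphism_one_cluster by blast+
    obtain j where j: "j < N" "c j = k (t 1)" using cov[of "t 1"] tX m1 by blast
    have tj: "t ` {1..m} = fib j" using tf j by (simp add: fib_def)
    define s where "s = (\<lambda>i \<in> {1..m}. inv_into {1..n j} (e j) (t i))"
    have es: "e j (s i) = t i" "s i \<in> {1..n j}" if "i \<in> {1..m}" for i
    proof -
      have "t i \<in> e j ` {1..n j}" using tj eim[of j] that by blast
      moreover have "s i = inv_into {1..n j} (e j) (t i)" using that by (simp add: s_def)
      ultimately show "e j (s i) = t i" "s i \<in> {1..n j}"
        using f_inv_into_f[of "t i"] inv_into_into[of "t i"] by metis+
    qed
    have "s ` {1..m} = {1..n j}"
    proof (intro subset_antisym subsetI)
      show "i \<in> {1..n j}" if "i \<in> s ` {1..m}" for i using that es by blast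
      fix i assume i: "i \<in> {1..n j}"
      then have "e j i \<in> t ` {1..m}" using tj eim[of j] by blast
      then obtain i' where i': "i' \<in> {1..m}" "e j i = t i'" by blast
      then have "i = s i'" using inj_onD[OF einj, of j i "s i'"] es[OF i'(1)] i by simp
      then show "i \<in> s ` {1..m}" using i' by blast
    qed
    then have s: "s \<in> Surj m (n j)" by (intro SurjI) (simp_all add: s_def)
    have "compose (carrier A) (dual m (n j) s) (\<pi> j) = g"
    proof (rule compose_eqI)
      fix a assume a: "a \<in> carrier A"
      have ga: "g a \<in> carrier (Simple m)" by (rule s5_hom_closed[OF g a])
      have "decode m (g a) = g' (r a)" using rX[OF a] a by (simp add: g'_def compose_def dr)
      also have "\<dots> = {i \<in> {1..m}. t i \<in> r a}" using rX[OF a] by (simp add: gt preimage_hom_apply)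
      finally have "g a = code m {i \<in> {1..m}. t i \<in> r a}" using code_decode[OF ga] by simp
      moreover have "{i \<in> {1..m}. s i \<in> {i \<in> {1..n j}. e j i \<in> r a}} = {i \<in> {1..m}. t i \<in> r a}"
        using es by auto
      moreover have "\<pi> j a \<in> carrier (Simple (n j))" 
        using a by (simp only: \<pi>_def restrict_apply if_True code_Collect_closed)
      ultimately show "dual m (n j) s (\<pi> j a) = g a" by (simp only: dual_apply \<pi>d[OF a])
    qed (rule s5_hom_extensional[OF g])
    then show "\<exists>j < N. \<exists>s \<in> Surj m (n j). g = compose (carrier A) (dual m (n j) s) (\<pi> j)"
      using j(1) s by metis
  qed
qed

section \<open>Restriction to simple algebras\<close>

definition restr :: "(nat s5_alg, nat \<Rightarrow> nat, 'u set, 'u \<Rightarrow> 'u) cfunctor \<Rightarrow> 'u struct" where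
  "restr F = \<lparr>Sort = (\<lambda>n. FObj F (Simple n)),
     Op = (\<lambda>m n f. FArr F (Simple n) (Simple m) (dual m n f))\<rparr>"

definition restriction ::
  "((nat s5_alg, nat \<Rightarrow> nat, 'u set, 'u \<Rightarrow> 'u) cfunctor, nat s5_alg \<Rightarrow> 'u \<Rightarrow> 'u,
    'u struct, nat \<Rightarrow> 'u \<Rightarrow> 'u) cfunctor" where
  "restriction = \<lparr>FObj = restr, FArr = (\<lambda>F G \<eta>. \<lambda>n \<in> {1..}. \<eta> (Simple n))\<rparr>"

lemma restr_simps [simp]:
  "Sort (restr F) n = FObj F (Simple n)"
  "Op (restr F) m n f = FArr F (Simple n) (Simple m) (dual m n f)"
  by (simp_all add: restr_def)

context
  fixes F :: "(nat s5_alg, nat \<Rightarrow> nat, 'u set, 'u \<Rightarrow> 'u) cfunctor"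
  assumes F: "is_functor S5Alg_fin SET F"
begin

lemma apply_closed:
  assumes "A \<in> Obj S5Alg_fin" "B \<in> Obj S5Alg_fin" "g \<in> s5_hom A B" "x \<in> FObj F A"
  shows "FArr F A B g x \<in> FObj F B"
  using functor_arr[OF F assms(1,2)] assms(3,4) by auto

lemma apply_id:
  assumes "A \<in> Obj S5Alg_fin" "x \<in> FObj F A"
  shows "FArr F A A (\<lambda>a \<in> carrier A. a) x = x"
  using functor_id[OF F assms(1)] assms(2) by simp

lemma apply_compose:
  assumes "A \<in> Obj S5Alg_fin" "B \<in> Obj S5Alg_fin" "C \<in> Obj S5Alg_fin"
    "f \<in> s5_hom A B" "g \<in> s5_hom B C" "x \<in> FObj F A"
  shows "FArr F A C (compose (carrier A) g f) x = FArr F B C g (FArr F A B f x)"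
  using functor_comp[OF F assms(1-3), of f g] assms(4-6) by (simp add: compose_def)

lemma restr_closed:
  "\<lbrakk>f \<in> Surj m n; x \<in> Sort (restr F) n\<rbrakk> \<Longrightarrow> Op (restr F) m n f x \<in> Sort (restr F) m"
  using apply_closed[OF Simple_Obj Simple_Obj dual_hom] by simp

lemma restr_id: "x \<in> Sort (restr F) n \<Longrightarrow> Op (restr F) n n (\<lambda>i \<in> {1..n}. i) x = x"
  using apply_id[OF Simple_Obj, of x n] by (simp only: restr_simps dual_id)

lemma restr_compose:
  assumes "f \<in> Surj r m" "g \<in> Surj m n" "x \<in> Sort (restr F) n"
  shows "Op (restr F) r m f (Op (restr F) m n g x) = Op (restr F) r n (compose {1..r} g f) x"
  using apply_compose[OF Simple_Obj Simple_Obj Simple_Obj dual_hom[OF assms(2)] dual_hom[OF assms(1)]]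
    assms(3) by (simp only: restr_simps dual_compose[OF assms(1,2)])

end

lemma L_structure_restr: "is_functor S5Alg_fin SET F \<Longrightarrow> L_structure (restr F)"
  by (simp add: L_structure_def apply_closed[OF _ Simple_Obj Simple_Obj dual_hom])

lemma axiom1_restr: "is_functor S5Alg_fin SET F \<Longrightarrow> axiom1 (restr F)"
  unfolding axiom1_def by (intro conjI allI impI ballI) (erule (1) restr_id, rule restr_compose)

subsection \<open>Subalgebras of simple algebras\<close>

lemma dual_inj:
  assumes g: "g \<in> Surj n k" and l: "l \<in> carrier (Simple k)" "l' \<in> carrier (Simple k)"
    and eq: "dual n k g l = dual n k g l'"
  shows "l = l'"
proof -
  have "{i \<in> {1..n}. g i \<in> decode k l} = {i \<in> {1..n}. g i \<in> decode k l'}"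
    using decode_dual[OF l(1), of n g] decode_dual[OF l(2), of n g] eq by simp
  moreover have "decode k l \<subseteq> g ` {1..n}" "decode k l' \<subseteq> g ` {1..n}"
    using decode_sub l Surj_image[OF g] by simp_all
  ultimately have "decode k l = decode k l'" by blast
  then show ?thesis using code_decode l by metis
qed

text \<open>
  A field of subsets of a finite set consists of the unions of its atoms \<open>cls i\<close>; the surjection \<open>g\<close>
  collapses every atom to a point.  Hence subalgebras of a simple algebra are simple.
\<close>

lemma field_of_sets_is_preimage:
  fixes n :: nat
  assumes sub: "\<A> \<subseteq> Pow {1..n}" and top: "{1..n} \<in> \<A>"
    and int: "\<And>a b. \<lbrakk>a \<in> \<A>; b \<in> \<A>\<rbrakk> \<Longrightarrow> a \<inter> b \<in> \<A>"
    and compl: "\<And>a. a \<in> \<A> \<Longrightarrow> {1..n} - a \<in> \<A>"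
  obtains k g where "g \<in> Surj n k" "\<And>a. a \<in> \<A> \<longleftrightarrow> (\<exists>S \<subseteq> {1..k}. a = {i \<in> {1..n}. g i \<in> S})"
proof -
  have finA: "finite \<A>" using sub by (rule finite_subset) simp
  have Inter: "{i \<in> {1..n}. \<forall>a \<in> \<B>. i \<in> a} \<in> \<A>" if "finite \<B>" "\<B> \<subseteq> \<A>" for \<B>
    using that
  proof (induction \<B> rule: finite_induct)
    case empty
    have "{i \<in> {1..n}. \<forall>a \<in> {}. i \<in> a} = {1..n}" by auto
    then show ?case using top by metis
  next
    case (insert b \<B>)
    then have "b \<inter> {i \<in> {1..n}. \<forall>a \<in> \<B>. i \<in> a} \<in> \<A>" using int by auto
    moreover have "{i \<in> {1..n}. \<forall>a \<in> insert b \<B>. i \<in> a} = b \<inter> {i \<in> {1..n}. \<forall>a \<in> \<B>. i \<in> a}" by auto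
    ultimately show ?case by metis
  qed
  define cls where "cls i = {j \<in> {1..n}. \<forall>a \<in> {a \<in> \<A>. i \<in> a}. j \<in> a}" for i
  have clsA: "cls i \<in> \<A>" for i
    unfolding cls_def by (rule Inter) (use finA in auto)
  have cls_self: "i \<in> cls i" if "i \<in> {1..n}" for i using that by (simp add: cls_def)
  have cls_le: "cls i \<subseteq> a" if "a \<in> \<A>" "i \<in> a" for i a using that by (auto simp: cls_def)
  have cls_eq: "cls j = cls i" if i: "i \<in> {1..n}" and j: "j \<in> cls i" for i j
  proof
    show "cls j \<subseteq> cls i" by (rule cls_le[OF clsA j])
    have "i \<in> cls j"
    proof (rule ccontr)
      assume "i \<notin> cls j"
      then have "cls i \<subseteq> {1..n} - cls j" using i by (intro cls_le compl clsA) simp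
      moreover have "j \<in> {1..n}" using j clsA[of i] sub by blast
      ultimately show False using cls_self j by blast
    qed
    then show "cls i \<subseteq> cls j" by (rule cls_le[OF clsA])
  qed
  define k where "k = card (cls ` {1..n})"
  have "\<exists>b. bij_betw b (cls ` {1..n}) {1..k}"
    by (rule finite_same_card_bij) (simp_all add: k_def)
  then obtain b where b: "bij_betw b (cls ` {1..n}) {1..k}" by blast
  define g where "g = (\<lambda>i \<in> {1..n}. b (cls i))"
  have "g ` {1..n} = b ` cls ` {1..n}" unfolding g_def by (auto simp: image_iff)
  then have g: "g \<in> Surj n k"
    using b by (intro SurjI) (simp_all only: g_def restrict_extensional bij_betw_def)
  have g_eq: "cls i = cls j" if "i \<in> {1..n}" "j \<in> {1..n}" "g i = g j" for i j
  proof -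
    have "b (cls i) = b (cls j)" using that by (simp add: g_def)
    then show ?thesis using b that unfolding bij_betw_def inj_on_def by blast
  qed
  have "a \<in> \<A> \<longleftrightarrow> (\<exists>S \<subseteq> {1..k}. a = {i \<in> {1..n}. g i \<in> S})" for a
  proof
    assume a: "a \<in> \<A>"
    have "i \<in> a" if "i \<in> {1..n}" "j \<in> a" "g i = g j" for i j
    proof -
      have "j \<in> {1..n}" using a sub that(2) by blast
      then have "cls i = cls j" using g_eq that by blast
      then show ?thesis using cls_self[OF that(1)] cls_le[OF a that(2)] by blast
    qed
    moreover have "g ` a \<subseteq> {1..k}" using Surj_image[OF g] a sub by blast
    moreover have "a \<subseteq> {1..n}" using a sub by blast
    ultimately show "\<exists>S \<subseteq> {1..k}. a = {i \<in> {1..n}. g i \<in> S}"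
      by (intro exI[of _ "g ` a"]) blast
  next
    assume "\<exists>S \<subseteq> {1..k}. a = {i \<in> {1..n}. g i \<in> S}"
    then obtain S where S: "a = {i \<in> {1..n}. g i \<in> S}" by blast
    \<comment> \<open>\<open>a\<close> is the union of its classes, hence the complement of an intersection\<close>
    let ?\<B> = "(\<lambda>i. {1..n} - cls i) ` a"
    have "{i \<in> {1..n}. \<forall>c \<in> ?\<B>. i \<in> c} \<in> \<A>"
      by (rule Inter) (use S clsA compl in auto)
    then have "{1..n} - {i \<in> {1..n}. \<forall>c \<in> ?\<B>. i \<in> c} \<in> \<A>" by (rule compl)
    moreover have "{1..n} - {i \<in> {1..n}. \<forall>c \<in> ?\<B>. i \<in> c} = a"
    proof (intro subset_antisym subsetI)
      fix i assume "i \<in> {1..n} - {i \<in> {1..n}. \<forall>c \<in> ?\<B>. i \<in> c}"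
      then obtain j where j: "i \<in> {1..n}" "j \<in> a" "i \<in> cls j" by blast
      then have "j \<in> {1..n}" "g j \<in> S" using S by auto
      then have "g i = g j" using cls_eq[of j i] j by (simp add: g_def)
      then show "i \<in> a" using S j \<open>g j \<in> S\<close> by simp
    next
      fix i assume ia: "i \<in> a"
      then have i: "i \<in> {1..n}" unfolding S by blast
      moreover have "{1..n} - cls i \<in> ?\<B>" using ia by blast
      moreover have "i \<notin> {1..n} - cls i" using cls_self[OF i] by blast
      ultimately show "i \<in> {1..n} - {i \<in> {1..n}. \<forall>c \<in> ?\<B>. i \<in> c}" by blast
    qed
    ultimately show "a \<in> \<A>" by metis
  qed
  with g show thesis by (rule that)
qed

lemma Surj_le: "f \<in> Surj m n \<Longrightarrow> n \<le> m"
  using card_image_le[of "{1..m}" f] Surj_image[of f m n] by simp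

lemma Surj_inj: "f \<in> Surj n n \<Longrightarrow> inj_on f {1..n}"
  using Surj_image[of f n n] by (intro eq_card_imp_inj_on) simp_all

lemma Surj_factor:
  assumes f: "f \<in> Surj n m" and g: "g \<in> Surj n k"
    and resp: "\<And>i j. \<lbrakk>i \<in> {1..n}; j \<in> {1..n}; f i = f j\<rbrakk> \<Longrightarrow> g i = g j"
  obtains h where "h \<in> Surj m k" "compose {1..n} h f = g"
proof -
  define h where "h = (\<lambda>y \<in> {1..m}. g (inv_into {1..n} f y))"
  have hf: "h (f i) = g i" if i: "i \<in> {1..n}" for i
  proof -
    have "f i \<in> f ` {1..n}" using i by blast
    then have "inv_into {1..n} f (f i) \<in> {1..n}" "f (inv_into {1..n} f (f i)) = f i"
      by (rule inv_into_into, rule f_inv_into_f)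
    then show ?thesis using resp[of "inv_into {1..n} f (f i)" i] i Surj_range[OF f i]
      by (simp only: h_def restrict_apply if_True)
  qed
  have "h ` {1..m} = h ` f ` {1..n}" by (simp only: Surj_image[OF f])
  also have "\<dots> = g ` {1..n}" unfolding image_image by (rule image_cong[OF refl hf])
  finally have "h \<in> Surj m k" using Surj_image[OF g] by (intro SurjI) (simp_all add: h_def)
  moreover have "compose {1..n} h f = g" by (rule compose_eqI, erule hf, rule Surj_ext[OF g])
  ultimately show thesis by (rule that)
qed

subsection \<open>Equalizers and pullbacks of simple algebras\<close>

text \<open>
  The sets invariant under \<open>\<sigma>\<close> form the equalizer of \<open>\<sigma>\<close> and the identity.  This is a copy of
  \<open>Simple k\<close>, where \<open>k < n\<close> because \<open>\<sigma>\<close> moves a point \<open>i\<close> and \<open>g\<close> identifies \<open>i\<close> with \<open>\<sigma> i\<close>.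
\<close>

lemma restr_equalizer:
  assumes F: "F \<in> Obj (Lex S5Alg_fin SET)" and n: "1 \<le> n"
    and \<sigma>: "\<sigma> \<in> Surj n n" "\<sigma> \<noteq> (\<lambda>i \<in> {1..n}. i)"
    and x: "x \<in> Sort (restr F) n" "Op (restr F) n n \<sigma> x = x"
  obtains k g z where "1 \<le> k" "k < n" "g \<in> Surj n k" "z \<in> Sort (restr F) k" "Op (restr F) n k g z = x"
proof -
  define \<A> where "\<A> = {a. a \<subseteq> {1..n} \<and> {i \<in> {1..n}. \<sigma> i \<in> a} = a}"
  have inA: "a \<in> \<A> \<longleftrightarrow> a \<subseteq> {1..n} \<and> (\<forall>i \<in> {1..n}. \<sigma> i \<in> a \<longleftrightarrow> i \<in> a)" for a
    unfolding \<A>_def by blast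
  obtain k g where g: "g \<in> Surj n k" and Ag: "\<And>a. a \<in> \<A> \<longleftrightarrow> (\<exists>S \<subseteq> {1..k}. a = {i \<in> {1..n}. g i \<in> S})"
  proof (rule field_of_sets_is_preimage[of \<A> n])
    show "\<A> \<subseteq> Pow {1..n}" unfolding \<A>_def by blast
    show "{1..n} \<in> \<A>" unfolding inA using Surj_range[OF \<sigma>(1)] by blast
    show "a \<inter> b \<in> \<A>" if "a \<in> \<A>" "b \<in> \<A>" for a b using that unfolding inA by blast
    show "{1..n} - a \<in> \<A>" if "a \<in> \<A>" for a using that Surj_range[OF \<sigma>(1)] unfolding inA by blast
  qed (rule that)
  obtain i where i: "i \<in> {1..n}" "\<sigma> i \<noteq> i"
  proof (rule ccontr)
    assume "\<not> thesis"
    then have "\<sigma> i = i" if "i \<in> {1..n}" for i using that \<open>\<And>i. \<lbrakk>i \<in> {1..n}; \<sigma> i \<noteq> i\<rbrakk> \<Longrightarrow> thesis\<close> by blast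
    then have "\<sigma> = (\<lambda>i \<in> {1..n}. i)" using Surj_ext[OF \<sigma>(1)] by (intro extensionalityI) auto
    then show False using \<sigma>(2) by blast
  qed
  have "{j \<in> {1..n}. g j \<in> {g i}} \<in> \<A>" unfolding Ag using Surj_range[OF g i(1)] by blast
  then have "g (\<sigma> i) = g i" using i(1) Surj_range[OF \<sigma>(1) i(1)] unfolding inA by blast
  then have "k \<noteq> n" using Surj_inj[of g n] g i Surj_range[OF \<sigma>(1) i(1)] unfolding inj_on_def by blast
  then have kn: "k < n" using Surj_le[OF g] by simp
  define E where "E i u = (if u = (0::nat) then dual n n (\<lambda>i \<in> {1..n}. i) else dual n n \<sigma>)" for i :: nat and u
  have "\<exists>!z. z \<in> FObj F (Simple k) \<and> (\<forall>i < (2::nat). FArr F (Simple k) (Simple n) (dual n k g) z = x)"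
  proof (rule lex_preserves_star_limit[OF F, where N = 2 and H = "\<lambda>_. {0, 1}" and E = E
        and D = "\<lambda>_. Simple n" and p = "\<lambda>_. dual n k g" and x = "\<lambda>_. x"])
    show "E i u \<in> s5_hom (Simple n) (Simple n)" for i u
      using dual_hom[OF Surj_id] dual_hom[OF \<sigma>(1)] by (simp add: E_def)
    show "dual n k g \<in> s5_hom (Simple k) (Simple n)" by (rule dual_hom[OF g])
    show "E i u (dual n k g l) = dual n k g l" if l: "l \<in> carrier (Simple k)" for i u l
    proof -
      have gl: "dual n k g l \<in> carrier (Simple n)" by (rule s5_hom_closed[OF dual_hom[OF g] l])
      have "decode n (dual n k g l) \<in> \<A>"
        unfolding decode_dual[OF l] Ag using decode_sub[OF l] by blast
      then have "{i \<in> {1..n}. \<sigma> i \<in> decode n (dual n k g l)} = decode n (dual n k g l)" by (simp only: \<A>_def mem_Collect_eq)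
      then have "dual n n \<sigma> (dual n k g l) = dual n k g l"
        by (simp only: dual_apply[OF gl] code_decode[OF gl])
      then show ?thesis using gl by (simp add: E_def dual_id)
    qed
    fix d assume d: "\<And>i. i < 2 \<Longrightarrow> d i \<in> carrier (Simple n)"
      and eq: "\<And>i u. \<lbrakk>0 < i; i < 2; u \<in> {0, 1}\<rbrakk> \<Longrightarrow> E i u (d i) = d 0"
    have d1: "d 1 \<in> carrier (Simple n)" by (rule d) simp
    have d01: "d 0 = d 1" using eq[of 1 0] d1 by (simp add: E_def dual_id)
    have "dual n n \<sigma> (d 1) = d 1" using eq[of 1 1] d01 by (simp add: E_def)
    then have "{i \<in> {1..n}. \<sigma> i \<in> decode n (d 1)} = decode n (d 1)" using decode_dual[OF d1, of n \<sigma>] by simp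
    then have "decode n (d 1) \<in> \<A>" using decode_sub[OF d1] unfolding \<A>_def by blast
    then obtain S where S: "S \<subseteq> {1..k}" "decode n (d 1) = {i \<in> {1..n}. g i \<in> S}" unfolding Ag by blast
    have "dual n k g (code k S) = d 1"
      using code_decode[OF d1] by (simp only: dual_apply[OF code_closed[OF S(1)]] decode_code[OF S(1)] S(2)[symmetric])
    then have gd: "dual n k g (code k S) = d i" if "i < 2" for i
      using d01 that by (auto simp: less_2_cases_iff One_nat_def)
    show "\<exists>!l. l \<in> carrier (Simple k) \<and> (\<forall>i < 2. dual n k g l = d i)"
    proof (rule ex1I[of _ "code k S"])
      show "code k S \<in> carrier (Simple k) \<and> (\<forall>i < 2. dual n k g (code k S) = d i)"
        using code_closed[OF S(1)] gd by blast
      fix l assume l: "l \<in> carrier (Simple k) \<and> (\<forall>i < 2. dual n k g l = d i)"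
      then have "dual n k g l = d 0" by simp
      then show "l = code k S" using l gd[of 0] by (intro dual_inj[OF g _ code_closed[OF S(1)]]) simp_all
    qed
  next
    show "FArr F (Simple n) (Simple n) (E i u) x = x" for i u
      using x restr_id[of F x n] F unfolding E_def Lex_def by simp
  qed (use x Simple_Obj in auto)
  then obtain z where z: "z \<in> FObj F (Simple k)" "FArr F (Simple k) (Simple n) (dual n k g) z = x"
    by (auto simp: less_2_cases_iff)
  show thesis by (rule that[OF Surj_pos[OF g n] kn g, of z]) (simp_all add: z)
qed

text \<open>
  The sets that are unions of fibres of \<open>f1\<close> as well as of \<open>f2\<close> form the intersection of the
  subalgebras \<open>Simple m1\<close> and \<open>Simple m2\<close> of \<open>Simple n\<close>, hence a pullback that \<open>F\<close> preserves.
\<close>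

lemma restr_pullback:
  assumes F: "F \<in> Obj (Lex S5Alg_fin SET)" and n: "1 \<le> n"
    and f1: "f1 \<in> Surj n m1" and f2: "f2 \<in> Surj n m2"
    and y1: "y1 \<in> Sort (restr F) m1" and y2: "y2 \<in> Sort (restr F) m2"
    and eq: "Op (restr F) n m1 f1 y1 = Op (restr F) n m2 f2 y2"
  obtains k g1 g2 z where "g1 \<in> Surj m1 k" "g2 \<in> Surj m2 k" "compose {1..n} g1 f1 = compose {1..n} g2 f2"
    "z \<in> Sort (restr F) k" "Op (restr F) m1 k g1 z = y1" "Op (restr F) m2 k g2 z = y2"
proof -
  define \<A> where "\<A> = {a. a \<subseteq> {1..n} \<and> (\<forall>i \<in> {1..n}. \<forall>j \<in> {1..n}. f1 i = f1 j \<or> f2 i = f2 j \<longrightarrow> (i \<in> a \<longleftrightarrow> j \<in> a))}"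
  have AD: "i \<in> a \<longleftrightarrow> j \<in> a" if "a \<in> \<A>" "i \<in> {1..n}" "j \<in> {1..n}" "f1 i = f1 j \<or> f2 i = f2 j" for a i j
    using that unfolding \<A>_def mem_Collect_eq by metis
  obtain k g where g: "g \<in> Surj n k" and Ag: "\<And>a. a \<in> \<A> \<longleftrightarrow> (\<exists>S \<subseteq> {1..k}. a = {i \<in> {1..n}. g i \<in> S})"
  proof (rule field_of_sets_is_preimage[of \<A> n])
    show "\<A> \<subseteq> Pow {1..n}" "{1..n} \<in> \<A>" unfolding \<A>_def by blast+
    show "a \<inter> b \<in> \<A>" if "a \<in> \<A>" "b \<in> \<A>" for a b
      using that unfolding \<A>_def mem_Collect_eq by (metis IntD1 IntD2 IntI subset_iff)
    show "{1..n} - a \<in> \<A>" if "a \<in> \<A>" for a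
      using that unfolding \<A>_def mem_Collect_eq by (metis Diff_iff subset_iff)
  qed (rule that)
  have resp: "g i = g j" if "i \<in> {1..n}" "j \<in> {1..n}" "f1 i = f1 j \<or> f2 i = f2 j" for i j
  proof -
    have "{j \<in> {1..n}. g j \<in> {g i}} \<in> \<A>" unfolding Ag using Surj_range[OF g that(1)] by blast
    then have "i \<in> {j \<in> {1..n}. g j \<in> {g i}} \<longleftrightarrow> j \<in> {j \<in> {1..n}. g j \<in> {g i}}" by (rule AD[OF _ that])
    then show ?thesis using that(1,2) by simp
  qed
  obtain g1 where g1: "g1 \<in> Surj m1 k" "compose {1..n} g1 f1 = g"
  proof (rule Surj_factor[OF f1 g])
    show "g i = g j" if "i \<in> {1..n}" "j \<in> {1..n}" "f1 i = f1 j" for i j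
      by (rule resp[OF that(1,2)]) (simp add: that(3))
  qed (rule that)
  obtain g2 where g2: "g2 \<in> Surj m2 k" "compose {1..n} g2 f2 = g"
  proof (rule Surj_factor[OF f2 g])
    show "g i = g j" if "i \<in> {1..n}" "j \<in> {1..n}" "f2 i = f2 j" for i j
      by (rule resp[OF that(1,2)]) (simp add: that(3))
  qed (rule that)
  define m where "m i = (if i = 0 then n else if i = 1 then m1 else m2)" for i :: nat
  define p where "p i = (if i = 0 then g else if i = 1 then g1 else g2)" for i :: nat
  define f where "f i = (if i = 1 then f1 else f2)" for i :: nat
  define x where "x i = (if i = 0 then Op (restr F) n m1 f1 y1 else if i = 1 then y1 else y2)" for i :: nat
  have p: "p i \<in> Surj (m i) k" for i using g g1 g2 by (simp add: p_def m_def)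
  have f: "f i \<in> Surj n (m i)" if "0 < i" for i using f1 f2 that by (simp add: f_def m_def)
  have fp: "dual n (m i) (f i) (dual (m i) k (p i) l) = dual n k g l"
    if "0 < i" "l \<in> carrier (Simple k)" for i l
  proof -
    have "compose {1..n} (p i) (f i) = g" using that(1) g1 g2 by (simp add: p_def f_def)
    then have "compose (carrier (Simple k)) (dual n (m i) (f i)) (dual (m i) k (p i)) = dual n k g"
      by (simp only: dual_compose[OF f[OF that(1)] p])
    then show ?thesis using that(2) by (rule compose_eqD)
  qed
  have Ff: "is_functor S5Alg_fin SET F" using F by (simp add: Lex_def)
  have "\<exists>!z. z \<in> FObj F (Simple k) \<and> (\<forall>i < 3. FArr F (Simple k) (Simple (m i)) (dual (m i) k (p i)) z = x i)"
  proof (rule lex_preserves_star_limit[OF F, where H = "\<lambda>_. {0}" and E = "\<lambda>i u. dual n (m i) (f i)"])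
    show "dual n (m i) (f i) \<in> s5_hom (Simple (m i)) (Simple (m 0))" if "0 < i" for i
      using dual_hom[OF f[OF that]] by (simp add: m_def)
    show "dual (m i) k (p i) \<in> s5_hom (Simple k) (Simple (m i))" for i by (rule dual_hom[OF p])
    show "dual n (m i) (f i) (dual (m i) k (p i) l) = dual (m 0) k (p 0) l"
      if "0 < i" "l \<in> carrier (Simple k)" for i l
      using fp[OF that] by (simp add: m_def p_def)
    fix d assume d: "\<And>i. i < 3 \<Longrightarrow> d i \<in> carrier (Simple (m i))"
      and eq: "\<And>i u. \<lbrakk>0 < i; i < 3; u \<in> {0}\<rbrakk> \<Longrightarrow> dual n (m i) (f i) (d i) = d 0"
    have d0: "d 0 \<in> carrier (Simple n)" using d[of 0] by (simp add: m_def)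
    have dj: "decode n (d 0) = {i \<in> {1..n}. f j i \<in> decode (m j) (d j)}" if "0 < j" "j < 3" for j
      using eq[OF that] decode_dual[OF d[OF that(2)], of n "f j"] by simp
    have "f 1 = f1" "f 2 = f2" by (simp_all add: f_def)
    note dj1 = dj[of 1, unfolded this(1)] and dj2 = dj[of 2, unfolded this(2)]
    have "decode n (d 0) = {i \<in> {1..n}. f1 i \<in> decode (m 1) (d 1)}"
      "decode n (d 0) = {i \<in> {1..n}. f2 i \<in> decode (m 2) (d 2)}"
      by (rule dj1; simp) (rule dj2; simp)
    then have "decode n (d 0) \<in> \<A>" unfolding \<A>_def mem_Collect_eq by (metis (mono_tags, lifting) mem_Collect_eq subsetI)
    then obtain S where S: "S \<subseteq> {1..k}" "decode n (d 0) = {i \<in> {1..n}. g i \<in> S}" unfolding Ag by blast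
    note cS = code_closed[OF S(1)]
    have pd0: "dual n k g (code k S) = d 0"
      using code_decode[OF d0] by (simp only: dual_apply[OF cS] decode_code[OF S(1)] S(2)[symmetric])
    have pd: "dual (m i) k (p i) (code k S) = d i" if i: "i < 3" for i
    proof (cases "i = 0")
      case True
      then show ?thesis using pd0 by (simp add: m_def p_def)
    next
      case False
      then have i0: "0 < i" by simp
      show ?thesis
      proof (rule dual_inj[OF f[OF i0]])
        show "dual (m i) k (p i) (code k S) \<in> carrier (Simple (m i))" by (rule s5_hom_closed[OF dual_hom[OF p] cS])
        show "dual n (m i) (f i) (dual (m i) k (p i) (code k S)) = dual n (m i) (f i) (d i)"
          using fp[OF i0 cS] pd0 eq[OF i0 i] by simp
      qed (rule d[OF i])
    qed
    show "\<exists>!l. l \<in> carrier (Simple k) \<and> (\<forall>i < 3. dual (m i) k (p i) l = d i)"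
    proof (rule ex1I[of _ "code k S"])
      show "code k S \<in> carrier (Simple k) \<and> (\<forall>i < 3. dual (m i) k (p i) (code k S) = d i)" using cS pd by blast
      fix l assume l: "l \<in> carrier (Simple k) \<and> (\<forall>i < 3. dual (m i) k (p i) l = d i)"
      then have "dual (m 0) k (p 0) l = d 0" by simp
      then show "l = code k S" using l cS pd0 dual_inj[OF g] by (simp add: m_def p_def)
    qed
  next
    show "x i \<in> FObj F (Simple (m i))" for i
      using y1 y2 restr_closed[OF Ff f1 y1] by (simp add: x_def m_def)
    show "FArr F (Simple (m i)) (Simple (m 0)) (dual n (m i) (f i)) (x i) = x 0" if "0 < i" for i
      using that eq by (simp add: x_def m_def f_def)
  qed (use Simple_Obj in auto)
  then obtain z where z: "z \<in> FObj F (Simple k)"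
    "\<And>i. i < 3 \<Longrightarrow> FArr F (Simple k) (Simple (m i)) (dual (m i) k (p i)) z = x i" by blast
  show thesis
  proof (rule that[OF g1(1) g2(1)])
    show "compose {1..n} g1 f1 = compose {1..n} g2 f2" using g1 g2 by simp
    show "z \<in> Sort (restr F) k" using z by simp
    show "Op (restr F) m1 k g1 z = y1" using z(2)[of 1] by (simp add: m_def p_def x_def)
    show "Op (restr F) m2 k g2 z = y2" using z(2)[of 2] by (simp add: m_def p_def x_def)
  qed
qed

subsection \<open>Restrictions are models\<close>

lemma Bij_Surj: "\<sigma> \<in> Bij {1..n} \<Longrightarrow> \<sigma> \<in> Surj n n"
  by (rule SurjI) (simp_all add: Bij_def bij_betw_def)

lemma Surj_Bij: "\<sigma> \<in> Surj n n \<Longrightarrow> \<sigma> \<in> Bij {1..n}"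
  by (simp add: Bij_def bij_betw_def Surj_inj Surj_image Surj_ext)

text \<open>If \<open>g\<close> identified two points, exchanging them would fix \<open>g(z)\<close>.\<close>

lemma Fix_trivial_imp_inj:
  assumes M: "axiom1 M" and g: "g \<in> Surj m k" and mk: "1 \<le> m" "1 \<le> k" and z: "z \<in> Sort M k"
    and triv: "Fix_trivial M m (Op M m k g z)"
  shows "inj_on g {1..m}"
proof (rule inj_onI, rule ccontr)
  fix i j assume ij: "i \<in> {1..m}" "j \<in> {1..m}" "g i = g j" "i \<noteq> j"
  define \<sigma> where "\<sigma> = (\<lambda>l \<in> {1..m}. if l = i then j else if l = j then i else l)"
  have "\<sigma> ` {1..m} = {1..m}"
  proof (intro subset_antisym subsetI)
    show "l \<in> {1..m}" if "l \<in> \<sigma> ` {1..m}" for l using that ij by (auto simp: \<sigma>_def split: if_splits)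
    show "l \<in> \<sigma> ` {1..m}" if "l \<in> {1..m}" for l
      using that ij by (intro image_eqI[of _ _ "\<sigma> l"]) (auto simp: \<sigma>_def)
  qed
  then have \<sigma>: "\<sigma> \<in> Surj m m" by (intro SurjI) (simp_all add: \<sigma>_def)
  have "compose {1..m} g \<sigma> = g"
    by (rule compose_eqI) (use ij Surj_ext[OF g] in \<open>auto simp: \<sigma>_def\<close>)
  then have "Op M m m \<sigma> (Op M m k g z) = Op M m k g z"
    using M mk \<sigma> g z by (simp add: axiom1_def)
  moreover have "\<sigma> i \<noteq> (\<lambda>l \<in> {1..m}. l) i" using ij by (simp add: \<sigma>_def)
  then have "\<sigma> \<in> Bij {1..m} - {\<lambda>l \<in> {1..m}. l}" using Surj_Bij[OF \<sigma>] by blast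
  ultimately show False using triv unfolding Fix_trivial_def by blast
qed

text \<open>
  An element that some nontrivial permutation fixes comes from a smaller sort by
  \<open>restr_equalizer\<close>; iterating this gives the existence part of axiom (5).  When an element comes
  from \<open>y1\<close> and from \<open>y2\<close>, both with trivial stabilizer, the surjections \<open>g1\<close>, \<open>g2\<close> of
  \<open>restr_pullback\<close> are bijections by \<open>Fix_trivial_imp_inj\<close>.  Hence \<open>y1\<close> and \<open>y2\<close> have the same sort,
  and \<open>g2\<close> followed by the inverse of \<open>g1\<close> is the permutation required by axiom (6).
\<close>

theorem model_T2_restr:
  assumes F: "F \<in> Obj (Lex S5Alg_fin SET)"
  shows "model_T2 (restr F)"
proof -
  let ?M = "restr F"
  have Ff: "is_functor S5Alg_fin SET F" using F by (simp add: Lex_def)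
  note ax1 = axiom1_restr[OF Ff]
  have ex: "\<exists>m f y. 1 \<le> m \<and> m \<le> n \<and> f \<in> Surj n m \<and> y \<in> Sort ?M m \<and>
      Op ?M n m f y = x \<and> Fix_trivial ?M m y"
    if "1 \<le> n" "x \<in> Sort ?M n" for n x
    using that
  proof (induction n arbitrary: x rule: less_induct)
    case (less n)
    show ?case
    proof (cases "Fix_trivial ?M n x")
      case True
      then show ?thesis using less.prems Surj_id restr_id[OF Ff less.prems(2)] by blast
    next
      case False
      then obtain \<sigma> where \<sigma>: "\<sigma> \<in> Bij {1..n}" "\<sigma> \<noteq> (\<lambda>i \<in> {1..n}. i)" "Op ?M n n \<sigma> x = x"
        unfolding Fix_trivial_def by blast
      obtain k g z where k: "1 \<le> k" "k < n" "g \<in> Surj n k" "z \<in> Sort ?M k" "Op ?M n k g z = x"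
        by (rule restr_equalizer[OF F less.prems(1) Bij_Surj[OF \<sigma>(1)] \<sigma>(2) less.prems(2) \<sigma>(3)])
      obtain m f y where m: "1 \<le> m" "m \<le> k" "f \<in> Surj k m" "y \<in> Sort ?M m"
          "Op ?M k m f y = z" "Fix_trivial ?M m y"
        using less.IH[OF k(2,1,4)] by blast
      have "Op ?M n m (compose {1..n} f g) y = x"
        using restr_compose[OF Ff k(3) m(3,4)] m(5) k(5) by simp
      moreover have "m \<le> n" using m k by simp
      ultimately show ?thesis using m Surj_compose[OF k(3) m(3)] by blast
    qed
  qed
  have uniq: "\<exists>k g1 g2 z. m1 = k \<and> m2 = k \<and> g1 \<in> Surj k k \<and> g2 \<in> Surj k k \<and>
      compose {1..n} g1 f1 = compose {1..n} g2 f2 \<and>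
      z \<in> Sort ?M k \<and> Op ?M k k g1 z = y1 \<and> Op ?M k k g2 z = y2"
    if n: "1 \<le> n" and m: "1 \<le> m1" "1 \<le> m2" and f: "f1 \<in> Surj n m1" "f2 \<in> Surj n m2"
      and y: "y1 \<in> Sort ?M m1" "y2 \<in> Sort ?M m2"
      and eq: "Op ?M n m1 f1 y1 = Op ?M n m2 f2 y2"
      and triv: "Fix_trivial ?M m1 y1" "Fix_trivial ?M m2 y2" for n m1 m2 f1 f2 y1 y2
  proof -
    obtain k g1 g2 z where g: "g1 \<in> Surj m1 k" "g2 \<in> Surj m2 k" "compose {1..n} g1 f1 = compose {1..n} g2 f2"
      and z: "z \<in> Sort ?M k" "Op ?M m1 k g1 z = y1" "Op ?M m2 k g2 z = y2"
      by (rule restr_pullback[OF F n f y eq])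
    have k: "1 \<le> k" using Surj_pos[OF g(1) m(1)] .
    have "inj_on g1 {1..m1}" using triv(1) unfolding z(2)[symmetric] by (rule Fix_trivial_imp_inj[OF ax1 g(1) m(1) k z(1)])
    then have 1: "m1 = k" using card_image[of g1 "{1..m1}"] Surj_image[OF g(1)] by simp
    have "inj_on g2 {1..m2}" using triv(2) unfolding z(3)[symmetric] by (rule Fix_trivial_imp_inj[OF ax1 g(2) m(2) k z(1)])
    then have 2: "m2 = k" using card_image[of g2 "{1..m2}"] Surj_image[OF g(2)] by simp
    show ?thesis using 1 2 g z by blast
  qed
  have "axiom5 ?M"
    unfolding axiom5_def
  proof (intro allI impI ballI)
    fix n :: nat and x assume n: "1 \<le> n" and x: "x \<in> Sort ?M n"
    obtain m f y where m: "1 \<le> m" "m \<le> n" "f \<in> Surj n m" "y \<in> Sort ?M m"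
        "Op ?M n m f y = x" "Fix_trivial ?M m y"
      using ex[OF n x] by blast
    show "\<exists>!m. 1 \<le> m \<and> m \<le> n \<and>
        (\<exists>f \<in> Surj n m. \<exists>y \<in> Sort ?M m. Op ?M n m f y = x \<and> Fix_trivial ?M m y)"
    proof (rule ex1I[of _ m])
      show "1 \<le> m \<and> m \<le> n \<and>
        (\<exists>f \<in> Surj n m. \<exists>y \<in> Sort ?M m. Op ?M n m f y = x \<and> Fix_trivial ?M m y)"
        using m by blast
      fix m' assume "1 \<le> m' \<and> m' \<le> n \<and>
        (\<exists>f \<in> Surj n m'. \<exists>y \<in> Sort ?M m'. Op ?M n m' f y = x \<and> Fix_trivial ?M m' y)"
      then obtain f' y' where m': "1 \<le> m'" "f' \<in> Surj n m'" "y' \<in> Sort ?M m'"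
        "Op ?M n m' f' y' = x" "Fix_trivial ?M m' y'" by blast
      have "Op ?M n m' f' y' = Op ?M n m f y" using m' m by simp
      from uniq[OF n m'(1) m(1) m'(2) m(3) m'(3) m(4) this m'(5) m(6)] show "m' = m" by blast
    qed
  qed
  moreover have "axiom6 ?M"
    unfolding axiom6_def
  proof (intro allI impI ballI)
    fix n m :: nat and q1 q2 x1 x2
    assume nm: "1 \<le> n" "1 \<le> m" and q: "q1 \<in> Surj n m" "q2 \<in> Surj n m"
      and x: "x1 \<in> Sort ?M m" "x2 \<in> Sort ?M m"
      and "Fix_trivial ?M m x1 \<and> Fix_trivial ?M m x2 \<and> Op ?M n m q1 x1 = Op ?M n m q2 x2"
    then obtain k g1 g2 z where k: "m = k" and g: "g1 \<in> Surj k k" "g2 \<in> Surj k k"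
      "compose {1..n} g1 q1 = compose {1..n} g2 q2" and z: "z \<in> Sort ?M k"
      "Op ?M k k g1 z = x1" "Op ?M k k g2 z = x2"
      using uniq[OF nm(1) nm(2) nm(2) q x] by blast
    have "g1 ` {1..m} = {1..m}" "inj_on g1 {1..m}" using g k Surj_image Surj_inj by blast+
    define \<sigma> where "\<sigma> = (\<lambda>i \<in> {1..m}. inv_into {1..m} g1 (g2 i))"
    have g1\<sigma>: "g1 (\<sigma> i) = g2 i" "\<sigma> i \<in> {1..m}" if i: "i \<in> {1..m}" for i
    proof -
      have "g2 i \<in> g1 ` {1..m}" using Surj_range[OF g(2)] i k \<open>g1 ` {1..m} = {1..m}\<close> by blast
      moreover have "\<sigma> i = inv_into {1..m} g1 (g2 i)" using i by (simp add: \<sigma>_def)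
      ultimately show "g1 (\<sigma> i) = g2 i" "\<sigma> i \<in> {1..m}"
        using f_inv_into_f[of "g2 i"] inv_into_into[of "g2 i"] by metis+
    qed
    have \<sigma>_eq: "\<sigma> (q2 i) = q1 i" if i: "i \<in> {1..n}" for i
    proof -
      have "g1 (\<sigma> (q2 i)) = g1 (q1 i)"
        using g1\<sigma>[OF Surj_range[OF q(2) i]] compose_eqD[OF g(3) i] i by (simp add: compose_def)
      then show ?thesis
        using inj_onD[OF \<open>inj_on g1 {1..m}\<close>] g1\<sigma>(2)[OF Surj_range[OF q(2) i]] Surj_range[OF q(1) i] by blast
    qed
    have "\<sigma> ` {1..m} = {1..m}"
    proof (intro subset_antisym subsetI)
      show "i \<in> {1..m}" if "i \<in> \<sigma> ` {1..m}" for i using that g1\<sigma>(2) by blast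
      fix i assume "i \<in> {1..m}"
      then obtain j where j: "j \<in> {1..n}" "i = q1 j" using Surj_image[OF q(1)] by blast
      then show "i \<in> \<sigma> ` {1..m}" using \<sigma>_eq[OF j(1)] Surj_range[OF q(2) j(1)] by (metis image_eqI)
    qed
    then have \<sigma>: "\<sigma> \<in> Surj m m" by (intro SurjI) (simp_all add: \<sigma>_def)
    have "compose {1..n} \<sigma> q2 = q1" by (rule compose_eqI, erule \<sigma>_eq, rule Surj_ext[OF q(1)])
    moreover have "compose {1..m} g1 \<sigma> = g2"
      by (rule compose_eqI, erule g1\<sigma>(1)) (use Surj_ext[OF g(2)] k in simp)
    then have "Op ?M m m \<sigma> x1 = x2"
      using restr_compose[OF Ff \<sigma>, of g1 m z] g z k by simp
    ultimately show "\<exists>\<sigma> \<in> Bij {1..m}. compose {1..n} \<sigma> q2 = q1 \<and> Op ?M m m \<sigma> x1 = x2"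
      using Surj_Bij[OF \<sigma>] by blast
  qed
  ultimately show ?thesis
    unfolding model_T2_def using L_structure_restr[OF Ff] ax1 by blast
qed

section \<open>Restriction is fully faithful\<close>

text \<open>
  A lex functor is the right Kan extension of its restriction, since it preserves the decomposition
  into simple algebras and every homomorphism to a simple algebra factors through a projection.
\<close>

lemma lex_determined_by_simple:
  assumes G: "G \<in> Obj (Lex S5Alg_fin SET)" and A: "A \<in> Obj S5Alg_fin"
    and w: "\<And>n g. \<lbrakk>1 \<le> n; g \<in> s5_hom A (Simple n)\<rbrakk> \<Longrightarrow> w n g \<in> FObj G (Simple n)"
    and compat: "\<And>m n f g. \<lbrakk>1 \<le> m; 1 \<le> n; f \<in> Surj m n; g \<in> s5_hom A (Simple n)\<rbrakk>
      \<Longrightarrow> w m (compose (carrier A) (dual m n f) g) = FArr G (Simple n) (Simple m) (dual m n f) (w n g)"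
  shows "\<exists>!z. z \<in> FObj G A \<and> (\<forall>n \<ge> 1. \<forall>g \<in> s5_hom A (Simple n). FArr G A (Simple n) g z = w n g)"
proof -
  have Gf: "is_functor S5Alg_fin SET G" using G by (simp add: Lex_def)
  obtain N n \<pi> where n: "\<And>j::nat. j < N \<Longrightarrow> 1 \<le> n j" and \<pi>: "\<And>j. j < N \<Longrightarrow> \<pi> j \<in> s5_hom A (Simple (n j))"
    and prod: "\<And>x. \<forall>j < N. x j \<in> carrier (Simple (n j))
      \<Longrightarrow> \<exists>!a. a \<in> carrier A \<and> (\<forall>j < N. \<pi> j a = x j)"
    and fac: "\<And>m g. \<lbrakk>1 \<le> m; g \<in> s5_hom A (Simple m)\<rbrakk>
      \<Longrightarrow> \<exists>j < N. \<exists>s \<in> Surj m (n j). g = compose (carrier A) (dual m (n j) s) (\<pi> j)"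
    by (rule simple_decomposition[OF A], rule that)
  have "\<exists>!z. z \<in> FObj G A \<and> (\<forall>j < N. FArr G A (Simple (n j)) (\<pi> j) z = w (n j) (\<pi> j))"
  proof (rule lex_preserves_star_limit[OF G, where N = N and H = "\<lambda>_. {}" and E = "\<lambda>_ _ a. a"
        and D = "\<lambda>j. Simple (n j)" and p = \<pi> and x = "\<lambda>j. w (n j) (\<pi> j)"])
    show "\<exists>!l. l \<in> carrier A \<and> (\<forall>j < N. \<pi> j l = d j)"
      if "\<And>j. j < N \<Longrightarrow> d j \<in> carrier (Simple (n j))" for d using prod that by blast
    show "w (n j) (\<pi> j) \<in> FObj G (Simple (n j))" if "j < N" for j by (rule w[OF n \<pi>]) (rule that)+
    show "\<pi> j \<in> s5_hom A (Simple (n j))" if "j < N" for j by (rule \<pi>[OF that])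
    show "A \<in> Obj S5Alg_fin" by (rule A)
  qed (simp_all only: Simple_Obj empty_iff finite.emptyI)
  then obtain z where z: "z \<in> FObj G A" "\<And>j. j < N \<Longrightarrow> FArr G A (Simple (n j)) (\<pi> j) z = w (n j) (\<pi> j)"
    and uniq: "\<And>z'. \<lbrakk>z' \<in> FObj G A; \<And>j. j < N \<Longrightarrow> FArr G A (Simple (n j)) (\<pi> j) z' = w (n j) (\<pi> j)\<rbrakk> \<Longrightarrow> z' = z"
    unfolding Ex1_def by blast
  have "FArr G A (Simple m) g z = w m g" if m: "1 \<le> m" and g: "g \<in> s5_hom A (Simple m)" for m g
  proof -
    obtain j s where j: "j < N" and s: "s \<in> Surj m (n j)" and gs: "g = compose (carrier A) (dual m (n j) s) (\<pi> j)"
      using fac[OF m g] by blast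
    have "FArr G A (Simple m) g z = FArr G (Simple (n j)) (Simple m) (dual m (n j) s) (w (n j) (\<pi> j))"
      using apply_compose[OF Gf A Simple_Obj Simple_Obj \<pi>[OF j] dual_hom[OF s] z(1)] z(2)[OF j] gs by simp
    also have "\<dots> = w m g" using compat[OF m n[OF j] s \<pi>[OF j]] gs by simp
    finally show ?thesis .
  qed
  then show ?thesis using z(1) uniq n \<pi> by (intro ex1I[of _ z]) blast+
qed

lemma nat_trans_apply:
  "\<lbrakk>\<eta> \<in> nat_trans S5Alg_fin SET F G; A \<in> Obj S5Alg_fin; x \<in> FObj F A\<rbrakk> \<Longrightarrow> \<eta> A x \<in> FObj G A"
  by (auto simp: nat_trans_def PiE_iff)

lemma nat_trans_natural:
  assumes \<eta>: "\<eta> \<in> nat_trans S5Alg_fin SET F G" and A: "A \<in> Obj S5Alg_fin" and B: "B \<in> Obj S5Alg_fin"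
    and f: "f \<in> s5_hom A B" and x: "x \<in> FObj F A"
  shows "\<eta> B (FArr F A B f x) = FArr G A B f (\<eta> A x)"
proof -
  have "\<forall>X \<in> Obj S5Alg_fin. \<forall>Y \<in> Obj S5Alg_fin. \<forall>f \<in> s5_hom X Y.
      compose (FObj F X) (\<eta> Y) (FArr F X Y f) = compose (FObj F X) (FArr G X Y f) (\<eta> X)"
    using \<eta> unfolding nat_trans_def S5Alg_fin_simps SET_simps by blast
  then have "compose (FObj F A) (\<eta> B) (FArr F A B f) = compose (FObj F A) (FArr G A B f) (\<eta> A)"
    using A B f by blast
  from compose_eqD[OF this x] show ?thesis using x by (simp add: compose_def)
qed

lemma restriction_arr:
  assumes "F \<in> Obj (Lex S5Alg_fin SET)" "G \<in> Obj (Lex S5Alg_fin SET)"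
    and \<eta>: "\<eta> \<in> nat_trans S5Alg_fin SET F G"
  shows "(\<lambda>n \<in> {1..}. \<eta> (Simple n)) \<in> L_hom (restr F) (restr G)"
proof -
  have "\<eta> (Simple n) \<in> FObj F (Simple n) \<rightarrow>\<^sub>E FObj G (Simple n)" for n
  proof -
    have "\<eta> \<in> (\<Pi>\<^sub>E X \<in> Obj S5Alg_fin. FObj F X \<rightarrow>\<^sub>E FObj G X)"
      using \<eta> unfolding nat_trans_def SET_simps by blast
    then show ?thesis using Simple_Obj by blast
  qed
  then show ?thesis
    by (simp add: L_hom_def nat_trans_natural[OF \<eta> Simple_Obj Simple_Obj dual_hom])
qed

lemma is_functor_restriction:
  "is_functor (Lex S5Alg_fin SET) Mod_T2 restriction"
  unfolding is_functor_def
proof (intro conjI ballI)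
  fix F assume F: "F \<in> Obj (Lex S5Alg_fin (SET :: ('u set, 'u \<Rightarrow> 'u) precategory))"
  show "FObj restriction F \<in> Obj Mod_T2"
    using model_T2_restr[OF F] by (simp add: restriction_def Mod_T2_def)
  show "FArr restriction F F (Id (Lex S5Alg_fin SET) F) = Id Mod_T2 (FObj restriction F)"
    using Simple_Obj by (auto simp: restriction_def Mod_T2_def Lex_def)
next
  fix F G \<eta>
  assume "F \<in> Obj (Lex S5Alg_fin (SET :: ('u set, 'u \<Rightarrow> 'u) precategory))" "G \<in> Obj (Lex S5Alg_fin SET)"
    "\<eta> \<in> Hom (Lex S5Alg_fin SET) F G"
  then show "FArr restriction F G \<eta> \<in> Hom Mod_T2 (FObj restriction F) (FObj restriction G)"
    using restriction_arr[of F G \<eta>] by (simp add: restriction_def Mod_T2_def) (simp add: Lex_def)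
next
  fix F G K :: "(nat s5_alg, nat \<Rightarrow> nat, 'u set, 'u \<Rightarrow> 'u) cfunctor" and \<eta> \<theta>
  show "FArr restriction F K (Comp (Lex S5Alg_fin SET) F G K \<theta> \<eta>) =
    Comp Mod_T2 (FObj restriction F) (FObj restriction G) (FObj restriction K)
      (FArr restriction G K \<theta>) (FArr restriction F G \<eta>)"
    using Simple_Obj by (auto simp: restriction_def Mod_T2_def Lex_def)
qed

text \<open>
  The transformation extending \<open>h\<close> sends \<open>x\<close> to the unique element whose image under every
  \<open>g\<close> from \<open>A\<close> to a simple algebra is \<open>h\<close> of the image of \<open>x\<close>.  Being characterized in this way, it is
  natural and unique.
\<close>

theorem restriction_fully_faithful:
  assumes F: "F \<in> Obj (Lex S5Alg_fin SET)" and G: "G \<in> Obj (Lex S5Alg_fin SET)"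
  shows "bij_betw (\<lambda>\<eta>. \<lambda>n \<in> {1..}. \<eta> (Simple n)) (nat_trans S5Alg_fin SET F G) (L_hom (restr F) (restr G))"
proof -
  have Ff: "is_functor S5Alg_fin SET F" and Gf: "is_functor S5Alg_fin SET G"
    using F G by (simp_all add: Lex_def)
  define comp where "comp h A x z \<longleftrightarrow> z \<in> FObj G A \<and>
    (\<forall>n \<ge> 1. \<forall>g \<in> s5_hom A (Simple n). FArr G A (Simple n) g z = h n (FArr F A (Simple n) g x))"
    for h :: "nat \<Rightarrow> 'a \<Rightarrow> 'a" and A x z
  have ex1: "\<exists>!z. comp h A x z"
    if h: "h \<in> L_hom (restr F) (restr G)" and A: "A \<in> Obj S5Alg_fin" and x: "x \<in> FObj F A" for h A x
    unfolding comp_def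
  proof (rule lex_determined_by_simple[OF G A])
    fix n g assume n: "1 \<le> n" and g: "g \<in> s5_hom A (Simple n)"
    show "h n (FArr F A (Simple n) g x) \<in> FObj G (Simple n)"
      using L_hom_app[OF h n] apply_closed[OF Ff A Simple_Obj g x] by simp
  next
    fix m n f g assume m: "1 \<le> m" and n: "1 \<le> n" and f: "f \<in> Surj m n" and g: "g \<in> s5_hom A (Simple n)"
    show "h m (FArr F A (Simple m) (compose (carrier A) (dual m n f) g) x) =
       FArr G (Simple n) (Simple m) (dual m n f) (h n (FArr F A (Simple n) g x))"
      using L_hom_Op[OF h m n f] apply_closed[OF Ff A Simple_Obj g x]
        apply_compose[OF Ff A Simple_Obj Simple_Obj g dual_hom[OF f] x] by simp
  qed
  have comp_nat: "comp (\<lambda>n \<in> {1..}. \<eta> (Simple n)) A x (\<eta> A x)"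
    if \<eta>: "\<eta> \<in> nat_trans S5Alg_fin SET F G" and A: "A \<in> Obj S5Alg_fin" and x: "x \<in> FObj F A" for \<eta> A x
    using nat_trans_apply[OF \<eta> A x] nat_trans_natural[OF \<eta> A Simple_Obj _ x] by (simp add: comp_def)
  show ?thesis
    unfolding bij_betw_def
  proof
    show "inj_on (\<lambda>\<eta>. \<lambda>n \<in> {1..}. \<eta> (Simple n)) (nat_trans S5Alg_fin SET F G)"
    proof (rule inj_onI)
      fix \<eta> \<theta> assume n: "\<eta> \<in> nat_trans S5Alg_fin SET F G" "\<theta> \<in> nat_trans S5Alg_fin SET F G"
        and eq: "(\<lambda>n \<in> {1..}. \<eta> (Simple n)) = (\<lambda>n \<in> {1..}. \<theta> (Simple n))"
      have P: "\<eta> \<in> (\<Pi>\<^sub>E X \<in> Obj S5Alg_fin. FObj F X \<rightarrow>\<^sub>E FObj G X)"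
        "\<theta> \<in> (\<Pi>\<^sub>E X \<in> Obj S5Alg_fin. FObj F X \<rightarrow>\<^sub>E FObj G X)"
        using n unfolding nat_trans_def SET_simps by blast+
      show "\<eta> = \<theta>"
      proof (rule PiE_ext[OF P])
        fix A assume A: "A \<in> Obj S5Alg_fin"
        have \<eta>A: "\<eta> A \<in> FObj F A \<rightarrow>\<^sub>E FObj G A" and \<theta>A: "\<theta> A \<in> FObj F A \<rightarrow>\<^sub>E FObj G A"
          using P A by blast+
        show "\<eta> A = \<theta> A"
        proof (rule PiE_ext[OF \<eta>A \<theta>A])
          fix x assume x: "x \<in> FObj F A"
          show "\<eta> A x = \<theta> A x"
            using ex1[OF restriction_arr[OF F G n(1)] A x] comp_nat[OF n(1) A x]
              comp_nat[OF n(2) A x, folded eq] by blast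
        qed
      qed
    qed
    show "(\<lambda>\<eta>. \<lambda>n \<in> {1..}. \<eta> (Simple n)) ` nat_trans S5Alg_fin SET F G = L_hom (restr F) (restr G)"
    proof (intro subset_antisym subsetI)
      show "h \<in> L_hom (restr F) (restr G)"
        if "h \<in> (\<lambda>\<eta>. \<lambda>n \<in> {1..}. \<eta> (Simple n)) ` nat_trans S5Alg_fin SET F G" for h
        using that restriction_arr[OF F G] by blast
      fix h assume h: "h \<in> L_hom (restr F) (restr G)"
      define \<eta> where "\<eta> = (\<lambda>A \<in> Obj S5Alg_fin. \<lambda>x \<in> FObj F A. THE z. comp h A x z)"
      have \<eta>: "comp h A x (\<eta> A x)" if "A \<in> Obj S5Alg_fin" "x \<in> FObj F A" for A x
        using theI'[OF ex1[OF h that]] that by (simp add: \<eta>_def)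
      have \<eta>G: "\<eta> A x \<in> FObj G A" and \<eta>h: "\<And>n g. \<lbrakk>1 \<le> n; g \<in> s5_hom A (Simple n)\<rbrakk>
          \<Longrightarrow> FArr G A (Simple n) g (\<eta> A x) = h n (FArr F A (Simple n) g x)"
        if "A \<in> Obj S5Alg_fin" "x \<in> FObj F A" for A x
        using \<eta>[OF that] unfolding comp_def by blast+
      have nt: "\<eta> B (FArr F A B f x) = FArr G A B f (\<eta> A x)"
        if A: "A \<in> Obj S5Alg_fin" and B: "B \<in> Obj S5Alg_fin" and f: "f \<in> s5_hom A B" and x: "x \<in> FObj F A"
        for A B f x
      proof -
        have "comp h B (FArr F A B f x) (FArr G A B f (\<eta> A x))"
          unfolding comp_def
        proof (intro conjI allI impI ballI)
          show "FArr G A B f (\<eta> A x) \<in> FObj G B" by (rule apply_closed[OF Gf A B f \<eta>G[OF A x]])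
          fix n :: nat and g assume n: "1 \<le> n" and g: "g \<in> s5_hom B (Simple n)"
          have As: "s5_algebra A" using A by simp
          show "FArr G B (Simple n) g (FArr G A B f (\<eta> A x)) = h n (FArr F B (Simple n) g (FArr F A B f x))"
            using \<eta>h[OF A x n s5_hom_compose[OF As f g]]
            by (simp only: apply_compose[OF Gf A B Simple_Obj f g \<eta>G[OF A x]] apply_compose[OF Ff A B Simple_Obj f g x])
        qed
        then show ?thesis
          using ex1[OF h B apply_closed[OF Ff A B f x]] \<eta>[OF B apply_closed[OF Ff A B f x]] by blast
      qed
      have "\<eta> \<in> nat_trans S5Alg_fin SET F G"
        unfolding nat_trans_def
      proof (intro CollectI conjI ballI)
        show "\<eta> \<in> (\<Pi>\<^sub>E X \<in> Obj S5Alg_fin. Hom SET (FObj F X) (FObj G X))"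
          using \<eta>G by (auto simp: \<eta>_def PiE_iff)
        fix A B f assume A: "A \<in> Obj S5Alg_fin" and B: "B \<in> Obj S5Alg_fin" and f: "f \<in> Hom S5Alg_fin A B"
        have "compose (FObj F A) (\<eta> B) (FArr F A B f) = compose (FObj F A) (FArr G A B f) (\<eta> A)"
          by (rule compose_eqI) (use nt[OF A B] f in \<open>simp_all add: compose_def\<close>)
        then show "Comp SET (FObj F A) (FObj F B) (FObj G B) (\<eta> B) (FArr F A B f) =
            Comp SET (FObj F A) (FObj G A) (FObj G B) (FArr G A B f) (\<eta> A)" by simp
      qed
      moreover have "(\<lambda>n \<in> {1..}. \<eta> (Simple n)) = h"
      proof (rule L_hom_ext[OF restriction_arr[OF F G \<open>\<eta> \<in> nat_trans S5Alg_fin SET F G\<close>] h])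
        fix n :: nat and x assume n: "1 \<le> n" and "x \<in> Sort (restr F) n"
        then have x: "x \<in> FObj F (Simple n)" by simp
        have "FArr G (Simple n) (Simple n) (\<lambda>a \<in> carrier (Simple n). a) (\<eta> (Simple n) x) =
            h n (FArr F (Simple n) (Simple n) (\<lambda>a \<in> carrier (Simple n). a) x)"
          by (rule \<eta>h[OF Simple_Obj x n s5_hom_id[OF Simple_alg]])
        then have "\<eta> (Simple n) x = h n x"
          by (simp only: apply_id[OF Gf Simple_Obj \<eta>G[OF Simple_Obj x]] apply_id[OF Ff Simple_Obj x])
        then show "(\<lambda>n \<in> {1..}. \<eta> (Simple n)) n x = h n x" using n by simp
      qed
      ultimately show "h \<in> (\<lambda>\<eta>. \<lambda>n \<in> {1..}. \<eta> (Simple n)) ` nat_trans S5Alg_fin SET F G" by blast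
    qed
  qed
qed

section \<open>The lex functor of a frame with finite clusters\<close>

text \<open>
  For a finite algebra \<open>A\<close> and finite clusters, such a homomorphism is dual to a p-morphism from the
  frame of \<open>A\<close> to \<open>(X, k)\<close>: the support condition excludes nonprincipal ultrafilters of \<open>X\<close> as values.
  Supports are taken to be unions of clusters because these are the subframes.
\<close>

definition finite_support_homs :: "'x set \<Rightarrow> ('x \<Rightarrow> 'k) \<Rightarrow> 'a s5_alg \<Rightarrow> ('x set \<Rightarrow> 'a) set" where
  "finite_support_homs X k A =
    {h \<in> s5_hom (Cm X k) A. \<exists>K. finite K \<and> h {x \<in> X. k x \<in> K} = tt\<^bsub>A\<^esub>}"

lemma finite_support_homs_compose:
  assumes h: "h \<in> finite_support_homs X k A" and f: "f \<in> s5_hom A B"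
  shows "compose (Pow X) f h \<in> finite_support_homs X k B"
proof -
  obtain K where K: "finite K" "h {x \<in> X. k x \<in> K} = tt\<^bsub>A\<^esub>" and hh: "h \<in> s5_hom (Cm X k) A"
    using h by (auto simp: finite_support_homs_def)
  have "compose (Pow X) f h \<in> s5_hom (Cm X k) B" using s5_hom_compose[OF s5_algebra_Cm hh f] by simp
  moreover have "compose (Pow X) f h {x \<in> X. k x \<in> K} = tt\<^bsub>B\<^esub>"
    using K(2) f by (simp add: compose_def s5_hom_def)
  ultimately show ?thesis using K(1) unfolding finite_support_homs_def by blast
qed

lemma s5_hom_Cm_Int:
  assumes "h \<in> s5_hom (Cm X k) A" "S \<subseteq> X" "T \<subseteq> X"
  shows "h (S \<inter> T) = h S \<curlywedge>\<^bsub>A\<^esub> h T"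
  using assms by (simp add: s5_hom_def)

lemma support_absorb:
  assumes A: "s5_algebra A" and h: "h \<in> s5_hom (Cm X k) A" and Y: "Y \<subseteq> X" "h Y = tt\<^bsub>A\<^esub>" and S: "S \<subseteq> X"
  shows "h (S \<inter> Y) = h S"
proof -
  interpret s5_algebra A by fact
  have "h S \<in> carrier A" using s5_hom_closed[OF h] S by simp
  then show ?thesis using s5_hom_Cm_Int[OF h S Y(1)] Y(2) by (simp add: meet_top)
qed

lemma support_mono:
  assumes A: "s5_algebra A" and h: "h \<in> s5_hom (Cm X k) A"
    and Y: "Y \<subseteq> Y'" "Y' \<subseteq> X" "h Y = tt\<^bsub>A\<^esub>"
  shows "h Y' = tt\<^bsub>A\<^esub>"
  using support_absorb[OF A h _ Y(3) Y(2)] Y by (simp add: Int_absorb1)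

text \<open>
  On a union of clusters the box is computed as in the whole frame.
\<close>

lemma restrict_support_hom:
  assumes A: "s5_algebra A" and h: "h \<in> s5_hom (Cm X k) A" and tt: "h {x \<in> X. k x \<in> K} = tt\<^bsub>A\<^esub>"
  shows "restrict h (Pow {x \<in> X. k x \<in> K}) \<in> s5_hom (Cm {x \<in> X. k x \<in> K} k) A"
proof -
  let ?Y = "{x \<in> X. k x \<in> K}"
  have YX: "?Y \<subseteq> X" by blast
  have abs: "h (S \<inter> ?Y) = h S" if "S \<subseteq> X" for S by (rule support_absorb[OF A h YX tt that])
  have hom: "h {} = ff\<^bsub>A\<^esub>"
    "\<And>S T. \<lbrakk>S \<subseteq> X; T \<subseteq> X\<rbrakk> \<Longrightarrow> h (S \<inter> T) = h S \<curlywedge>\<^bsub>A\<^esub> h T"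
    "\<And>S T. \<lbrakk>S \<subseteq> X; T \<subseteq> X\<rbrakk> \<Longrightarrow> h (S \<union> T) = h S \<curlyvee>\<^bsub>A\<^esub> h T"
    "\<And>S. S \<subseteq> X \<Longrightarrow> h (X - S) = neg\<^bsub>A\<^esub> (h S)"
    "\<And>S. S \<subseteq> X \<Longrightarrow> h {x \<in> X. \<forall>y \<in> X. k y = k x \<longrightarrow> y \<in> S} = box\<^bsub>A\<^esub> (h S)"
    "\<And>S. S \<subseteq> X \<Longrightarrow> h S \<in> carrier A"
    using h by (auto simp: s5_hom_def PiE_iff)
  have neg: "h (?Y - S) = neg\<^bsub>A\<^esub> (h S)" if S: "S \<subseteq> ?Y" for S
  proof -
    have "?Y - S = (X - S) \<inter> ?Y" by blast
    then have "h (?Y - S) = h (X - S)" using abs[of "X - S"] by (metis Diff_subset)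
    then show ?thesis using hom(4) S YX by simp
  qed
  have box: "h {x \<in> ?Y. \<forall>y \<in> ?Y. k y = k x \<longrightarrow> y \<in> S} = box\<^bsub>A\<^esub> (h S)" if S: "S \<subseteq> ?Y" for S
  proof -
    have "{x \<in> ?Y. \<forall>y \<in> ?Y. k y = k x \<longrightarrow> y \<in> S} = {x \<in> X. \<forall>y \<in> X. k y = k x \<longrightarrow> y \<in> S} \<inter> ?Y"
      by auto
    then have "h {x \<in> ?Y. \<forall>y \<in> ?Y. k y = k x \<longrightarrow> y \<in> S} = h {x \<in> X. \<forall>y \<in> X. k y = k x \<longrightarrow> y \<in> S}"
      using abs[of "{x \<in> X. \<forall>y \<in> X. k y = k x \<longrightarrow> y \<in> S}"] by (metis (no_types, lifting) mem_Collect_eq subsetI)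
    then show ?thesis using hom(5)[of S] S by auto
  qed
  show ?thesis
    unfolding s5_hom_def
  proof (intro CollectI conjI ballI)
    show "restrict h (Pow ?Y) \<in> carrier (Cm ?Y k) \<rightarrow>\<^sub>E carrier A" using hom(6) YX by auto
    show "restrict h (Pow ?Y) tt\<^bsub>Cm ?Y k\<^esub> = tt\<^bsub>A\<^esub>" using tt by simp
    show "restrict h (Pow ?Y) ff\<^bsub>Cm ?Y k\<^esub> = ff\<^bsub>A\<^esub>" using hom by simp
  next
    fix S assume "S \<in> carrier (Cm ?Y k)"
    then have S: "S \<subseteq> ?Y" by simp
    have "?Y - S \<subseteq> ?Y" "{x \<in> ?Y. \<forall>y \<in> ?Y. k y = k x \<longrightarrow> y \<in> S} \<subseteq> ?Y" by blast+
    then show "restrict h (Pow ?Y) (neg\<^bsub>Cm ?Y k\<^esub> S) = neg\<^bsub>A\<^esub> (restrict h (Pow ?Y) S)"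
      "restrict h (Pow ?Y) (box\<^bsub>Cm ?Y k\<^esub> S) = box\<^bsub>A\<^esub> (restrict h (Pow ?Y) S)"
      using S neg[OF S] box[OF S] unfolding Cm_simps by (simp_all only: restrict_apply Pow_iff if_True)
    fix T assume "T \<in> carrier (Cm ?Y k)"
    then have T: "T \<subseteq> ?Y" by simp
    have "S \<inter> T \<subseteq> ?Y" "S \<union> T \<subseteq> ?Y" "S \<subseteq> X" "T \<subseteq> X" using S T by blast+
    then show "restrict h (Pow ?Y) (S \<curlywedge>\<^bsub>Cm ?Y k\<^esub> T) = restrict h (Pow ?Y) S \<curlywedge>\<^bsub>A\<^esub> restrict h (Pow ?Y) T"
      "restrict h (Pow ?Y) (S \<curlyvee>\<^bsub>Cm ?Y k\<^esub> T) = restrict h (Pow ?Y) S \<curlyvee>\<^bsub>A\<^esub> restrict h (Pow ?Y) T"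
      using S T hom(2,3) unfolding Cm_simps by (simp_all only: restrict_apply Pow_iff if_True)
  qed
qed

lemma extend_support_hom:
  assumes l: "l \<in> s5_hom (Cm {x \<in> X. k x \<in> K} k) A"
  shows "(\<lambda>S \<in> Pow X. l (S \<inter> {x \<in> X. k x \<in> K})) \<in> s5_hom (Cm X k) A"
proof -
  let ?Y = "{x \<in> X. k x \<in> K}"
  have "p_morphism ?Y k X k (\<lambda>x. x)" by (auto simp: p_morphism_def)
  from s5_hom_compose[OF s5_algebra_Cm preimage_hom_in_s5_hom[OF this] l]
  have "compose (Pow X) l (preimage_hom X ?Y (\<lambda>x. x)) \<in> s5_hom (Cm X k) A" by simp
  moreover have "compose (Pow X) l (preimage_hom X ?Y (\<lambda>x. x)) = (\<lambda>S \<in> Pow X. l (S \<inter> ?Y))"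
  proof (rule compose_eqI)
    fix S assume S: "S \<in> Pow X"
    then have "preimage_hom X ?Y (\<lambda>x. x) S = S \<inter> ?Y" by (auto simp: preimage_hom_def)
    then show "l (preimage_hom X ?Y (\<lambda>x. x) S) = (\<lambda>S \<in> Pow X. l (S \<inter> ?Y)) S" using S by simp
  qed simp
  ultimately show ?thesis by simp
qed

lemma cone_functor:
  assumes E: "is_functor J C E" and F: "is_functor C D F" and cone: "cone J C E L p"
  shows "cone J D (comp_functor F E) (FObj F L) (\<lambda>j. FArr F L (FObj E j) (p j))"
proof -
  have L: "L \<in> Obj C" and p: "\<And>j. j \<in> Obj J \<Longrightarrow> p j \<in> Hom C L (FObj E j)"
    and c: "\<And>i j u. \<lbrakk>i \<in> Obj J; j \<in> Obj J; u \<in> Hom J i j\<rbrakk>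
      \<Longrightarrow> Comp C L (FObj E i) (FObj E j) (FArr E i j u) (p i) = p j"
    using cone by (simp_all add: cone_def)
  show ?thesis
    unfolding cone_def
  proof (intro conjI ballI)
    show "FObj F L \<in> Obj D" by (rule functor_obj[OF F L])
    show "FArr F L (FObj E j) (p j) \<in> Hom D (FObj F L) (FObj (comp_functor F E) j)" if "j \<in> Obj J" for j
      using functor_arr[OF F L functor_obj[OF E that] p[OF that]] by (simp add: comp_functor_def)
    show "Comp D (FObj F L) (FObj (comp_functor F E) i) (FObj (comp_functor F E) j)
        (FArr (comp_functor F E) i j u) (FArr F L (FObj E i) (p i)) = FArr F L (FObj E j) (p j)"
      if "i \<in> Obj J" "j \<in> Obj J" "u \<in> Hom J i j" for i j u
      using functor_comp[OF F L functor_obj[OF E that(1)] functor_obj[OF E that(2)] p[OF that(1)]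
          functor_arr[OF E that]] c[OF that]
      by (simp add: comp_functor_def)
  qed
qed

text \<open>
  The functor of finite-support homomorphisms, with its values moved into the universe along the
  codings \<open>\<iota> A\<close>.
\<close>

definition frame_functor ::
  "'x set \<Rightarrow> ('x \<Rightarrow> 'k) \<Rightarrow> (nat s5_alg \<Rightarrow> ('x set \<Rightarrow> nat) \<Rightarrow> 'u) \<Rightarrow>
    (nat s5_alg, nat \<Rightarrow> nat, 'u set, 'u \<Rightarrow> 'u) cfunctor" where
  "frame_functor X k \<iota> = \<lparr>FObj = (\<lambda>A. \<iota> A ` finite_support_homs X k A),
     FArr = (\<lambda>A B f. \<lambda>z \<in> \<iota> A ` finite_support_homs X k A.
       \<iota> B (compose (Pow X) f (inv_into (finite_support_homs X k A) (\<iota> A) z)))\<rparr>"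

lemma FObj_frame_functor: "FObj (frame_functor X k \<iota>) A = \<iota> A ` finite_support_homs X k A"
  by (simp add: frame_functor_def)

lemma FArr_frame_functor:
  assumes "inj_on (\<iota> A) (finite_support_homs X k A)" "h \<in> finite_support_homs X k A"
  shows "FArr (frame_functor X k \<iota>) A B f (\<iota> A h) = \<iota> B (compose (Pow X) f h)"
  using assms by (simp add: frame_functor_def)

lemma is_functor_frame_functor:
  assumes inj: "\<And>A. A \<in> Obj S5Alg_fin \<Longrightarrow> inj_on (\<iota> A) (finite_support_homs X k A)"
  shows "is_functor S5Alg_fin SET (frame_functor X k \<iota>)"
proof -
  let ?F = "frame_functor X k \<iota>" and ?H = "finite_support_homs X k"
  have app: "FArr ?F A B f (\<iota> A h) = \<iota> B (compose (Pow X) f h)"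
    if "A \<in> Obj S5Alg_fin" "h \<in> ?H A" for A B f h
    using FArr_frame_functor[where \<iota> = \<iota> and A = A] inj that by blast
  have ext: "h \<in> extensional (Pow X)" "\<And>S. S \<in> Pow X \<Longrightarrow> h S \<in> carrier A" if "h \<in> ?H A" for h and A :: "nat s5_alg"
    using that s5_hom_extensional[of h "Cm X k" A] s5_hom_closed[of h "Cm X k" A]
    by (simp_all add: finite_support_homs_def)
  have cl: "FArr ?F A B f z \<in> FObj ?F B"
    if A: "A \<in> Obj S5Alg_fin" and f: "f \<in> s5_hom A B" and z: "z \<in> FObj ?F A" for A B f z
  proof -
    obtain h where h: "h \<in> ?H A" "z = \<iota> A h" using z unfolding FObj_frame_functor by blast
    then show ?thesis
      using app[OF A h(1)] finite_support_homs_compose[OF h(1) f] unfolding FObj_frame_functor by simp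
  qed
  have e: "FArr ?F A B f \<in> extensional (FObj ?F A)" for A B f by (simp add: frame_functor_def)
  show ?thesis
    unfolding is_functor_def
  proof (intro conjI ballI)
    fix A assume A: "A \<in> Obj S5Alg_fin"
    show "FObj ?F A \<in> Obj SET" by simp
    show "FArr ?F A A (Id S5Alg_fin A) = Id SET (FObj ?F A)"
    proof (rule extensionalityI[OF e])
      show "Id SET (FObj ?F A) \<in> extensional (FObj ?F A)" by simp
      fix z assume z: "z \<in> FObj ?F A"
      then obtain h where h: "h \<in> ?H A" "z = \<iota> A h" unfolding FObj_frame_functor by blast
      have "compose (Pow X) (\<lambda>a \<in> carrier A. a) h = h"
        by (rule compose_eqI) (use ext[OF h(1)] in auto)
      then show "FArr ?F A A (Id S5Alg_fin A) z = Id SET (FObj ?F A) z" using app[OF A h(1)] h(2) z by simp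
    qed
  next
    fix A B f assume A: "A \<in> Obj S5Alg_fin" and B: "B \<in> Obj S5Alg_fin" and f: "f \<in> Hom S5Alg_fin A B"
    then show "FArr ?F A B f \<in> Hom SET (FObj ?F A) (FObj ?F B)" using cl[OF A] e by (simp add: PiE_iff)
  next
    fix A B C f g assume A: "A \<in> Obj S5Alg_fin" and B: "B \<in> Obj S5Alg_fin" and C: "C \<in> Obj S5Alg_fin"
      and f: "f \<in> Hom S5Alg_fin A B" and g: "g \<in> Hom S5Alg_fin B C"
    show "FArr ?F A C (Comp S5Alg_fin A B C g f) =
        Comp SET (FObj ?F A) (FObj ?F B) (FObj ?F C) (FArr ?F B C g) (FArr ?F A B f)"
    proof (rule extensionalityI[OF e])
      show "Comp SET (FObj ?F A) (FObj ?F B) (FObj ?F C) (FArr ?F B C g) (FArr ?F A B f)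
          \<in> extensional (FObj ?F A)" by simp
      fix z assume z: "z \<in> FObj ?F A"
      then obtain h where h: "h \<in> ?H A" "z = \<iota> A h" unfolding FObj_frame_functor by blast
      have fh: "compose (Pow X) f h \<in> ?H B" using finite_support_homs_compose[OF h(1)] f by simp
      have "compose (Pow X) (compose (carrier A) g f) h = compose (Pow X) g (compose (Pow X) f h)"
        by (rule compose_eqI) (use ext[OF h(1)] in \<open>auto simp: compose_def\<close>)
      then show "FArr ?F A C (Comp S5Alg_fin A B C g f) z =
          Comp SET (FObj ?F A) (FObj ?F B) (FObj ?F C) (FArr ?F B C g) (FArr ?F A B f) z"
        using app[OF A h(1)] app[OF B fh] h(2) z by (simp add: compose_def[of "FObj ?F A"])
    qed
  qed
qed

text \<open>
  The functor is a filtered colimit of representables: on a finite union \<open>?Y K\<close> of clusters,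
  finite-support homomorphisms to \<open>A\<close> are homomorphisms from the finite algebra \<open>Cm (?Y K) k\<close> to \<open>A\<close>.
  A matching family over a finite diagram has a common support of this kind, and there the
  universal property of the given limit applies.
\<close>

lemma frame_functor_in_Lex:
  assumes inj: "\<And>A. A \<in> Obj S5Alg_fin \<Longrightarrow> inj_on (\<iota> A) (finite_support_homs X k A)"
    and fib: "\<And>c. finite {x \<in> X. k x = c}"
  shows "frame_functor X k \<iota> \<in> Obj (Lex S5Alg_fin SET)"
proof -
  let ?F = "frame_functor X k \<iota>" and ?H = "finite_support_homs X k" and ?Y = "\<lambda>K. {x \<in> X. k x \<in> K}"
  have app: "FArr ?F A B f (\<iota> A h) = \<iota> B (compose (Pow X) f h)"
    if "A \<in> Obj S5Alg_fin" "h \<in> ?H A" for A B f h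
    using FArr_frame_functor[where \<iota> = \<iota> and A = A] inj that by blast
  have Ff: "is_functor S5Alg_fin SET ?F" by (rule is_functor_frame_functor[OF inj])
  have finY: "finite (?Y K)" if "finite K" for K
  proof -
    have "?Y K = (\<Union>c \<in> K. {x \<in> X. k x = c})" by blast
    then show ?thesis using that fib by simp
  qed
  have "preserves_finite_limits S5Alg_fin SET ?F"
    unfolding preserves_finite_limits_def
  proof (intro allI impI)
    fix J :: "(nat, nat) precategory" and E L p
    assume "finite_category J \<and> is_functor J S5Alg_fin E \<and> limit_cone J S5Alg_fin E L p"
    then have E: "is_functor J S5Alg_fin E" and lim: "limit_cone J S5Alg_fin E L p" and fJ: "finite (Obj J)"
      by (simp_all add: finite_category_def)
    have cone: "cone J S5Alg_fin E L p" using lim by (simp add: limit_cone_def)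
    have LO: "L \<in> Obj S5Alg_fin" and p: "\<And>j. j \<in> Obj J \<Longrightarrow> p j \<in> s5_hom L (FObj E j)"
      using cone by (simp_all add: cone_def)
    have LA: "s5_algebra L" using LO by simp
    have EO: "FObj E j \<in> Obj S5Alg_fin" and EA: "s5_algebra (FObj E j)" if "j \<in> Obj J" for j
      using functor_obj[OF E that] by simp_all
    have Ea: "FArr E i j u \<in> s5_hom (FObj E i) (FObj E j)"
      if "i \<in> Obj J" "j \<in> Obj J" "u \<in> Hom J i j" for i j u using functor_arr[OF E that] by simp
    have hom: "h \<in> s5_hom (Cm X k) A" if "h \<in> ?H A" for h and A :: "nat s5_alg"
      using that by (simp add: finite_support_homs_def)
    have univ: "\<exists>!l. l \<in> s5_hom (Cm (?Y K) k) L \<and> (\<forall>j \<in> Obj J. \<forall>b \<in> Pow (?Y K). p j (l b) = q j b)"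
      if K: "finite K" and q: "\<And>j. j \<in> Obj J \<Longrightarrow> q j \<in> s5_hom (Cm (?Y K) k) (FObj E j)"
        and "\<And>i j u b. \<lbrakk>i \<in> Obj J; j \<in> Obj J; u \<in> Hom J i j; b \<in> Pow (?Y K)\<rbrakk> \<Longrightarrow> FArr E i j u (q i b) = q j b"
      for K q
      using limit_cone_S5_universal[OF lim s5_algebra_Cm, of "?Y K" k q] finY[OF K] q that(3) E by simp
    \<comment> \<open>two elements of \<open>FObj ?F L\<close> live on a common finite union of clusters\<close>
    have uniq: "g = g'"
      if g: "g \<in> ?H L" "g' \<in> ?H L" and eq: "\<And>j. j \<in> Obj J \<Longrightarrow> compose (Pow X) (p j) g = compose (Pow X) (p j) g'" for g g'
    proof -
      obtain K1 K2 where K1: "finite K1" "g (?Y K1) = tt\<^bsub>L\<^esub>" and K2: "finite K2" "g' (?Y K2) = tt\<^bsub>L\<^esub>"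
        using g unfolding finite_support_homs_def by blast
      define K where "K = K1 \<union> K2"
      have fK: "finite K" using K1 K2 by (simp add: K_def)
      have YX: "?Y K \<subseteq> X" and Y12: "?Y K1 \<subseteq> ?Y K" "?Y K2 \<subseteq> ?Y K" by (auto simp: K_def)
      have tt: "g (?Y K) = tt\<^bsub>L\<^esub>" "g' (?Y K) = tt\<^bsub>L\<^esub>"
        by (rule support_mono[OF LA hom[OF g(1)] Y12(1) YX K1(2)], rule support_mono[OF LA hom[OF g(2)] Y12(2) YX K2(2)])
      let ?l = "restrict g (Pow (?Y K))" and ?l' = "restrict g' (Pow (?Y K))"
      have l: "?l \<in> s5_hom (Cm (?Y K) k) L" "?l' \<in> s5_hom (Cm (?Y K) k) L"
        by (rule restrict_support_hom[OF LA hom[OF g(1)] tt(1)], rule restrict_support_hom[OF LA hom[OF g(2)] tt(2)])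
      have pg: "p j (g S) = p j (g' S)" if "j \<in> Obj J" "S \<in> Pow X" for j S
        using compose_eqD[OF eq[OF that(1)] that(2)] that(2) by (simp add: compose_def)
      define q where "q j = compose (Pow (?Y K)) (p j) ?l" for j
      have "\<exists>!l. l \<in> s5_hom (Cm (?Y K) k) L \<and> (\<forall>j \<in> Obj J. \<forall>b \<in> Pow (?Y K). p j (l b) = q j b)"
      proof (rule univ[OF fK])
        show "q j \<in> s5_hom (Cm (?Y K) k) (FObj E j)" if "j \<in> Obj J" for j
          unfolding q_def using s5_hom_compose[OF s5_algebra_Cm l(1) p[OF that]] by simp
        show "FArr E i j u (q i b) = q j b" if "i \<in> Obj J" "j \<in> Obj J" "u \<in> Hom J i j" "b \<in> Pow (?Y K)" for i j u b
        proof -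
          have "?l b \<in> carrier L" using s5_hom_closed[OF l(1)] that(4) by simp
          then show ?thesis using cone_S5_apply[OF cone that(1-3)] that(4) unfolding q_def compose_def by simp
        qed
      qed
      moreover have "\<forall>j \<in> Obj J. \<forall>b \<in> Pow (?Y K). p j (?l b) = q j b" by (simp add: q_def compose_def)
      moreover have "\<forall>j \<in> Obj J. \<forall>b \<in> Pow (?Y K). p j (?l' b) = q j b"
      proof (intro ballI)
        fix j b assume j: "j \<in> Obj J" and b: "b \<in> Pow (?Y K)"
        then have "b \<in> Pow X" by blast
        then show "p j (?l' b) = q j b" using pg[OF j] b by (simp add: q_def compose_def)
      qed
      ultimately have ll: "?l = ?l'" using l by blast
      have "g S = g' S" if S: "S \<in> carrier (Cm X k)" for S
      proof -
        have "S \<inter> ?Y K \<in> Pow (?Y K)" by blast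
        then have "g (S \<inter> ?Y K) = g' (S \<inter> ?Y K)" using fun_cong[OF ll, of "S \<inter> ?Y K"] by simp
        then show ?thesis
          using support_absorb[OF LA hom[OF g(1)] YX tt(1)] support_absorb[OF LA hom[OF g(2)] YX tt(2)] S by simp
      qed
      then show "g = g'" by (rule s5_hom_eqI[OF hom[OF g(1)] hom[OF g(2)]])
    qed
    have elts: "\<exists>!z. z \<in> FObj ?F L \<and> (\<forall>j \<in> Obj J. FArr ?F L (FObj E j) (p j) z = x j)"
      if x: "x \<in> matching J (FObj (comp_functor ?F E)) (FArr (comp_functor ?F E))" for x
    proof -
      have "\<exists>h. h \<in> ?H (FObj E j) \<and> x j = \<iota> (FObj E j) h" if "j \<in> Obj J" for j
        using x that by (auto simp: matching_def comp_functor_def FObj_frame_functor)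
      then obtain h where h: "\<And>j. j \<in> Obj J \<Longrightarrow> h j \<in> ?H (FObj E j)"
        and xh: "\<And>j. j \<in> Obj J \<Longrightarrow> x j = \<iota> (FObj E j) (h j)" by metis
      have hm: "compose (Pow X) (FArr E i j u) (h i) = h j"
        if "i \<in> Obj J" "j \<in> Obj J" "u \<in> Hom J i j" for i j u
      proof -
        have "FArr ?F (FObj E i) (FObj E j) (FArr E i j u) (x i) = x j"
          using x that by (simp add: matching_def comp_functor_def)
        then have "\<iota> (FObj E j) (compose (Pow X) (FArr E i j u) (h i)) = \<iota> (FObj E j) (h j)"
          using app[OF EO[OF that(1)] h[OF that(1)]] xh[OF that(1)] xh[OF that(2)] by simp
        then show ?thesis
          using inj_onD[OF inj[OF EO[OF that(2)]]] finite_support_homs_compose[OF h[OF that(1)] Ea[OF that]] h[OF that(2)] by blast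
      qed
      have "\<exists>K. finite K \<and> h j (?Y K) = tt\<^bsub>FObj E j\<^esub>" if "j \<in> Obj J" for j
        using h[OF that] by (simp add: finite_support_homs_def)
      then obtain K' where K': "\<And>j. j \<in> Obj J \<Longrightarrow> finite (K' j)"
        "\<And>j. j \<in> Obj J \<Longrightarrow> h j (?Y (K' j)) = tt\<^bsub>FObj E j\<^esub>" by metis
      define K where "K = (\<Union>j \<in> Obj J. K' j)"
      have fK: "finite K" using fJ K'(1) by (simp add: K_def)
      have YX: "?Y K \<subseteq> X" by blast
      have tt: "h j (?Y K) = tt\<^bsub>FObj E j\<^esub>" if "j \<in> Obj J" for j
        by (rule support_mono[OF EA[OF that] hom[OF h[OF that]] _ YX K'(2)[OF that]]) (use that in \<open>auto simp: K_def\<close>)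
      define q where "q j = restrict (h j) (Pow (?Y K))" for j
      have "\<exists>!l. l \<in> s5_hom (Cm (?Y K) k) L \<and> (\<forall>j \<in> Obj J. \<forall>b \<in> Pow (?Y K). p j (l b) = q j b)"
      proof (rule univ[OF fK])
        show "q j \<in> s5_hom (Cm (?Y K) k) (FObj E j)" if "j \<in> Obj J" for j
          unfolding q_def by (rule restrict_support_hom[OF EA[OF that] hom[OF h[OF that]] tt[OF that]])
        show "FArr E i j u (q i b) = q j b" if "i \<in> Obj J" "j \<in> Obj J" "u \<in> Hom J i j" "b \<in> Pow (?Y K)" for i j u b
        proof -
          have "b \<in> Pow X" using that(4) by blast
          from compose_eqD[OF hm[OF that(1-3)] this] show ?thesis using that(4) by (simp add: q_def)
        qed
      qed
      then obtain l where l: "l \<in> s5_hom (Cm (?Y K) k) L"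
        and pl: "\<And>j b. \<lbrakk>j \<in> Obj J; b \<in> Pow (?Y K)\<rbrakk> \<Longrightarrow> p j (l b) = q j b" unfolding Ex1_def by blast
      define g where "g = (\<lambda>S \<in> Pow X. l (S \<inter> ?Y K))"
      have "g (?Y K) = tt\<^bsub>L\<^esub>"
      proof -
        have "g (?Y K) = l (?Y K)" using YX by (simp add: g_def)
        also have "\<dots> = tt\<^bsub>L\<^esub>" using l by (simp add: s5_hom_def)
        finally show ?thesis .
      qed
      then have gH: "g \<in> ?H L"
        using extend_support_hom[OF l] fK unfolding finite_support_homs_def g_def by blast
      have pg: "compose (Pow X) (p j) g = h j" if j: "j \<in> Obj J" for j
      proof (rule compose_eqI)
        show "h j \<in> extensional (Pow X)" using s5_hom_extensional[OF hom[OF h[OF j]]] by simp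
        fix S assume S: "S \<in> Pow X"
        have "S \<inter> ?Y K \<in> Pow (?Y K)" by blast
        then have "p j (g S) = h j (S \<inter> ?Y K)" using pl[OF j] S by (simp add: g_def q_def)
        then show "p j (g S) = h j S"
          using support_absorb[OF EA[OF j] hom[OF h[OF j]] YX tt[OF j]] S by simp
      qed
      show ?thesis
      proof (rule ex1I[of _ "\<iota> L g"])
        show "\<iota> L g \<in> FObj ?F L \<and> (\<forall>j \<in> Obj J. FArr ?F L (FObj E j) (p j) (\<iota> L g) = x j)"
          using gH app[OF LO gH] pg xh by (simp add: FObj_frame_functor)
        fix z assume z: "z \<in> FObj ?F L \<and> (\<forall>j \<in> Obj J. FArr ?F L (FObj E j) (p j) z = x j)"
        then obtain g' where g': "g' \<in> ?H L" "z = \<iota> L g'" unfolding FObj_frame_functor by blast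
        have "compose (Pow X) (p j) g' = h j" if j: "j \<in> Obj J" for j
        proof -
          have "\<iota> (FObj E j) (compose (Pow X) (p j) g') = \<iota> (FObj E j) (h j)"
            using z g' app[OF LO g'(1)] xh[OF j] j by simp
          then show ?thesis
            using inj_onD[OF inj[OF EO[OF j]]] finite_support_homs_compose[OF g'(1) p[OF j]] h[OF j] by blast
        qed
        then have "g' = g" by (intro uniq[OF g'(1) gH]) (simp add: pg)
        then show "z = \<iota> L g" using g' by simp
      qed
    qed
    show "limit_cone J SET (comp_functor ?F E) (FObj ?F L) (\<lambda>j. FArr ?F L (FObj E j) (p j))"
      unfolding limit_cone_SET_iff[OF functor_comp_functor[OF E Ff]]
      using cone_functor[OF E Ff cone] elts by blast
  qed
  then show ?thesis using Ff by (simp add: Lex_def)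
qed

subsection \<open>Fitting the values into the universe\<close>

lemma infinite_pair_coding:
  assumes "infinite (UNIV :: 'u set)"
  obtains p :: "'u \<Rightarrow> 'u \<Rightarrow> 'u" where "\<And>a b c d. p a b = p c d \<Longrightarrow> a = c \<and> b = d"
proof -
  have "\<exists>f. bij_betw f ((UNIV :: 'u set) \<times> (UNIV :: 'u set)) (UNIV :: 'u set)"
    unfolding card_of_ordIso by (rule card_of_Times_same_infinite[OF assms])
  then obtain f :: "'u \<times> 'u \<Rightarrow> 'u" where f: "inj f" by (auto simp: bij_betw_def)
  show thesis
  proof (rule that[of "\<lambda>a b. f (a, b)"])
    show "a = c \<and> b = d" if "f (a, b) = f (c, d)" for a b c d using injD[OF f that] by simp
  qed
qed

lemma finite_support_hom_dual_map:
  assumes h: "h \<in> finite_support_homs X k A" and fib: "\<And>c. finite {x \<in> X. k x = c}"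
    and r: "r \<in> s5_hom A (Cm Z l)"
  obtains t where "p_morphism Z l X k t" "\<And>S. S \<subseteq> X \<Longrightarrow> r (h S) = {z \<in> Z. t z \<in> S}"
proof -
  obtain K where K: "finite K" "h {x \<in> X. k x \<in> K} = tt\<^bsub>A\<^esub>" and hh: "h \<in> s5_hom (Cm X k) A"
    using h by (auto simp: finite_support_homs_def)
  have rh: "compose (Pow X) r h \<in> s5_hom (Cm X k) (Cm Z l)" using s5_hom_compose[OF s5_algebra_Cm hh r] by simp
  have "{x \<in> X. k x \<in> K} = (\<Union>c \<in> K. {x \<in> X. k x = c})" by blast
  then have fin: "finite {x \<in> X. k x \<in> K}" using K(1) fib by simp
  have sub: "{x \<in> X. k x \<in> K} \<subseteq> X" by blast
  have Z: "compose (Pow X) r h {x \<in> X. k x \<in> K} = Z" using K(2) r sub by (simp add: compose_def s5_hom_def)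
  obtain t where t: "p_morphism Z l X k t" "compose (Pow X) r h = preimage_hom X Z t"
    by (rule finite_support_hom_is_preimage[OF rh fin sub Z], rule that)
  have "r (h S) = {z \<in> Z. t z \<in> S}" if "S \<subseteq> X" for S
    using compose_eqD[OF t(2), of S] that by (simp add: preimage_hom_apply)
  with t(1) show thesis by (rule that)
qed

text \<open>
  By duality a finite-support homomorphism amounts to a map from the finite set of atoms of \<open>A\<close>
  to \<open>X\<close>, that is, to a list of fixed length over \<open>X\<close>.
\<close>

lemma finite_support_homs_coding:
  fixes e :: "'x \<Rightarrow> 'u" and A :: "'a s5_alg"
  assumes inf: "infinite (UNIV :: 'u set)" and e: "inj_on e X" and A: "s5_algebra A" "finite (carrier A)"
    and fib: "\<And>c. finite {x \<in> X. k x = c}"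
  shows "\<exists>\<iota> :: ('x set \<Rightarrow> 'a) \<Rightarrow> 'u. inj_on \<iota> (finite_support_homs X k A)"
proof -
  obtain p :: "'u \<Rightarrow> 'u \<Rightarrow> 'u" where p: "\<And>a b c d. p a b = p c d \<Longrightarrow> a = c \<and> b = d"
    by (rule infinite_pair_coding[OF inf], rule that)
  define cd where "cd xs = foldr p xs undefined" for xs
  have cd: "xs = ys" if "length xs = length ys" "cd xs = cd ys" for xs ys
    using that
  proof (induction xs ys rule: list_induct2)
    case (Cons x xs y ys)
    then have "p x (cd xs) = p y (cd ys)" by (simp add: cd_def)
    then show ?case using p Cons.IH by blast
  qed simp
  obtain Z :: "'a set" and l :: "'a \<Rightarrow> 'a" and r d where fZ: "finite Z" and r: "r \<in> s5_hom A (Cm Z l)"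
    and d: "d \<in> s5_hom (Cm Z l) A" and dr: "\<And>a. a \<in> carrier A \<Longrightarrow> d (r a) = a"
    and rd: "\<And>S. S \<subseteq> Z \<Longrightarrow> r (d S) = S"
    by (rule finite_s5_algebra_is_complex[OF A], rule that)
  obtain zs where zs: "set zs = Z" using finite_list[OF fZ] by blast
  have "\<exists>t. p_morphism Z l X k t \<and> (\<forall>S \<subseteq> X. r (h S) = {z \<in> Z. t z \<in> S})"
    if "h \<in> finite_support_homs X k A" for h
    by (rule finite_support_hom_dual_map[OF that fib r]) blast
  then obtain t where t: "\<And>h. h \<in> finite_support_homs X k A \<Longrightarrow> p_morphism Z l X k (t h)"
    and rt: "\<And>h S. \<lbrakk>h \<in> finite_support_homs X k A; S \<subseteq> X\<rbrakk> \<Longrightarrow> r (h S) = {z \<in> Z. t h z \<in> S}" by metis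
  have "inj_on (\<lambda>h. cd (map (e \<circ> t h) zs)) (finite_support_homs X k A)"
  proof (rule inj_onI)
    fix h h' assume h: "h \<in> finite_support_homs X k A" and h': "h' \<in> finite_support_homs X k A"
      and "cd (map (e \<circ> t h) zs) = cd (map (e \<circ> t h') zs)"
    then have "map (e \<circ> t h) zs = map (e \<circ> t h') zs" by (intro cd) simp_all
    then have "e (t h z) = e (t h' z)" if "z \<in> Z" for z using that zs by auto
    moreover have "t h z \<in> X" "t h' z \<in> X" if "z \<in> Z" for z using t[OF h] t[OF h'] that by (auto simp: p_morphism_def)
    ultimately have tt: "t h z = t h' z" if "z \<in> Z" for z using inj_onD[OF e] that by blast
    have hh: "h \<in> s5_hom (Cm X k) A" "h' \<in> s5_hom (Cm X k) A" using h h' by (simp_all add: finite_support_homs_def)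
    show "h = h'"
    proof (rule s5_hom_eqI[OF hh])
      fix S assume S: "S \<in> carrier (Cm X k)"
      then have "{z \<in> Z. t h z \<in> S} = {z \<in> Z. t h' z \<in> S}" using tt by auto
      then have "r (h S) = r (h' S)" using rt[OF h] rt[OF h'] S by simp
      moreover have "h S \<in> carrier A" "h' S \<in> carrier A" using s5_hom_closed[OF hh(1) S] s5_hom_closed[OF hh(2) S] .
      ultimately show "h S = h' S" using dr by metis
    qed
  qed
  then show ?thesis by blast
qed

section \<open>Every model is a restriction\<close>

text \<open>
  The orbit of \<open>y\<close> under the permutations, confined to elements with trivial stabilizer since these
  are the ones that axiom (6) is about.  Every such orbit contributes one generator.
\<close>

definition orbit :: "'u struct \<Rightarrow> nat \<Rightarrow> 'u \<Rightarrow> 'u set" where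
  "orbit M m y = {y' \<in> Sort M m. Fix_trivial M m y' \<and> (\<exists>\<sigma> \<in> Bij {1..m}. Op M m m \<sigma> y = y')}"

definition orbit_rep :: "'u struct \<Rightarrow> nat \<Rightarrow> 'u \<Rightarrow> 'u" where
  "orbit_rep M m y = (SOME y'. y' \<in> orbit M m y)"

definition generators :: "'u struct \<Rightarrow> (nat \<times> 'u) set" where
  "generators M = {(m, r). 1 \<le> m \<and> (\<exists>y \<in> Sort M m. Fix_trivial M m y \<and> r = orbit_rep M m y)}"

context
  fixes M :: "'u struct"
  assumes M: "model_T2 M"
begin

lemma model_id: "\<lbrakk>1 \<le> n; x \<in> Sort M n\<rbrakk> \<Longrightarrow> Op M n n (\<lambda>i \<in> {1..n}. i) x = x"
  using M by (simp add: model_T2_def axiom1_def)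

lemma model_compose:
  "\<lbrakk>1 \<le> r; f \<in> Surj r m; g \<in> Surj m n; x \<in> Sort M n\<rbrakk>
    \<Longrightarrow> Op M r m f (Op M m n g x) = Op M r n (compose {1..r} g f) x"
  using M Surj_pos[of f r m] Surj_pos[of g m n] unfolding model_T2_def axiom1_def by blast

lemma model_closed: "\<lbrakk>1 \<le> m; f \<in> Surj m n; x \<in> Sort M n\<rbrakk> \<Longrightarrow> Op M m n f x \<in> Sort M m"
  using M Surj_pos[of f m n] Op_in by (metis model_T2_def)

lemma model_axiom6:
  assumes "1 \<le> n" "q1 \<in> Surj n m" "q2 \<in> Surj n m" "x1 \<in> Sort M m" "x2 \<in> Sort M m"
    "Fix_trivial M m x1" "Fix_trivial M m x2" "Op M n m q1 x1 = Op M n m q2 x2"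
  obtains \<sigma> where "\<sigma> \<in> Bij {1..m}" "compose {1..n} \<sigma> q2 = q1" "Op M m m \<sigma> x1 = x2"
proof -
  have "axiom6 M" using M by (simp add: model_T2_def)
  then have "\<exists>\<sigma> \<in> Bij {1..m}. compose {1..n} \<sigma> q2 = q1 \<and> Op M m m \<sigma> x1 = x2"
    using assms Surj_pos[OF assms(2,1)] unfolding axiom6_def by blast
  then show thesis using that by blast
qed

lemma model_axiom5:
  "\<lbrakk>1 \<le> n; x \<in> Sort M n\<rbrakk> \<Longrightarrow> \<exists>!m. 1 \<le> m \<and> m \<le> n \<and>
    (\<exists>f \<in> Surj n m. \<exists>y \<in> Sort M m. Op M n m f y = x \<and> Fix_trivial M m y)"
  using M unfolding model_T2_def axiom5_def by blast

lemma orbit_self: "\<lbrakk>1 \<le> m; y \<in> Sort M m; Fix_trivial M m y\<rbrakk> \<Longrightarrow> y \<in> orbit M m y"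
  using model_id Surj_Bij[OF Surj_id] unfolding orbit_def by blast

text \<open>
  Axiom (6) for \<open>1(y') = \<sigma>(y)\<close> provides the inverse permutation.
\<close>

lemma orbit_sym:
  assumes m: "1 \<le> m" and y: "y \<in> Sort M m" "Fix_trivial M m y" and y': "y' \<in> orbit M m y"
  shows "y \<in> orbit M m y'"
proof -
  obtain \<sigma> where \<sigma>: "\<sigma> \<in> Bij {1..m}" "Op M m m \<sigma> y = y'" and s: "y' \<in> Sort M m" "Fix_trivial M m y'"
    using y' unfolding orbit_def by blast
  have eq: "Op M m m (\<lambda>i \<in> {1..m}. i) y' = Op M m m \<sigma> y" using model_id[OF m s(1)] \<sigma> by simp
  obtain \<tau> where "\<tau> \<in> Bij {1..m}" "Op M m m \<tau> y' = y"
    by (rule model_axiom6[OF m Surj_id Bij_Surj[OF \<sigma>(1)] s(1) y(1) s(2) y(2) eq], rule that)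
  then show ?thesis using y unfolding orbit_def by blast
qed

lemma orbit_trans:
  assumes m: "1 \<le> m" and y: "y \<in> Sort M m" and y': "y' \<in> orbit M m y" and z: "z \<in> orbit M m y'"
  shows "z \<in> orbit M m y"
proof -
  obtain \<sigma> \<tau> where \<sigma>: "\<sigma> \<in> Bij {1..m}" "Op M m m \<sigma> y = y'" and \<tau>: "\<tau> \<in> Bij {1..m}" "Op M m m \<tau> y' = z"
    using y' z unfolding orbit_def by blast
  have "Op M m m (compose {1..m} \<sigma> \<tau>) y = z"
    using model_compose[OF m Bij_Surj[OF \<tau>(1)] Bij_Surj[OF \<sigma>(1)] y] \<sigma> \<tau> by simp
  moreover have "compose {1..m} \<sigma> \<tau> \<in> Bij {1..m}"
    by (rule Surj_Bij[OF Surj_compose[OF Bij_Surj[OF \<tau>(1)] Bij_Surj[OF \<sigma>(1)]]])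
  ultimately show ?thesis using z unfolding orbit_def by blast
qed

lemma orbit_eq:
  assumes "1 \<le> m" "y \<in> Sort M m" "Fix_trivial M m y" "y' \<in> orbit M m y"
  shows "orbit M m y' = orbit M m y"
proof -
  have "y' \<in> Sort M m" using assms(4) by (simp add: orbit_def)
  then show ?thesis using assms orbit_sym orbit_trans by blast
qed

lemma orbit_rep_in: "\<lbrakk>1 \<le> m; y \<in> Sort M m; Fix_trivial M m y\<rbrakk> \<Longrightarrow> orbit_rep M m y \<in> orbit M m y"
  unfolding orbit_rep_def using orbit_self by (rule someI)

lemma generatorD:
  assumes "(m, r) \<in> generators M"
  shows "1 \<le> m" "r \<in> Sort M m" "Fix_trivial M m r" "orbit_rep M m r = r"
proof -
  obtain y where m: "1 \<le> m" and y: "y \<in> Sort M m" "Fix_trivial M m y" and r: "r = orbit_rep M m y"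
    using assms unfolding generators_def by blast
  have ro: "r \<in> orbit M m y" using orbit_rep_in[OF m y] r by simp
  show "1 \<le> m" by (rule m)
  show "r \<in> Sort M m" "Fix_trivial M m r" using ro by (simp_all add: orbit_def)
  show "orbit_rep M m r = r" using orbit_eq[OF m y ro] r by (simp add: orbit_rep_def)
qed

text \<open>
  The next two facts say that \<open>M\<close> is the coproduct of representables, one for each generator: every
  element is \<open>q(r)\<close> for exactly one generator \<open>r\<close> and one surjection \<open>q\<close>.
\<close>

lemma generators_cover:
  assumes n: "1 \<le> n" and x: "x \<in> Sort M n"
  obtains m r q where "(m, r) \<in> generators M" "q \<in> Surj n m" "Op M n m q r = x"
proof -
  obtain m f y where m: "1 \<le> m" and f: "f \<in> Surj n m" and y: "y \<in> Sort M m" "Fix_trivial M m y"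
    and fx: "Op M n m f y = x"
    using ex1_implies_ex[OF model_axiom5[OF n x]] by blast
  let ?r = "orbit_rep M m y"
  have g: "(m, ?r) \<in> generators M" using m y unfolding generators_def by blast
  have "y \<in> orbit M m ?r" by (rule orbit_sym[OF m y orbit_rep_in[OF m y]])
  then obtain \<sigma> where \<sigma>: "\<sigma> \<in> Bij {1..m}" "Op M m m \<sigma> ?r = y" unfolding orbit_def by blast
  have "Op M n m (compose {1..n} \<sigma> f) ?r = x"
    using model_compose[OF n f Bij_Surj[OF \<sigma>(1)] generatorD(2)[OF g]] \<sigma> fx by simp
  then show thesis using that[OF g Surj_compose[OF f Bij_Surj[OF \<sigma>(1)]]] by blast
qed

lemma generators_free:
  assumes n: "1 \<le> n" and g: "(m, r) \<in> generators M" "(m', r') \<in> generators M"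
    and q: "q \<in> Surj n m" "q' \<in> Surj n m'" and eq: "Op M n m q r = Op M n m' q' r'"
  shows "m = m' \<and> r = r' \<and> q = q'"
proof -
  note r = generatorD[OF g(1)] and r' = generatorD[OF g(2)]
  define x where "x = Op M n m q r"
  have "\<exists>!m. 1 \<le> m \<and> m \<le> n \<and>
      (\<exists>f \<in> Surj n m. \<exists>y \<in> Sort M m. Op M n m f y = x \<and> Fix_trivial M m y)"
    unfolding x_def by (rule model_axiom5[OF n model_closed[OF n q(1) r(2)]])
  moreover have "1 \<le> m \<and> m \<le> n \<and>
      (\<exists>f \<in> Surj n m. \<exists>y \<in> Sort M m. Op M n m f y = x \<and> Fix_trivial M m y)"
    using r q(1) Surj_le[OF q(1)] x_def by blast
  moreover have "1 \<le> m' \<and> m' \<le> n \<and>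
      (\<exists>f \<in> Surj n m'. \<exists>y \<in> Sort M m'. Op M n m' f y = x \<and> Fix_trivial M m' y)"
    using r' q(2) Surj_le[OF q(2)] eq x_def by metis
  ultimately have mm: "m' = m" by blast
  obtain \<sigma> where \<sigma>: "\<sigma> \<in> Bij {1..m}" "compose {1..n} \<sigma> q' = q" "Op M m m \<sigma> r = r'"
    by (rule model_axiom6[OF n q(1) q(2)[unfolded mm] r(2) r'(2)[unfolded mm] r(3) r'(3)[unfolded mm] eq[unfolded mm]], rule that)
  have "r' \<in> orbit M m r" using \<sigma> r' mm unfolding orbit_def by blast
  then have "orbit M m r' = orbit M m r" by (rule orbit_eq[OF r(1-3)])
  then have rr: "r' = r" using r(4) r'(4) mm by (simp add: orbit_rep_def)
  have "\<sigma> = (\<lambda>i \<in> {1..m}. i)" using r(3) \<sigma> rr unfolding Fix_trivial_def by blast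
  moreover have "compose {1..n} (\<lambda>i \<in> {1..m}. i) q' = q'"
    by (rule compose_eqI) (use Surj_range[OF q(2)] Surj_ext[OF q(2)] mm in auto)
  ultimately show ?thesis using \<sigma>(2) mm rr by simp
qed

end

text \<open>
  Let \<open>X\<close> be the frame with a cluster of size \<open>m\<close> for each generator of sort \<open>m\<close>.  The p-morphisms from
  an \<open>n\<close>-element cluster to \<open>X\<close> are the surjections onto its clusters, and these correspond to the
  elements of \<open>M\<close> of sort \<open>n\<close>.
\<close>

theorem restriction_essentially_surjective:
  fixes M :: "'u struct"
  assumes inf: "infinite (UNIV :: 'u set)" and M: "model_T2 M"
  shows "\<exists>F \<in> Obj (Lex S5Alg_fin SET). \<exists>f. is_iso Mod_T2 (restr F) M f"
proof -
  define X where "X = {(c, i). c \<in> generators M \<and> i \<in> {1..fst c}}"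
  let ?k = "fst :: (nat \<times> 'u) \<times> nat \<Rightarrow> nat \<times> 'u"
  let ?H = "finite_support_homs X ?k"
  have fib: "finite {x \<in> X. ?k x = c}" for c
    by (rule finite_subset[of _ "{c} \<times> {1..fst c}"]) (auto simp: X_def)
  obtain p :: "'u \<Rightarrow> 'u \<Rightarrow> 'u" where p: "\<And>a b c d. p a b = p c d \<Longrightarrow> a = c \<and> b = d"
    by (rule infinite_pair_coding[OF inf], rule that)
  obtain e0 :: "nat \<Rightarrow> 'u" where e0: "inj e0" using infinite_countable_subset[OF inf] by blast
  have inj_e: "inj_on (\<lambda>((m, r), i). p (p (e0 m) r) (e0 i)) X"
  proof (rule inj_onI)
    fix x y :: "(nat \<times> 'u) \<times> nat"
    assume eq: "(\<lambda>((m, r), i). p (p (e0 m) r) (e0 i)) x = (\<lambda>((m, r), i). p (p (e0 m) r) (e0 i)) y"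
    obtain m r i m' r' i' where xy: "x = ((m, r), i)" "y = ((m', r'), i')" by (metis surj_pair)
    have "p (p (e0 m) r) (e0 i) = p (p (e0 m') r') (e0 i')" using eq unfolding xy by simp
    then have 1: "p (e0 m) r = p (e0 m') r'" and "e0 i = e0 i'" using p by blast+
    from p[OF 1] \<open>e0 i = e0 i'\<close> show "x = y" unfolding xy using injD[OF e0] by blast
  qed
  have "\<exists>\<iota> :: (((nat \<times> 'u) \<times> nat) set \<Rightarrow> nat) \<Rightarrow> 'u. inj_on \<iota> (?H A)" if "A \<in> Obj S5Alg_fin" for A
    by (rule finite_support_homs_coding[OF inf inj_e _ _ fib]) (use that in simp_all)
  then obtain \<iota> :: "nat s5_alg \<Rightarrow> (((nat \<times> 'u) \<times> nat) set \<Rightarrow> nat) \<Rightarrow> 'u"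
    where inj: "\<And>A. A \<in> Obj S5Alg_fin \<Longrightarrow> inj_on (\<iota> A) (?H A)" by metis
  let ?F = "frame_functor X ?k \<iota>"
  have F: "?F \<in> Obj (Lex S5Alg_fin SET)" by (rule frame_functor_in_Lex[OF inj fib])
  have "\<exists>c q. c \<in> generators M \<and> q \<in> Surj n (fst c) \<and> Op M n (fst c) q (snd c) = x"
    if "1 \<le> n" "x \<in> Sort M n" for n x
    using generators_cover[OF M that] by (metis fst_conv snd_conv)
  then obtain c q where c: "\<And>n x. \<lbrakk>1 \<le> n; x \<in> Sort M n\<rbrakk> \<Longrightarrow> c n x \<in> generators M"
    and q: "\<And>n x. \<lbrakk>1 \<le> n; x \<in> Sort M n\<rbrakk> \<Longrightarrow> q n x \<in> Surj n (fst (c n x))"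
    and cq: "\<And>n x. \<lbrakk>1 \<le> n; x \<in> Sort M n\<rbrakk> \<Longrightarrow> Op M n (fst (c n x)) (q n x) (snd (c n x)) = x" by metis
  have free: "c n x = d \<and> q n x = s"
    if "1 \<le> n" "x \<in> Sort M n" "d \<in> generators M" "s \<in> Surj n (fst d)" "Op M n (fst d) s (snd d) = x" for n x d s
  proof -
    have "(fst (c n x), snd (c n x)) \<in> generators M" "(fst d, snd d) \<in> generators M" using c[OF that(1,2)] that(3) by simp_all
    from generators_free[OF M that(1) this q[OF that(1,2)] that(4)] cq[OF that(1,2)] that(5)
    show ?thesis by (simp add: prod_eq_iff)
  qed
  \<comment> \<open>the element \<open>q(r)\<close> is sent to the p-morphism from \<open>{1..n}\<close> onto the cluster of \<open>(m, r)\<close> given by \<open>q\<close>\<close>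
  define \<phi> where "\<phi> n x = (\<lambda>S \<in> Pow X. code n {i \<in> {1..n}. (c n x, q n x i) \<in> S})" for n x
  have pm: "p_morphism {1..n} (\<lambda>_. ()) X ?k (\<lambda>i. (d, s i))" if "d \<in> generators M" "s \<in> Surj n (fst d)" for n d s
    unfolding p_morphism_one_cluster
  proof (intro conjI ballI)
    have im: "(\<lambda>i. (d, s i)) ` {1..n} = Pair d ` {1..fst d}" using Surj_image[OF that(2)] by (metis image_image)
    show "(\<lambda>i. (d, s i)) ` {1..n} \<subseteq> X" unfolding im using that(1) by (auto simp: X_def)
    show "(\<lambda>i. (d, s i)) ` {1..n} = {x \<in> X. fst x = fst (d, s z)}" for z
      unfolding im using that(1) by (auto simp: X_def)
  qed
  have \<phi>H: "\<phi> n x \<in> ?H (Simple n)" if nx: "1 \<le> n" "x \<in> Sort M n" for n x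
  proof -
    have "(\<lambda>S \<in> carrier (Cm X ?k). S) \<in> s5_hom (Cm X ?k) (Cm X ?k)" by (rule s5_hom_id[OF s5_algebra_Cm])
    from coded_preimage_hom[OF s5_algebra_Cm this pm[OF c[OF nx] q[OF nx]]]
    have h: "\<phi> n x \<in> s5_hom (Cm X ?k) (Simple n)"
      unfolding \<phi>_def by (simp cong: restrict_cong)
    let ?Y = "{y \<in> X. fst y \<in> {c n x}}"
    have "{i \<in> {1..n}. (c n x, q n x i) \<in> ?Y} = {1..n}"
      using c[OF nx] Surj_range[OF q[OF nx]] by (auto simp: X_def)
    moreover have "?Y \<in> Pow X" by blast
    ultimately have "\<phi> n x ?Y = code n {1..n}" unfolding \<phi>_def by (simp only: restrict_apply if_True)
    also have "\<dots> = tt\<^bsub>Simple n\<^esub>" using code_hom[of n] by (simp add: s5_hom_def one_cluster_def)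
    finally show ?thesis using h unfolding finite_support_homs_def by blast
  qed
  have \<phi>_inj: "x = x'" if nx: "1 \<le> n" "x \<in> Sort M n" "x' \<in> Sort M n" and eq: "\<phi> n x = \<phi> n x'" for n x x'
  proof -
    have pt: "(c n x, q n x i) = (c n x', q n x' i)" if i: "i \<in> {1..n}" for i
    proof -
      have S: "{(c n x, q n x i)} \<in> Pow X"
        using c[OF nx(1,2)] Surj_range[OF q[OF nx(1,2)] i] by (auto simp: X_def)
      have "decode n (\<phi> n x {(c n x, q n x i)}) = decode n (\<phi> n x' {(c n x, q n x i)})" using eq by simp
      then have E: "{j \<in> {1..n}. (c n x, q n x j) \<in> {(c n x, q n x i)}} = {j \<in> {1..n}. (c n x', q n x' j) \<in> {(c n x, q n x i)}}"
        using S unfolding \<phi>_def by (simp only: restrict_apply if_True decode_code_Collect)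
      have "i \<in> {j \<in> {1..n}. (c n x, q n x j) \<in> {(c n x, q n x i)}}" using i by simp
      then show ?thesis unfolding E by simp
    qed
    have "1 \<in> {1..n}" using nx(1) by simp
    then have cc: "c n x = c n x'" using pt by blast
    have qq: "q n x = q n x'"
      by (rule extensionalityI[OF Surj_ext[OF q[OF nx(1,2)]] Surj_ext[OF q[OF nx(1,3)]]]) (use pt in blast)
    have "x = Op M n (fst (c n x)) (q n x) (snd (c n x))" by (rule cq[OF nx(1,2), symmetric])
    also have "\<dots> = Op M n (fst (c n x')) (q n x') (snd (c n x'))" by (simp only: cc qq)
    also have "\<dots> = x'" by (rule cq[OF nx(1,3)])
    finally show "x = x'" .
  qed
  have \<phi>_surj: "\<exists>x \<in> Sort M n. h = \<phi> n x" if n: "1 \<le> n" and h: "h \<in> ?H (Simple n)" for n h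
  proof -
    have hh: "h \<in> s5_hom (Cm X ?k) (Simple n)" using h unfolding finite_support_homs_def by blast
    obtain t where t: "p_morphism {1..n} (\<lambda>_. ()) X ?k t"
      "\<And>S. S \<subseteq> X \<Longrightarrow> decode n (h S) = {i \<in> {1..n}. t i \<in> S}"
      by (rule finite_support_hom_dual_map[OF h fib decode_hom[unfolded one_cluster_def]], rule that)
    have 1: "1 \<in> {1..n}" using n by simp
    have tX: "t ` {1..n} \<subseteq> X" and tim: "t ` {1..n} = {x \<in> X. fst x = fst (t 1)}"
      using t(1) 1 unfolding p_morphism_one_cluster by blast+
    define d where "d = fst (t 1)"
    define s where "s = (\<lambda>i \<in> {1..n}. snd (t i))"
    have d: "d \<in> generators M" using tX 1 unfolding X_def d_def by fastforce
    have ts: "t i = (d, s i)" if "i \<in> {1..n}" for i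
      using tim that unfolding d_def s_def by (auto simp: prod_eq_iff)
    have "s ` {1..n} = {1..fst d}"
    proof -
      have "s ` {1..n} = snd ` t ` {1..n}" by (simp add: s_def image_image)
      also have "\<dots> = snd ` (Pair d ` {1..fst d})"
        unfolding tim d_def[symmetric] using d by (intro arg_cong[of _ _ "image snd"]) (auto simp: X_def)
      finally show ?thesis by (simp add: image_image)
    qed
    then have s: "s \<in> Surj n (fst d)" by (intro SurjI) (simp_all add: s_def)
    have dS: "snd d \<in> Sort M (fst d)" using generatorD(2)[OF M, of "fst d" "snd d"] d by simp
    let ?x = "Op M n (fst d) s (snd d)"
    have x: "?x \<in> Sort M n" by (rule model_closed[OF M n s dS])
    have cx: "c n ?x = d" "q n ?x = s" using free[OF n x d s] by simp_all
    have "h S = \<phi> n ?x S" if S: "S \<in> carrier (Cm X ?k)" for S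
    proof -
      have SX: "S \<in> Pow X" using S by simp
      have "decode n (h S) = {i \<in> {1..n}. t i \<in> S}" using t(2) SX by simp
      also have "\<dots> = {i \<in> {1..n}. (d, s i) \<in> S}" using ts by auto
      finally have "code n (decode n (h S)) = code n {i \<in> {1..n}. (d, s i) \<in> S}" by simp
      then show ?thesis using SX unfolding code_decode[OF s5_hom_closed[OF hh S]] \<phi>_def cx by simp
    qed
    moreover have "\<phi> n ?x \<in> s5_hom (Cm X ?k) (Simple n)" using \<phi>H[OF n x] by (simp add: finite_support_homs_def)
    ultimately have "h = \<phi> n ?x" using s5_hom_eqI[OF hh] by blast
    then show ?thesis using x by blast
  qed
  have \<phi>_nat: "compose (Pow X) (dual m n f) (\<phi> n x) = \<phi> m (Op M m n f x)"
    if m: "1 \<le> m" and n: "1 \<le> n" and f: "f \<in> Surj m n" and x: "x \<in> Sort M n" for m n f x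
  proof (rule compose_eqI)
    have fx: "Op M m n f x \<in> Sort M m" by (rule model_closed[OF M m f x])
    have sc: "snd (c n x) \<in> Sort M (fst (c n x))"
      using generatorD(2)[OF M, of "fst (c n x)" "snd (c n x)"] c[OF n x] by simp
    have "Op M m (fst (c n x)) (compose {1..m} (q n x) f) (snd (c n x)) = Op M m n f x"
      using model_compose[OF M m f q[OF n x] sc] cq[OF n x] by simp
    from free[OF m fx c[OF n x] Surj_compose[OF f q[OF n x]] this]
    have cf: "c m (Op M m n f x) = c n x" and qf: "q m (Op M m n f x) = compose {1..m} (q n x) f" by simp_all
    show "\<phi> m (Op M m n f x) \<in> extensional (Pow X)" by (simp add: \<phi>_def)
    fix S assume S: "S \<in> Pow X"
    have "{i \<in> {1..m}. f i \<in> {i \<in> {1..n}. (c n x, q n x i) \<in> S}} =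
        {i \<in> {1..m}. (c n x, compose {1..m} (q n x) f i) \<in> S}"
      using Surj_range[OF f] by (auto simp: compose_def)
    then show "dual m n f (\<phi> n x S) = \<phi> m (Op M m n f x) S"
      using S unfolding \<phi>_def cf qf
      by (simp only: restrict_apply if_True dual_apply[OF code_Collect_closed] decode_code_Collect)
  qed
  define h where "h = (\<lambda>n \<in> {1..}. \<lambda>x \<in> Sort M n. \<iota> (Simple n) (\<phi> n x))"
  have sF: "Sort (restr ?F) n = \<iota> (Simple n) ` ?H (Simple n)" for n by (simp add: FObj_frame_functor)
  have "h \<in> L_hom M (restr ?F)"
    unfolding L_hom_def
  proof (intro CollectI conjI allI impI ballI)
    show "h \<in> (\<Pi>\<^sub>E n \<in> {1..}. Sort M n \<rightarrow>\<^sub>E Sort (restr ?F) n)"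
      using \<phi>H unfolding h_def sF by auto
    fix m n :: nat and f x assume m: "1 \<le> m" and n: "1 \<le> n" and f: "f \<in> Surj m n" and x: "x \<in> Sort M n"
    have "Op (restr ?F) m n f (h n x) = \<iota> (Simple m) (compose (Pow X) (dual m n f) (\<phi> n x))"
      using FArr_frame_functor[where \<iota> = \<iota> and A = "Simple n", OF inj[OF Simple_Obj] \<phi>H[OF n x]] n x by (simp add: h_def)
    then show "h m (Op M m n f x) = Op (restr ?F) m n f (h n x)"
      using m model_closed[OF M m f x] \<phi>_nat[OF m n f x] by (simp add: h_def)
  qed
  moreover have "bij_betw (h n) (Sort M n) (Sort (restr ?F) n)" if n: "1 \<le> n" for n
    unfolding bij_betw_def
  proof
    show "inj_on (h n) (Sort M n)"
    proof (rule inj_onI)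
      fix x x' assume x: "x \<in> Sort M n" "x' \<in> Sort M n" and "h n x = h n x'"
      then have "\<iota> (Simple n) (\<phi> n x) = \<iota> (Simple n) (\<phi> n x')" using n by (simp add: h_def)
      then have "\<phi> n x = \<phi> n x'" by (rule inj_onD[OF inj[OF Simple_Obj] _ \<phi>H[OF n x(1)] \<phi>H[OF n x(2)]])
      then show "x = x'" by (rule \<phi>_inj[OF n x])
    qed
    have hn: "h n x = \<iota> (Simple n) (\<phi> n x)" if "x \<in> Sort M n" for x using n that by (simp add: h_def)
    show "h n ` Sort M n = Sort (restr ?F) n"
      unfolding sF
    proof (intro subset_antisym subsetI)
      show "z \<in> \<iota> (Simple n) ` ?H (Simple n)" if "z \<in> h n ` Sort M n" for z
        using that hn \<phi>H[OF n] by auto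
      fix z assume "z \<in> \<iota> (Simple n) ` ?H (Simple n)"
      then obtain g where "g \<in> ?H (Simple n)" "z = \<iota> (Simple n) g" by blast
      then obtain x where "x \<in> Sort M n" "z = \<iota> (Simple n) (\<phi> n x)" using \<phi>_surj[OF n] by blast
      then show "z \<in> h n ` Sort M n" using hn by (metis image_eqI)
    qed
  qed
  moreover have "L_structure M" using M by (simp add: model_T2_def)
  ultimately have "is_iso Mod_T2 M (restr ?F) h" by (intro is_iso_Mod_T2)
  then have "\<exists>f. is_iso Mod_T2 (restr ?F) M f" unfolding is_iso_def by blast
  then show ?thesis using F by blast
qed

section \<open>The equivalence\<close>

theorem theorem6p1:
  assumes "infinite (UNIV :: 'u set)"
  shows "has_finite_limits S5Alg_fin \<and>
    equivalent_categories
      (Lex S5Alg_fin (SET :: ('u set, 'u \<Rightarrow> 'u) precategory))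
      (Mod_T2 :: ('u struct, nat \<Rightarrow> 'u \<Rightarrow> 'u) precategory)"
proof
  show "has_finite_limits S5Alg_fin" by (rule has_finite_limits_S5Alg_fin)
  show "equivalent_categories
      (Lex S5Alg_fin (SET :: ('u set, 'u \<Rightarrow> 'u) precategory))
      (Mod_T2 :: ('u struct, nat \<Rightarrow> 'u \<Rightarrow> 'u) precategory)"
  proof (rule equivalence_from_fully_faithful_eso[OF category_Lex[OF category_SET] category_Mod_T2 is_functor_restriction])
    show "bij_betw (FArr restriction F G) (Hom (Lex S5Alg_fin SET) F G)
        (Hom (Mod_T2 :: ('u struct, nat \<Rightarrow> 'u \<Rightarrow> 'u) precategory) (FObj restriction F) (FObj restriction G))"
      if "F \<in> Obj (Lex S5Alg_fin SET)" "G \<in> Obj (Lex S5Alg_fin SET)" for F G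
      using restriction_fully_faithful[OF that] by (simp add: restriction_def Mod_T2_def) (simp add: Lex_def)
    show "\<exists>F \<in> Obj (Lex S5Alg_fin SET). \<exists>f. is_iso Mod_T2 (FObj restriction F) M f"
      if "M \<in> Obj (Mod_T2 :: ('u struct, nat \<Rightarrow> 'u \<Rightarrow> 'u) precategory)" for M
      using restriction_essentially_surjective[OF assms] that by (simp add: Mod_T2_def restriction_def)
  qed
qed

end
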